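(* Suppose that $f$ satisfies the structural assumption (A) stated in the context for some $\rho>0$, let $\Delta t\in\Lambda_f(\rho)$ satisfy $\frac1{\Delta t}>\kappa_f$, and suppose that for each $N\ge0$ the sequence of energies $\{E(u_N^n)\}_n$ of the iterates on $\mathbb{V}_N$ is bounded from below. Let $\{\mathfrak{u}_N\}_{N}$ be the sequence of final approximations generated by the adaptive iterative linearised Galerkin algorithm described in the context. If the sequence of Galerkin spaces $\{\mathbb{V}_N\}_N$ satisfies, with a uniform factor $0<q<1$, \[ \mathcal{E}^{\mathrm{dis}}_{N+1}(\mathfrak{u}_N)\le q\,\mathcal{E}^{\mathrm{dis}}_N(\mathfrak{u}_N)\qquad\forall N\ge0, \] where $\mathcal{E}^{\mathrm{dis}}_{M}(u):=\|E'(u)\|_{\mathbb{V}'}-\|E'(u)\|_{\mathbb{V}_M'}$, and if the sequence $\{\mathfrak{u}_N\}_N$ is bounded in $\mathbb{V}$, then $\{\mathfrak{u}_N\}_N$ has a subsequence that converges weakly in $\mathbb{V}$ and strongly in $L^2(\Omega)$ to a solution $u^\star\in\mathbb{V}$ of the weak formulation \[ \int_\Omega\left(\nabla u^\star\cdot\nabla v-f(\mathbf{x},u^\star)v\right)d\mathbf{x}=0\qquad\forall v\in\mathbb{V}. \] Moreover, if $f$ is continuous on $\overline\Omega\times\mathbb{R}$, then it even holds strong convergence in $\mathbb{V}$ (for a further subsequence).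
   Context: $\Omega\subset\mathbb{R}^d$, $d\in\{1,2,3\}$, is an open bounded polytopal domain with boundary consisting of straight faces. $\mathbb{V}:=H^1_0(\Omega)$. For $\lambda>0$, $|||v|||_\lambda:=(\lambda\|\nabla v\|_{L^2(\Omega)}^2+\|v\|_{L^2(\Omega)}^2)^{1/2}$, $v\in\mathbb{V}$. $C_P>0$ is a constant depending only on $\Omega$ such that $\|v\|_{L^2(\Omega)}^2\le C_P\|\nabla v\|_{L^2(\Omega)}^2$ for all $v\in\mathbb{V}$. $f:\Omega\times\mathbb{R}\to\mathbb{R}$ is a function, with $f(\cdot,u)$ measurable for each $u\in\mathbb{R}$. For $\lambda>0$ let $\sigma_f(\lambda):=\operatorname{ess\,sup}_{\mathbf{x}\in\Omega}\sup_{u\in\mathbb{R}}\left|\frac{\partial f}{\partial u}(\mathbf{x},u)+\frac1\lambda\right|$, and for $\rho>0$ let $\Lambda_f(\rho):=\{\lambda>0:\sigma_f(\lambda)<\rho+\frac1\lambda\}$. Assumption (A) for $\rho>0$: (i) $f(\cdot,0)\in L^2(\Omega)$; (ii) $f$ is differentiable in the second variable; (iii) the set $\Lambda_f(\rho)$ is non-empty. Define $\mu_f:=(\sup\Lambda_f(\rho))^{-1}$ if $\sup\Lambda_f(\rho)<\infty$ and $\mu_f:=0$ otherwise, and $\kappa_f:=\max\{\mu_f+\frac{\rho}{2}-\frac{1}{2C_P},0\}$. Energy functional: $E(u)=\frac12\int_\Omega|\nabla u|^2\,d\mathbf{x}-\int_\Omega\int_0^{u(\mathbf{x})}f(\mathbf{x},s)\,ds\,d\mathbf{x}$,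 $u\in\mathbb{V}$, with derivative $\langle E'(u),v\rangle=\int_\Omega(\nabla u\cdot\nabla v-f(\mathbf{x},u)v)\,d\mathbf{x}$. For a closed subspace $\mathbb{W}\subseteq\mathbb{V}$ the dual norm is $\|E'(u)\|_{\mathbb{W}'}:=\sup_{w\in\mathbb{W}\setminus\{0\}}\frac{|\langle E'(u),w\rangle|}{|||w|||_{\Delta t}}$. For $\lambda>0$: $B_\lambda(u,v):=\int_\Omega(\lambda\nabla u\cdot\nabla v+uv)\,d\mathbf{x}$ for $u,v\in\mathbb{V}$, and $\ell_\lambda(y;v):=\int_\Omega(y+\lambda f(\mathbf{x},y))v\,d\mathbf{x}$ for $y\in L^2(\Omega)$, $v\in\mathbb{V}$. Algorithm. Let $\mathbb{V}_0\subset\mathbb{V}_1\subset\mathbb{V}_2\subset\dots\subset\mathbb{V}$ be finite-dimensional subspaces, $\alpha\in(0,1)$ a fixed parameter, and $u_0^0\in\mathbb{V}_0$ an initial guess. For $N=0,1,2,\dots$: starting from $u_N^0\in\mathbb{V}_N$, iterate $u_N^{n+1}\in\mathbb{V}_N$, $B_{\Delta t}(u_N^{n+1},v)=\ell_{\Delta t}(u_N^n;v)$ for all $v\in\mathbb{V}_N$, $n\ge 0$. Let $n^\star=n^\star(N)\ge1$ be the first index $n\ge1$ for which $|||R_N^{\Delta t}(u_N^n)|||_{\Delta t}\le\alpha\left(E(u_N^0)-E(u_N^n)\right)$, where, for $u\in\mathbb{V}_N$, $R_N^{\Delta t}(u)\in\mathbb{V}_N$ is defined by $B_{\Delta t}(R_N^{\Delta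 t}(u),v)=\langle E'(u),v\rangle$ for all $v\in\mathbb{V}_N$. Set $\mathfrak{u}_N:=u_N^{n^\star(N)}$ and $u_{N+1}^0:=\mathfrak{u}_N\in\mathbb{V}_N\subset\mathbb{V}_{N+1}$. (In the algorithm the space $\mathbb{V}_{N+1}$ may be chosen depending on $\mathfrak{u}_N$.) *)

theory Defs
  imports "HOL-Analysis.Analysis" "HOL-Probability.Essential_Supremum"
begin

text \<open>
  Elements of \<open>L\<^sup>2(\<Omega>)\<close> and of the Sobolev spaces are represented by functions on the whole ambient
  space, of which only the values on \<open>\<Omega>\<close> matter, and only up to Lebesgue null sets. Accordingly
  ``\<open>w = 0\<close>'' for an element of a function space is rendered as ``\<open>w = 0\<close> a.e. in \<open>\<Omega>\<close>''.
\<close>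

section \<open>Domain\<close>

definition polytopal_domain :: "'a::euclidean_space set \<Rightarrow> bool" where
  "polytopal_domain \<Omega> \<longleftrightarrow> open \<Omega> \<and> bounded \<Omega> \<and> \<Omega> \<noteq> {} \<and>
     (\<exists>F. finite F \<and> (\<forall>P\<in>F. polytope P \<and> aff_dim P = int DIM('a) - 1) \<and> frontier \<Omega> = \<Union>F)"

section \<open>Lebesgue and Sobolev spaces\<close>

definition L2 :: "'a::euclidean_space set \<Rightarrow> ('a \<Rightarrow> 'b::euclidean_space) set" where
  "L2 \<Omega> = {g. g \<in> borel_measurable (lebesgue_on \<Omega>) \<and>
             integrable (lebesgue_on \<Omega>) (\<lambda>x. (norm (g x))\<^sup>2)}"

definition L2_norm :: "'a::euclidean_space set \<Rightarrow> ('a \<Rightarrow> 'b::euclidean_space) \<Rightarrow> real" where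
  "L2_norm \<Omega> g = sqrt (\<integral>x. (norm (g x))\<^sup>2 \<partial>lebesgue_on \<Omega>)"

primrec Ck :: "nat \<Rightarrow> ('a::euclidean_space \<Rightarrow> real) \<Rightarrow> bool" where
  "Ck 0 \<phi> \<longleftrightarrow> continuous_on UNIV \<phi>"
| "Ck (Suc k) \<phi> \<longleftrightarrow> (\<forall>x. \<phi> differentiable (at x)) \<and>
     (\<forall>i\<in>Basis. Ck k (\<lambda>x. frechet_derivative \<phi> (at x) i))"

text \<open>\<open>C\<^sub>c\<^sup>\<infinity>(\<Omega>)\<close>, its elements being extended by zero to the whole space.\<close>

definition test_functions :: "'a::euclidean_space set \<Rightarrow> ('a \<Rightarrow> real) set" where
  "test_functions \<Omega> = {\<phi>. (\<forall>k. Ck k \<phi>) \<and> compact (closure {x. \<phi> x \<noteq> 0}) \<and>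
                          closure {x. \<phi> x \<noteq> 0} \<subseteq> \<Omega>}"

definition grad :: "('a::euclidean_space \<Rightarrow> real) \<Rightarrow> 'a \<Rightarrow> 'a" where
  "grad \<phi> x = (\<Sum>i\<in>Basis. frechet_derivative \<phi> (at x) i *\<^sub>R i)"

definition has_weak_gradient ::
    "'a::euclidean_space set \<Rightarrow> ('a \<Rightarrow> real) \<Rightarrow> ('a \<Rightarrow> 'a) \<Rightarrow> bool" where
  "has_weak_gradient \<Omega> u g \<longleftrightarrow> (\<forall>\<phi>\<in>test_functions \<Omega>.
     (\<integral>x. u x *\<^sub>R grad \<phi> x \<partial>lebesgue_on \<Omega>) = - (\<integral>x. \<phi> x *\<^sub>R g x \<partial>lebesgue_on \<Omega>))"

definition H1 :: "'a::euclidean_space set \<Rightarrow> ('a \<Rightarrow> real) set" where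
  "H1 \<Omega> = {u \<in> L2 \<Omega>. \<exists>g\<in>L2 \<Omega>. has_weak_gradient \<Omega> u g}"

text \<open>For \<open>u\<close> in \<open>H1 \<Omega>\<close> the choice is unique up to null sets of \<open>\<Omega>\<close>.\<close>

definition wgrad :: "'a::euclidean_space set \<Rightarrow> ('a \<Rightarrow> real) \<Rightarrow> 'a \<Rightarrow> 'a" where
  "wgrad \<Omega> u = (SOME g. g \<in> L2 \<Omega> \<and> has_weak_gradient \<Omega> u g)"

definition trinorm :: "'a::euclidean_space set \<Rightarrow> real \<Rightarrow> ('a \<Rightarrow> real) \<Rightarrow> real" where
  "trinorm \<Omega> lam v = sqrt (lam * (L2_norm \<Omega> (wgrad \<Omega> v))\<^sup>2 + (L2_norm \<Omega> v)\<^sup>2)"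

definition H1_norm :: "'a::euclidean_space set \<Rightarrow> ('a \<Rightarrow> real) \<Rightarrow> real" where
  "H1_norm \<Omega> v = sqrt ((L2_norm \<Omega> (wgrad \<Omega> v))\<^sup>2 + (L2_norm \<Omega> v)\<^sup>2)"

text \<open>The closure of \<open>C\<^sub>c\<^sup>\<infinity>(\<Omega>)\<close> in \<open>H\<^sup>1(\<Omega>)\<close>.\<close>

definition H10 :: "'a::euclidean_space set \<Rightarrow> ('a \<Rightarrow> real) set" where
  "H10 \<Omega> = {u \<in> H1 \<Omega>. \<exists>\<phi>. (\<forall>n. \<phi> n \<in> test_functions \<Omega>) \<and>
                (\<lambda>n::nat. H1_norm \<Omega> (\<lambda>x. u x - \<phi> n x)) \<longlonglongrightarrow> 0}"

definition H10_functional ::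
    "'a::euclidean_space set \<Rightarrow> (('a \<Rightarrow> real) \<Rightarrow> real) \<Rightarrow> bool" where
  "H10_functional \<Omega> L \<longleftrightarrow>
     (\<forall>u\<in>H10 \<Omega>. \<forall>v\<in>H10 \<Omega>. \<forall>a b. L (\<lambda>x. a * u x + b * v x) = a * L u + b * L v) \<and>
     (\<exists>C. \<forall>v\<in>H10 \<Omega>. \<bar>L v\<bar> \<le> C * H1_norm \<Omega> v)"

definition H10_weakly_converges ::
    "'a::euclidean_space set \<Rightarrow> (nat \<Rightarrow> 'a \<Rightarrow> real) \<Rightarrow> ('a \<Rightarrow> real) \<Rightarrow> bool" where
  "H10_weakly_converges \<Omega> X u \<longleftrightarrow> (\<forall>L. H10_functional \<Omega> L \<longrightarrow> (\<lambda>k. L (X k)) \<longlonglongrightarrow> L u)"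

text \<open>Finite-dimensional subspaces are closed under changing representatives.\<close>

definition fin_dim_subspace ::
    "'a::euclidean_space set \<Rightarrow> ('a \<Rightarrow> real) set \<Rightarrow> bool" where
  "fin_dim_subspace \<Omega> W \<longleftrightarrow> (\<exists>B. finite B \<and> B \<subseteq> H10 \<Omega> \<and>
     W = {u \<in> H10 \<Omega>. \<exists>c. AE x in lebesgue_on \<Omega>. u x = (\<Sum>b\<in>B. c b * b x)})"

definition poincare_constant :: "'a::euclidean_space set \<Rightarrow> real \<Rightarrow> bool" where
  "poincare_constant \<Omega> C \<longleftrightarrow> C > 0 \<and>
     (\<forall>v\<in>H10 \<Omega>. (L2_norm \<Omega> v)\<^sup>2 \<le> C * (L2_norm \<Omega> (wgrad \<Omega> v))\<^sup>2)"

section \<open>Structural assumptions on the nonlinearity\<close>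

definition sigma_f :: "'a::euclidean_space set \<Rightarrow> ('a \<Rightarrow> real \<Rightarrow> real) \<Rightarrow> real \<Rightarrow> ereal" where
  "sigma_f \<Omega> f lam = esssup (lebesgue_on \<Omega>) (\<lambda>x. SUP s. ereal \<bar>deriv (f x) s + 1 / lam\<bar>)"

definition Lambda_f :: "'a::euclidean_space set \<Rightarrow> ('a \<Rightarrow> real \<Rightarrow> real) \<Rightarrow> real \<Rightarrow> real set" where
  "Lambda_f \<Omega> f \<rho> = {lam. lam > 0 \<and> sigma_f \<Omega> f lam < ereal (\<rho> + 1 / lam)}"

definition assumption_A :: "'a::euclidean_space set \<Rightarrow> ('a \<Rightarrow> real \<Rightarrow> real) \<Rightarrow> real \<Rightarrow> bool" where
  "assumption_A \<Omega> f \<rho> \<longleftrightarrow> (\<lambda>x. f x 0) \<in> L2 \<Omega> \<and>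
     (\<forall>x\<in>\<Omega>. \<forall>s. f x differentiable (at s)) \<and> Lambda_f \<Omega> f \<rho> \<noteq> {}"

definition mu_f :: "'a::euclidean_space set \<Rightarrow> ('a \<Rightarrow> real \<Rightarrow> real) \<Rightarrow> real \<Rightarrow> real" where
  "mu_f \<Omega> f \<rho> = (if bdd_above (Lambda_f \<Omega> f \<rho>) then inverse (Sup (Lambda_f \<Omega> f \<rho>)) else 0)"

definition kappa_f ::
    "'a::euclidean_space set \<Rightarrow> ('a \<Rightarrow> real \<Rightarrow> real) \<Rightarrow> real \<Rightarrow> real \<Rightarrow> real" where
  "kappa_f \<Omega> f \<rho> C = max (mu_f \<Omega> f \<rho> + \<rho> / 2 - 1 / (2 * C)) 0"

text \<open>
  Since \<open>f\<close> is only meaningful on \<open>\<Omega> \<times> \<real>\<close>, its continuity on \<open>closure \<Omega> \<times> \<real>\<close> means that it has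
  a continuous extension to that set.
\<close>

definition continuous_up_to_boundary ::
    "'a::euclidean_space set \<Rightarrow> ('a \<Rightarrow> real \<Rightarrow> real) \<Rightarrow> bool" where
  "continuous_up_to_boundary \<Omega> f \<longleftrightarrow>
     (\<exists>g. continuous_on (closure \<Omega> \<times> UNIV) (\<lambda>(x, s). g x s) \<and> (\<forall>x\<in>\<Omega>. \<forall>s. g x s = f x s))"

section \<open>Energy, residuals and dual norms\<close>

definition energy ::
    "'a::euclidean_space set \<Rightarrow> ('a \<Rightarrow> real \<Rightarrow> real) \<Rightarrow> ('a \<Rightarrow> real) \<Rightarrow> real" where
  "energy \<Omega> f u = 1 / 2 * (\<integral>x. (norm (wgrad \<Omega> u x))\<^sup>2 \<partial>lebesgue_on \<Omega>) -
     (\<integral>x. (LBINT s=0..u x. f x s) \<partial>lebesgue_on \<Omega>)"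

definition energy_deriv ::
    "'a::euclidean_space set \<Rightarrow> ('a \<Rightarrow> real \<Rightarrow> real) \<Rightarrow> ('a \<Rightarrow> real) \<Rightarrow> ('a \<Rightarrow> real) \<Rightarrow> real" where
  "energy_deriv \<Omega> f u v =
     (\<integral>x. (wgrad \<Omega> u x \<bullet> wgrad \<Omega> v x - f x (u x) * v x) \<partial>lebesgue_on \<Omega>)"

text \<open>
  Inserting \<open>0\<close> does not affect the supremum of a nonempty set of nonnegative numbers; it gives
  the trivial subspace the dual norm \<open>0\<close>.
\<close>

definition energy_dual_norm ::
    "'a::euclidean_space set \<Rightarrow> ('a \<Rightarrow> real \<Rightarrow> real) \<Rightarrow> real \<Rightarrow> ('a \<Rightarrow> real) set \<Rightarrow> ('a \<Rightarrow> real) \<Rightarrow> real"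
  where
  "energy_dual_norm \<Omega> f dt W u =
     Sup (insert 0 ((\<lambda>w. \<bar>energy_deriv \<Omega> f u w\<bar> / trinorm \<Omega> dt w) `
       {w \<in> W. \<not> (AE x in lebesgue_on \<Omega>. w x = 0)}))"

definition dis_residual ::
    "'a::euclidean_space set \<Rightarrow> ('a \<Rightarrow> real \<Rightarrow> real) \<Rightarrow> real \<Rightarrow> ('a \<Rightarrow> real) set \<Rightarrow> ('a \<Rightarrow> real) \<Rightarrow> real"
  where
  "dis_residual \<Omega> f dt W u = energy_dual_norm \<Omega> f dt (H10 \<Omega>) u - energy_dual_norm \<Omega> f dt W u"

definition weak_solution ::
    "'a::euclidean_space set \<Rightarrow> ('a \<Rightarrow> real \<Rightarrow> real) \<Rightarrow> ('a \<Rightarrow> real) \<Rightarrow> bool" where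
  "weak_solution \<Omega> f u \<longleftrightarrow> u \<in> H10 \<Omega> \<and> (\<forall>v\<in>H10 \<Omega>.
     (\<integral>x. (wgrad \<Omega> u x \<bullet> wgrad \<Omega> v x - f x (u x) * v x) \<partial>lebesgue_on \<Omega>) = 0)"

section \<open>The adaptive iterative linearised Galerkin algorithm\<close>

definition B_form ::
    "'a::euclidean_space set \<Rightarrow> real \<Rightarrow> ('a \<Rightarrow> real) \<Rightarrow> ('a \<Rightarrow> real) \<Rightarrow> real" where
  "B_form \<Omega> lam u v =
     (\<integral>x. (lam * (wgrad \<Omega> u x \<bullet> wgrad \<Omega> v x) + u x * v x) \<partial>lebesgue_on \<Omega>)"

definition ell_form ::
    "'a::euclidean_space set \<Rightarrow> ('a \<Rightarrow> real \<Rightarrow> real) \<Rightarrow> real \<Rightarrow> ('a \<Rightarrow> real) \<Rightarrow> ('a \<Rightarrow> real) \<Rightarrow> real" where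
  "ell_form \<Omega> f lam y v = (\<integral>x. (y x + lam * f x (y x)) * v x \<partial>lebesgue_on \<Omega>)"

text \<open>For a finite-dimensional \<open>W\<close> the choice is unique up to null sets of \<open>\<Omega>\<close>.\<close>

definition residual ::
    "'a::euclidean_space set \<Rightarrow> ('a \<Rightarrow> real \<Rightarrow> real) \<Rightarrow> real \<Rightarrow> ('a \<Rightarrow> real) set \<Rightarrow> ('a \<Rightarrow> real) \<Rightarrow> 'a \<Rightarrow> real"
  where
  "residual \<Omega> f dt W u = (SOME R. R \<in> W \<and> (\<forall>v\<in>W. B_form \<Omega> dt R v = energy_deriv \<Omega> f u v))"

definition stopping_index ::
    "'a::euclidean_space set \<Rightarrow> ('a \<Rightarrow> real \<Rightarrow> real) \<Rightarrow> real \<Rightarrow> real \<Rightarrow> ('a \<Rightarrow> real) set \<Rightarrow>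
     (nat \<Rightarrow> 'a \<Rightarrow> real) \<Rightarrow> nat" where
  "stopping_index \<Omega> f dt \<alpha> W u = (LEAST n. n \<ge> 1 \<and>
     trinorm \<Omega> dt (residual \<Omega> f dt W (u n)) \<le> \<alpha> * (energy \<Omega> f (u 0) - energy \<Omega> f (u n)))"

text \<open>
  \<open>u N n\<close> is the \<open>n\<close>-th iterate on the space \<open>V N\<close> and \<open>U N\<close> the final approximation on \<open>V N\<close>.
  The iterates \<open>u N n\<close> are considered for all \<open>n\<close>, also beyond the stopping index.
\<close>

definition adaptive_ILG ::
    "'a::euclidean_space set \<Rightarrow> ('a \<Rightarrow> real \<Rightarrow> real) \<Rightarrow> real \<Rightarrow> real \<Rightarrow> (nat \<Rightarrow> ('a \<Rightarrow> real) set) \<Rightarrow>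
     (nat \<Rightarrow> nat \<Rightarrow> 'a \<Rightarrow> real) \<Rightarrow> (nat \<Rightarrow> 'a \<Rightarrow> real) \<Rightarrow> bool" where
  "adaptive_ILG \<Omega> f dt \<alpha> V u U \<longleftrightarrow>
     u 0 0 \<in> V 0 \<and>
     (\<forall>N n. u N (Suc n) \<in> V N \<and>
            (\<forall>v\<in>V N. B_form \<Omega> dt (u N (Suc n)) v = ell_form \<Omega> f dt (u N n) v)) \<and>
     (\<forall>N. U N = u N (stopping_index \<Omega> f dt \<alpha> (V N) (u N))) \<and>
     (\<forall>N. u (Suc N) 0 = U N)"

end

theory Submission
  imports Defs "HOL-Complex_Analysis.Great_Picard"
begin

text \<open>
  With the step \<open>w = u\<^sub>N\<^sup>n\<^sup>+\<^sup>1 - u\<^sub>N\<^sup>n\<close> one has \<open>B(w, v) = - \<Delta>t \<langle>E'(u\<^sub>N\<^sup>n), v\<rangle>\<close> on the Galerkin space, so the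
  residual is \<open>- w / \<Delta>t\<close>, and the restriction on \<open>\<Delta>t\<close> makes each step decrease the energy by at
  least \<open>c |||w|||\<^sup>2\<close>. Hence the stopping criterion is reached, and telescoping the energies of the
  final approximations gives \<open>\<rho>\<^sub>N := |||R\<^sub>N(U\<^sub>N)||| \<rightarrow> 0\<close>.

  By Rellich's theorem a subsequence of the bounded sequence \<open>U\<^sub>N\<close> is Cauchy in \<open>L\<^sup>2\<close>, and a further
  one has convergent gradient norms. Testing \<open>E'(U\<^sub>N)\<close> with \<open>U\<^sub>N - U\<^sub>M\<close>, which lies in the \<open>N\<close>-th Galerkin
  space for \<open>M \<le> N\<close>, shows that this subsequence is even Cauchy in \<open>H\<^sup>1\<close>; call its limit \<open>u\<^sup>*\<close>.
  Then \<open>E'(u\<^sup>*)\<close> vanishes on every Galerkin space, so \<open>\<parallel>E'(U\<^sub>N)\<parallel>\<close>, taken in the dual of the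
  \<open>(N+1)\<close>-st space, tends to \<open>0\<close> along the subsequence. The contraction hypothesis bounds
  \<open>(1 - q) \<parallel>E'(U\<^sub>N)\<parallel>\<close>, taken in the dual of the whole space, by that quantity, whence \<open>E'(u\<^sup>*) = 0\<close>.
\<close>

section \<open>Square-integrable functions\<close>

text \<open>Two members of \<open>Lambda_f\<close> do different work. The step \<open>dt\<close>
  itself yields the Lipschitz constant \<open>L\<close>. The one-sided bound \<open>K\<close> on the
  slope of \<open>f\<close> is taken from a member \<open>lam\<close> with \<open>1 / lam\<close>
  close to \<open>mu_f\<close>; this near-optimal choice turns \<open>1 / dt > kappa_f\<close> into
  \<open>1 / dt - K / 2 + 1 / (2 * C\<^sub>P) > 0\<close>. The coefficient
  \<open>1 / dt - K / 2\<close> alone may be negative, and the Poincare inequality then pays for it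
  with a part of the gradient term.

  Since \<open>wgrad\<close> is a Hilbert choice, every computation with it rests on the uniqueness
  of weak gradients up to null sets, hence on the du Bois-Reymond lemma and a supply of smooth bump
  functions.

  Rellich's theorem is proved by comparing a test function with its integrals over small grid cubes:
  countably many such integrals can be made convergent by a diagonal subsequence, and the error is
  controlled by the gradient uniformly in the sequence. All integration by parts, and the
  translation estimate behind that error bound, come from limits of difference quotients.\<close>

lemma L2_measurable: "g \<in> L2 D \<Longrightarrow> g \<in> borel_measurable (lebesgue_on D)"
  by (simp add: L2_def)

lemma L2_square_integrable: "g \<in> L2 D \<Longrightarrow> integrable (lebesgue_on D) (\<lambda>x. (norm (g x))\<^sup>2)"
  by (simp add: L2_def)

lemma L2_bounded_by:
  fixes g :: "'a::euclidean_space \<Rightarrow> 'b::euclidean_space" and h :: "'a \<Rightarrow> 'c::euclidean_space"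
  assumes "h \<in> L2 D" "g \<in> borel_measurable (lebesgue_on D)"
    and "AE x in lebesgue_on D. norm (g x) \<le> norm (h x)"
  shows "g \<in> L2 D"
proof -
  have "integrable (lebesgue_on D) (\<lambda>x. (norm (g x))\<^sup>2)"
  proof (rule Bochner_Integration.integrable_bound[OF L2_square_integrable[OF assms(1)]])
    show "(\<lambda>x. (norm (g x))\<^sup>2) \<in> borel_measurable (lebesgue_on D)"
      using assms(2) by measurable
    show "AE x in lebesgue_on D. norm ((norm (g x))\<^sup>2) \<le> norm ((norm (h x))\<^sup>2)"
      using assms(3) by eventually_elim (auto intro!: power_mono)
  qed
  with assms(2) show ?thesis by (simp add: L2_def)
qed

lemma L2_zero [simp]: "(\<lambda>x. 0) \<in> L2 D"
  by (simp add: L2_def)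

lemma L2_scaleR:
  assumes "g \<in> L2 D"
  shows "(\<lambda>x. a *\<^sub>R g x) \<in> L2 D"
  using assms unfolding L2_def by (auto simp: power_mult_distrib intro!: borel_measurable_scaleR)

lemma L2_cmult: "(g :: _ \<Rightarrow> real) \<in> L2 D \<Longrightarrow> (\<lambda>x. a * g x) \<in> L2 D"
  using L2_scaleR[of g D a] by simp

lemma L2_add:
  assumes g: "g \<in> L2 D" and h: "h \<in> L2 D"
  shows "(\<lambda>x. g x + h x) \<in> L2 D"
proof -
  have m: "g \<in> borel_measurable (lebesgue_on D)" "h \<in> borel_measurable (lebesgue_on D)"
    using assms by (auto simp: L2_measurable)
  have "integrable (lebesgue_on D) (\<lambda>x. (norm (g x + h x))\<^sup>2)"
  proof (rule Bochner_Integration.integrable_bound)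
    show "integrable (lebesgue_on D) (\<lambda>x. 2 * (norm (g x))\<^sup>2 + 2 * (norm (h x))\<^sup>2)"
      using assms by (intro Bochner_Integration.integrable_add integrable_mult_right)
        (auto simp: L2_square_integrable)
    show "(\<lambda>x. (norm (g x + h x))\<^sup>2) \<in> borel_measurable (lebesgue_on D)"
      using m by measurable
    have "(norm (g x + h x))\<^sup>2 \<le> 2 * (norm (g x))\<^sup>2 + 2 * (norm (h x))\<^sup>2" for x
    proof -
      have "(norm (g x + h x))\<^sup>2 \<le> (norm (g x) + norm (h x))\<^sup>2"
        by (intro power_mono norm_triangle_ineq) auto
      also have "\<dots> \<le> 2 * (norm (g x))\<^sup>2 + 2 * (norm (h x))\<^sup>2"
        using sum_squares_bound[of "norm (g x)" "norm (h x)"] by (simp add: power2_sum)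
      finally show ?thesis .
    qed
    then show "AE x in lebesgue_on D. norm ((norm (g x + h x))\<^sup>2)
      \<le> norm (2 * (norm (g x))\<^sup>2 + 2 * (norm (h x))\<^sup>2)"
      by auto
  qed
  with m show ?thesis by (simp add: L2_def)
qed

lemma L2_diff:
  assumes "g \<in> L2 D" "h \<in> L2 D"
  shows "(\<lambda>x. g x - h x) \<in> L2 D"
  using L2_add[OF assms(1) L2_scaleR[OF assms(2), of "-1"]] by simp

lemma L2_lincomb:
  "(u :: _ \<Rightarrow> real) \<in> L2 D \<Longrightarrow> v \<in> L2 D \<Longrightarrow> (\<lambda>x. a * u x + b * v x) \<in> L2 D"
  by (intro L2_add L2_cmult)

lemma L2_inner_integrable:
  assumes g: "g \<in> L2 D" and h: "h \<in> L2 D"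
  shows "integrable (lebesgue_on D) (\<lambda>x. g x \<bullet> h x)"
proof (rule Bochner_Integration.integrable_bound)
  show "integrable (lebesgue_on D) (\<lambda>x. (norm (g x))\<^sup>2 + (norm (h x))\<^sup>2)"
    using assms by (intro Bochner_Integration.integrable_add) (auto simp: L2_square_integrable)
  show "(\<lambda>x. g x \<bullet> h x) \<in> borel_measurable (lebesgue_on D)"
    using assms by (intro borel_measurable_inner) (auto simp: L2_measurable)
  have "\<bar>g x \<bullet> h x\<bar> \<le> (norm (g x))\<^sup>2 + (norm (h x))\<^sup>2" for x
    using Cauchy_Schwarz_ineq2[of "g x" "h x"] sum_squares_bound[of "norm (g x)" "norm (h x)"]
      mult_nonneg_nonneg[OF norm_ge_zero[of "g x"] norm_ge_zero[of "h x"]] by linarith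
  then show "AE x in lebesgue_on D. norm (g x \<bullet> h x) \<le> norm ((norm (g x))\<^sup>2 + (norm (h x))\<^sup>2)"
    by auto
qed

lemma L2_mult_integrable:
  "(u :: _ \<Rightarrow> real) \<in> L2 D \<Longrightarrow> v \<in> L2 D \<Longrightarrow> integrable (lebesgue_on D) (\<lambda>x. u x * v x)"
  using L2_inner_integrable[of u D v] by simp

lemma L2_norm_nonneg [simp]: "0 \<le> L2_norm D g"
  by (simp add: L2_norm_def)

lemma L2_norm_power2: "(L2_norm D g)\<^sup>2 = (\<integral>x. (norm (g x))\<^sup>2 \<partial>lebesgue_on D)"
  unfolding L2_norm_def by (subst real_sqrt_pow2) auto

lemma L2_norm_cong_AE:
  assumes "AE x in lebesgue_on D. g x = h x"
    "g \<in> borel_measurable (lebesgue_on D)" "h \<in> borel_measurable (lebesgue_on D)"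
  shows "L2_norm D g = L2_norm D h"
  unfolding L2_norm_def
  by (intro arg_cong[of _ _ sqrt] integral_cong_AE)
    (use assms in \<open>auto elim: eventually_mono\<close>)

lemma L2_norm_eq_0_iff:
  assumes "g \<in> L2 D"
  shows "L2_norm D g = 0 \<longleftrightarrow> (AE x in lebesgue_on D. g x = 0)"
  unfolding L2_norm_def real_sqrt_eq_0_iff
  by (subst integral_nonneg_eq_0_iff_AE) (auto simp: L2_square_integrable assms)

lemma L2_norm_scaleR: "L2_norm D (\<lambda>x. a *\<^sub>R g x) = \<bar>a\<bar> * L2_norm D g"
  by (simp add: L2_norm_def power_mult_distrib real_sqrt_mult)

lemma L2_norm_cmult: "L2_norm D (\<lambda>x. a * u x :: real) = \<bar>a\<bar> * L2_norm D u"
  using L2_norm_scaleR[of D a u] by simp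

lemma L2_norm_minus_commute: "L2_norm D (\<lambda>x. g x - h x) = L2_norm D (\<lambda>x. h x - g x)"
  by (simp add: L2_norm_def norm_minus_commute)

lemma L2_norm_add_power2:
  assumes "g \<in> L2 D" "h \<in> L2 D"
  shows "(L2_norm D (\<lambda>x. g x + h x))\<^sup>2
    = (L2_norm D g)\<^sup>2 + 2 * (\<integral>x. g x \<bullet> h x \<partial>lebesgue_on D) + (L2_norm D h)\<^sup>2"
proof -
  have eq: "(norm (g x + h x))\<^sup>2 = ((norm (g x))\<^sup>2 + 2 * (g x \<bullet> h x)) + (norm (h x))\<^sup>2" for x
    by (simp add: power2_norm_eq_inner inner_add inner_commute)
  show ?thesis
    using assms unfolding L2_norm_power2 eq
    by (simp add: L2_square_integrable L2_inner_integrable)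
qed

lemma L2_norm_diff_power2:
  assumes "g \<in> L2 D" "h \<in> L2 D"
  shows "(L2_norm D (\<lambda>x. g x - h x))\<^sup>2
    = (L2_norm D g)\<^sup>2 - 2 * (\<integral>x. g x \<bullet> h x \<partial>lebesgue_on D) + (L2_norm D h)\<^sup>2"
  using L2_norm_add_power2[OF assms(1) L2_scaleR[OF assms(2), of "-1"]]
  by (simp add: L2_norm_power2)

lemma L2_Cauchy_Schwarz:
  assumes g: "g \<in> L2 D" and h: "h \<in> L2 D"
  shows "\<bar>\<integral>x. g x \<bullet> h x \<partial>lebesgue_on D\<bar> \<le> L2_norm D g * L2_norm D h"
proof (cases "L2_norm D h = 0")
  case True
  then have "AE x in lebesgue_on D. g x \<bullet> h x = 0"
    using L2_norm_eq_0_iff[OF h] by (auto elim: eventually_mono)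
  then have "(\<integral>x. g x \<bullet> h x \<partial>lebesgue_on D) = 0"
    by (rule integral_eq_zero_AE)
  then show ?thesis by simp
next
  case False
  define A B C where "A = L2_norm D g" and "B = (\<integral>x. g x \<bullet> h x \<partial>lebesgue_on D)"
    and "C = L2_norm D h"
  have C: "C > 0" using False L2_norm_nonneg[of D h] by (simp add: C_def less_le)
  \<comment> \<open>The minimiser of the quadratic
    \<open>t \<mapsto> A\<^sup>2 + 2 * t * B + t\<^sup>2 * C\<^sup>2\<close>.\<close>
  define t where "t = - B / C\<^sup>2"
  have "0 \<le> (L2_norm D (\<lambda>x. g x + t *\<^sub>R h x))\<^sup>2" by simp
  also have "\<dots> = A\<^sup>2 + 2 * t * B + t\<^sup>2 * C\<^sup>2"
    by (subst L2_norm_add_power2[OF g L2_scaleR[OF h]])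
      (simp add: A_def B_def C_def L2_norm_scaleR power_mult_distrib)
  also have "\<dots> = A\<^sup>2 - B\<^sup>2 / C\<^sup>2"
    using C by (simp add: t_def field_simps power2_eq_square)
  finally have "B\<^sup>2 \<le> A\<^sup>2 * C\<^sup>2" using C by (simp add: field_simps)
  then have "B\<^sup>2 \<le> (A * C)\<^sup>2" by (simp add: power_mult_distrib)
  then have "\<bar>B\<bar> \<le> A * C"
    using C L2_norm_nonneg[of D g] unfolding abs_le_square_iff[symmetric]
    by (simp add: A_def abs_mult)
  then show ?thesis by (simp add: A_def B_def C_def)
qed

lemma L2_norm_triangle:
  assumes g: "g \<in> L2 D" and h: "h \<in> L2 D"
  shows "L2_norm D (\<lambda>x. g x + h x) \<le> L2_norm D g + L2_norm D h"
proof (rule power2_le_imp_le)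
  show "(L2_norm D (\<lambda>x. g x + h x))\<^sup>2 \<le> (L2_norm D g + L2_norm D h)\<^sup>2"
    using L2_Cauchy_Schwarz[OF g h] unfolding L2_norm_add_power2[OF g h] power2_sum
    by linarith
qed simp

lemma L2_norm_triangle_diff:
  assumes "g \<in> L2 D" "h \<in> L2 D" "k \<in> L2 D"
  shows "L2_norm D (\<lambda>x. g x - k x) \<le> L2_norm D (\<lambda>x. g x - h x) + L2_norm D (\<lambda>x. h x - k x)"
  using L2_norm_triangle[OF L2_diff[OF assms(1,2)] L2_diff[OF assms(2,3)]] by simp

lemma L2_norm_mono:
  fixes g :: "'a::euclidean_space \<Rightarrow> 'b::euclidean_space" and h :: "'a \<Rightarrow> 'c::euclidean_space"
  assumes "h \<in> L2 D" "g \<in> borel_measurable (lebesgue_on D)"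
    and "AE x in lebesgue_on D. norm (g x) \<le> norm (h x)"
  shows "L2_norm D g \<le> L2_norm D h"
  unfolding L2_norm_def
  by (intro real_sqrt_le_mono integral_mono_AE L2_square_integrable L2_bounded_by[OF assms] assms(1))
    (use assms(3) in eventually_elim, auto intro: power_mono)

lemma L2_integrable:
  assumes "D \<in> lmeasurable" "g \<in> L2 D"
  shows "integrable (lebesgue_on D) g"
proof -
  interpret finite_measure "lebesgue_on D" by (rule finite_measure_lebesgue_on[OF assms(1)])
  show ?thesis
  proof (rule Bochner_Integration.integrable_bound)
    show "integrable (lebesgue_on D) (\<lambda>x. 1 + (norm (g x))\<^sup>2)"
      using assms(2) by (intro Bochner_Integration.integrable_add L2_square_integrable) auto
    have "norm (g x) \<le> 1 + (norm (g x))\<^sup>2" for x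
      using sum_squares_bound[of "norm (g x)" 1] norm_ge_zero[of "g x"] unfolding power2_eq_square
      by linarith
    then show "AE x in lebesgue_on D. norm (g x) \<le> norm (1 + (norm (g x))\<^sup>2)"
      by (auto intro!: AE_I2 order_trans[OF _ abs_ge_self])
  qed (use assms(2) in \<open>simp add: L2_measurable\<close>)
qed

lemma L2_const:
  assumes "D \<in> lmeasurable"
  shows "(\<lambda>x. c) \<in> L2 D"
proof -
  interpret finite_measure "lebesgue_on D" by (rule finite_measure_lebesgue_on[OF assms(1)])
  show ?thesis by (simp add: L2_def)
qed

section \<open>Completeness of the L2 spaces\<close>

text \<open>Cauchy-Schwarz against the constant 1. It turns an L2-Cauchy sequence on a domain of
  finite measure into an L1-Cauchy one.\<close>

lemma L2_norm_le_L1: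
  assumes "D \<in> lmeasurable" "g \<in> L2 D"
  shows "(\<integral>x. norm (g x) \<partial>lebesgue_on D) \<le> L2_norm D (\<lambda>x. 1 :: real) * L2_norm D g"
proof -
  have "(\<lambda>x. norm (g x)) \<in> L2 D"
    using assms(2) by (intro L2_bounded_by[OF assms(2)]) (auto dest: L2_measurable)
  then have "\<bar>\<integral>x. 1 \<bullet> norm (g x) \<partial>lebesgue_on D\<bar>
      \<le> L2_norm D (\<lambda>x. 1 :: real) * L2_norm D (\<lambda>x. norm (g x))"
    by (intro L2_Cauchy_Schwarz L2_const assms(1))
  then show ?thesis by (simp add: L2_norm_def)
qed

text \<open>The Riesz-Fischer argument: the sequence is also L1-Cauchy, so a subsequence converges
  almost everywhere, and Fatou's lemma shows that the pointwise limit is the L2 limit of the whole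
  sequence.\<close>

lemma L2_complete:
  fixes g :: "nat \<Rightarrow> 'a::euclidean_space \<Rightarrow> 'b::euclidean_space"
  assumes D: "D \<in> lmeasurable" and g: "\<And>k. g k \<in> L2 D"
    and Cauchy: "\<And>e. e > 0 \<Longrightarrow> \<exists>K. \<forall>m\<ge>K. \<forall>n\<ge>K. L2_norm D (\<lambda>x. g m x - g n x) < e"
  obtains h where "h \<in> L2 D" "(\<lambda>k. L2_norm D (\<lambda>x. g k x - h x)) \<longlonglongrightarrow> 0"
proof -
  let ?M = "lebesgue_on D" and ?c = "L2_norm D (\<lambda>x. 1 :: real)"
  have meas [measurable]: "g k \<in> borel_measurable ?M" for k
    using g by (rule L2_measurable)
  obtain r where r: "strict_mono r" and rC: "AE x in ?M. Cauchy (\<lambda>i. g (r i) x)"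
  proof (rule cauchy_L1_AE_cauchy_subseq[of ?M g])
    show "integrable ?M (g n)" for n by (rule L2_integrable[OF D g])
    fix e :: real assume "e > 0"
    \<comment> \<open>Adding 1 keeps the divisor positive even when the domain is a null
      set.\<close>
    moreover have c: "?c + 1 > 0" using L2_norm_nonneg[of D "\<lambda>x. 1 :: real"] by linarith
    ultimately have "e / (?c + 1) > 0" by simp
    from Cauchy[OF this] obtain K where
      K: "\<And>m n. m \<ge> K \<Longrightarrow> n \<ge> K \<Longrightarrow> L2_norm D (\<lambda>x. g m x - g n x) < e / (?c + 1)"
      by blast
    have "(\<integral>x. norm (g i x - g j x) \<partial>?M) < e" if "i \<ge> K" "j \<ge> K" for i j
    proof -
      have "(\<integral>x. norm (g i x - g j x) \<partial>?M) \<le> ?c * L2_norm D (\<lambda>x. g i x - g j x)"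
        by (rule L2_norm_le_L1[OF D L2_diff[OF g g]])
      also have "\<dots> \<le> (?c + 1) * L2_norm D (\<lambda>x. g i x - g j x)"
        by (intro mult_right_mono) auto
      also have "\<dots> < e" using K[OF that] c by (simp add: field_simps)
      finally show ?thesis .
    qed
    then show "\<exists>N. \<forall>i\<ge>N. \<forall>j\<ge>N. (\<integral>x. norm (g i x - g j x) \<partial>?M) < e" by blast
  qed (use that in auto)
  define h where "h x = lim (\<lambda>i. g (r i) x)" for x
  have h_meas [measurable]: "h \<in> borel_measurable ?M" unfolding h_def by measurable
  have conv: "AE x in ?M. (\<lambda>i. g (r i) x) \<longlonglongrightarrow> h x"
    using rC by eventually_elim (simp add: h_def Cauchy_convergent_iff convergent_LIMSEQ_iff)
  \<comment> \<open>With \<open>n\<close> fixed, Fatou's lemma is applied along the subsequence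
    \<open>r\<close>; \<open>r i \<ge> i\<close> puts its late members into the range of the Cauchy
    bound.\<close>
  have key: "(\<lambda>x. g n x - h x) \<in> L2 D \<and> L2_norm D (\<lambda>x. g n x - h x) \<le> e"
    if e: "e > 0" and K: "\<And>m. m \<ge> K \<Longrightarrow> L2_norm D (\<lambda>x. g n x - g m x) < e" for n K e
  proof -
    have le: "(\<integral>\<^sup>+x. ennreal ((norm (g n x - h x))\<^sup>2) \<partial>?M) \<le> ennreal (e\<^sup>2)"
    proof -
      have "(\<integral>\<^sup>+x. ennreal ((norm (g n x - h x))\<^sup>2) \<partial>?M)
          = (\<integral>\<^sup>+x. liminf (\<lambda>i. ennreal ((norm (g n x - g (r i) x))\<^sup>2)) \<partial>?M)"
      proof (rule nn_integral_cong_AE)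
        show "AE x in ?M. ennreal ((norm (g n x - h x))\<^sup>2)
          = liminf (\<lambda>i. ennreal ((norm (g n x - g (r i) x))\<^sup>2))"
          using conv
        proof eventually_elim
          case (elim x)
          then have "(\<lambda>i. ennreal ((norm (g n x - g (r i) x))\<^sup>2))
            \<longlonglongrightarrow> ennreal ((norm (g n x - h x))\<^sup>2)"
            by (intro tendsto_intros) auto
          then show ?case by (intro lim_imp_Liminf[symmetric]) auto
        qed
      qed
      also have "\<dots> \<le> liminf (\<lambda>i. \<integral>\<^sup>+x. ennreal ((norm (g n x - g (r i) x))\<^sup>2) \<partial>?M)"
        by (intro nn_integral_liminf) measurable
      also have "\<dots> \<le> limsup (\<lambda>i. \<integral>\<^sup>+x. ennreal ((norm (g n x - g (r i) x))\<^sup>2) \<partial>?M)"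
        by (intro Liminf_le_Limsup) simp
      also have "\<dots> \<le> ennreal (e\<^sup>2)"
      proof (rule Limsup_bounded, rule eventually_sequentiallyI[of K])
        fix i assume "K \<le> i"
        then have "K \<le> r i" using seq_suble[OF r, of i] by simp
        have "(\<integral>\<^sup>+x. ennreal ((norm (g n x - g (r i) x))\<^sup>2) \<partial>?M)
            = ennreal ((L2_norm D (\<lambda>x. g n x - g (r i) x))\<^sup>2)"
          unfolding L2_norm_power2
          by (intro nn_integral_eq_integral L2_square_integrable L2_diff g) auto
        also have "\<dots> \<le> ennreal (e\<^sup>2)"
          using K[OF \<open>K \<le> r i\<close>] e
          by (intro ennreal_leI power_mono) auto
        finally show "(\<integral>\<^sup>+x. ennreal ((norm (g n x - g (r i) x))\<^sup>2) \<partial>?M) \<le> ennreal (e\<^sup>2)" .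
      qed
      finally show ?thesis .
    qed
    have int: "integrable ?M (\<lambda>x. (norm (g n x - h x))\<^sup>2)"
      using le by (intro integrableI_bounded) (auto intro: le_less_trans)
    then have L2: "(\<lambda>x. g n x - h x) \<in> L2 D" by (simp add: L2_def)
    have "ennreal ((L2_norm D (\<lambda>x. g n x - h x))\<^sup>2) \<le> ennreal (e\<^sup>2)"
      using le nn_integral_eq_integral[OF int] by (simp add: L2_norm_power2)
    then have "L2_norm D (\<lambda>x. g n x - h x) \<le> e"
      using e by (auto intro: power2_le_imp_le)
    with L2 show ?thesis by simp
  qed
  have "h \<in> L2 D"
  proof -
    obtain K where "\<And>m n. m \<ge> K \<Longrightarrow> n \<ge> K \<Longrightarrow> L2_norm D (\<lambda>x. g m x - g n x) < 1"
      using Cauchy[of 1] by auto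
    from key[of 1 K, OF _ this[of K]] have "(\<lambda>x. g K x - h x) \<in> L2 D" by simp
    from L2_diff[OF g[of K] this] show ?thesis by simp
  qed
  moreover have "(\<lambda>k. L2_norm D (\<lambda>x. g k x - h x)) \<longlonglongrightarrow> 0"
  proof (rule LIMSEQ_I)
    fix e :: real assume "e > 0"
    then obtain K where
      K: "\<And>m n. m \<ge> K \<Longrightarrow> n \<ge> K \<Longrightarrow> L2_norm D (\<lambda>x. g m x - g n x) < e / 2"
      using Cauchy[of "e / 2"] by auto
    have "L2_norm D (\<lambda>x. g n x - h x) \<le> e / 2" if "n \<ge> K" for n
      using key[of "e / 2" K n] K[OF that] \<open>e > 0\<close> by simp
    then show "\<exists>K. \<forall>n\<ge>K. norm (L2_norm D (\<lambda>x. g n x - h x) - 0) < e"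
      using \<open>e > 0\<close> by (intro exI[of _ K]) force
  qed
  ultimately show ?thesis by (rule that)
qed

text \<open>Allows a function and its weak gradient to be treated as one L2 function with values in
  a product space.\<close>

lemma L2_Pair_iff:
  fixes g :: "'a::euclidean_space \<Rightarrow> 'b::euclidean_space" and h :: "'a \<Rightarrow> 'c::euclidean_space"
  shows "(\<lambda>x. (g x, h x)) \<in> L2 D \<longleftrightarrow> g \<in> L2 D \<and> h \<in> L2 D"
proof
  assume a: "(\<lambda>x. (g x, h x)) \<in> L2 D"
  have "(\<lambda>x. fst (g x, h x)) \<in> borel_measurable (lebesgue_on D)"
    "(\<lambda>x. snd (g x, h x)) \<in> borel_measurable (lebesgue_on D)"
    using L2_measurable[OF a] unfolding borel_prod[symmetric] by measurable
  then show "g \<in> L2 D \<and> h \<in> L2 D"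
    by (auto intro!: L2_bounded_by[OF a]simp: norm_prod_def real_le_rsqrt)
next
  assume "g \<in> L2 D \<and> h \<in> L2 D"
  then show "(\<lambda>x. (g x, h x)) \<in> L2 D"
    unfolding L2_def norm_prod_def by (auto intro: borel_measurable_Pair)
qed

lemma L2_norm_Pair:
  fixes g :: "'a::euclidean_space \<Rightarrow> 'b::euclidean_space" and h :: "'a \<Rightarrow> 'c::euclidean_space"
  assumes "g \<in> L2 D" "h \<in> L2 D"
  shows "L2_norm D (\<lambda>x. (g x, h x)) = sqrt ((L2_norm D g)\<^sup>2 + (L2_norm D h)\<^sup>2)"
  using assms unfolding L2_norm_power2 by (simp add: L2_norm_def norm_prod_def L2_square_integrable)

section \<open>Smooth bump functions and the du Bois-Reymond lemma\<close>

abbreviation supp :: "('a::topological_space \<Rightarrow> real) \<Rightarrow> 'a set" where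
  "supp \<phi> \<equiv> closure {x. \<phi> x \<noteq> 0}"

section \<open>Calculus of k times continuously differentiable functions\<close>

lemma frechet_derivative_eq:
  "(f has_derivative f') (at x) \<Longrightarrow> frechet_derivative f (at x) = f'"
  using frechet_derivative_at by metis

lemma Ck_SucD: "Ck (Suc k) \<phi> \<Longrightarrow> Ck k \<phi>"
proof (induction k arbitrary: \<phi>)
  case 0
  then show ?case
    by (auto intro!: continuous_at_imp_continuous_on differentiable_imp_continuous_within)
next
  case (Suc k)
  then show ?case by (metis Ck.simps(2))
qed

lemma Ck_continuous: "Ck k \<phi> \<Longrightarrow> continuous_on UNIV \<phi>"
  by (induction k) (auto dest: Ck_SucD simp del: Ck.simps(2))

lemma Ck_const: "Ck k (\<lambda>x. c)"
  by (induction k arbitrary: c) (auto simp: frechet_derivative_const)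

lemma Ck_lincomb: "Ck k \<phi> \<Longrightarrow> Ck k \<psi> \<Longrightarrow> Ck k (\<lambda>x. a * \<phi> x + b * \<psi> x)"
proof (induction k arbitrary: \<phi> \<psi>)
  case 0
  then show ?case by (auto intro!: continuous_intros)
next
  case (Suc k)
  have d: "((\<lambda>x. a * \<phi> x + b * \<psi> x) has_derivative
    (\<lambda>h. a * frechet_derivative \<phi> (at x) h + b * frechet_derivative \<psi> (at x) h)) (at x)" for x
    using Suc.prems by (auto intro!: derivative_intros simp: frechet_derivative_works[symmetric])
  show ?case
    using Suc by (auto simp: frechet_derivative_eq[OF d] intro: differentiableI[OF d])
qed

lemma Ck_mult: "Ck k \<phi> \<Longrightarrow> Ck k \<psi> \<Longrightarrow> Ck k (\<lambda>x. \<phi> x * \<psi> x)"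
proof (induction k arbitrary: \<phi> \<psi>)
  case 0
  then show ?case by (auto intro!: continuous_intros)
next
  case (Suc k)
  have d: "((\<lambda>x. \<phi> x * \<psi> x) has_derivative
    (\<lambda>h. \<phi> x * frechet_derivative \<psi> (at x) h + frechet_derivative \<phi> (at x) h * \<psi> x)) (at x)" for x
    using Suc.prems by (auto intro!: derivative_intros simp: frechet_derivative_works[symmetric])
  have "Ck k (\<lambda>x. \<phi> x * frechet_derivative \<psi> (at x) i + frechet_derivative \<phi> (at x) i * \<psi> x)"
    if "i \<in> Basis" for i
    using Ck_lincomb[OF Suc.IH[OF Ck_SucD[OF Suc.prems(1)], of "\<lambda>x. frechet_derivative \<psi> (at x) i"]
        Suc.IH[OF _ Ck_SucD[OF Suc.prems(2)], of "\<lambda>x. frechet_derivative \<phi> (at x) i"], of 1 1]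
      Suc.prems that by simp
  then show ?case
    by (auto simp: frechet_derivative_eq[OF d] intro: differentiableI[OF d])
qed

lemma Ck_prod: "finite I \<Longrightarrow> (\<And>i. i \<in> I \<Longrightarrow> Ck k (\<phi> i)) \<Longrightarrow> Ck k (\<lambda>x. \<Prod>i\<in>I. \<phi> i x)"
  by (induction I rule: finite_induct) (auto intro: Ck_mult Ck_const)

text \<open>
  The functions \<open>exp (-1/t) p(1/t)\<close>, extended by zero to \<open>t \<le> 0\<close>, with \<open>p\<close> a polynomial,
  form a family that is closed under differentiation.
\<close>

definition flat_exp :: "real poly \<Rightarrow> real \<Rightarrow> real" where
  "flat_exp p t = (if t > 0 then exp (- inverse t) * poly p (inverse t) else 0)"

text \<open>Substituting \<open>y = 1/t\<close> reduces the claim to the decay of polynomial over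
  exponential at infinity.\<close>

lemma flat_exp_at_right: "(flat_exp p \<longlongrightarrow> 0) (at_right 0)"
proof -
  have eq: "poly p y / exp y = (\<Sum>i\<le>degree p. coeff p i * (y ^ i / exp y))" for y :: real
    by (simp add: poly_altdef sum_divide_distrib)
  have "((\<lambda>y. poly p y / exp y) \<longlongrightarrow> (\<Sum>i\<le>degree p. coeff p i * 0)) at_top"
    unfolding eq by (intro tendsto_intros tendsto_power_div_exp_0)
  then have "((\<lambda>y. poly p y / exp y) \<longlongrightarrow> 0) at_top" by simp
  from filterlim_compose[OF this filterlim_inverse_at_top_right]
  have "((\<lambda>t. poly p (inverse t) / exp (inverse t)) \<longlongrightarrow> 0) (at_right 0)" .
  moreover have "\<forall>\<^sub>F t in at_right (0::real). poly p (inverse t) / exp (inverse t) = flat_exp p t"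
    by (auto simp: eventually_at_right_field flat_exp_def exp_minus field_simps intro: exI[of _ 1])
  ultimately show ?thesis by (rule Lim_transform_eventually)
qed

text \<open>With \<open>y = 1/t\<close>, differentiating \<open>exp (- y) * p(y)\<close> gives the
  factor \<open>y\<^sup>2\<close> from the inner derivative and \<open>p - p'\<close> from the
  product rule; \<open>[:0,0,1:]\<close> is the polynomial \<open>y\<^sup>2\<close>. Only the point
  0 needs a limit argument.\<close>

lemma flat_exp_DERIV: "(flat_exp p has_real_derivative flat_exp ([:0,0,1:] * (p - pderiv p)) t) (at t)"
proof -
  consider "t > 0" | "t < 0" | "t = 0" by linarith
  then show ?thesis
  proof cases
    case 1
    have "((\<lambda>t. exp (- inverse t) * poly p (inverse t)) has_real_derivative
        flat_exp ([:0,0,1:] * (p - pderiv p)) t) (at t)"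
      using 1 by (auto intro!: derivative_eq_intros DERIV_chain2[where f="poly p"] poly_DERIV
        simp: flat_exp_def power2_eq_square field_simps)
    then show ?thesis
      by (rule has_field_derivative_transform_within_open[where S="{0<..}"])
        (use 1 in \<open>auto simp: flat_exp_def\<close>)
  next
    case 2
    have "((\<lambda>t. 0) has_real_derivative 0) (at t)" by simp
    then have "(flat_exp p has_real_derivative 0) (at t)"
      by (rule has_field_derivative_transform_within_open[where S="{..<0}"])
        (use 2 in \<open>auto simp: flat_exp_def\<close>)
    then show ?thesis using 2 by (simp add: flat_exp_def)
  next
    case 3
    have "((\<lambda>h. (flat_exp p (0 + h) - flat_exp p 0) / h) \<longlongrightarrow> 0) (at_left 0)"
      by (rule tendsto_eventually) (auto simp: eventually_at_left_field flat_exp_def intro: exI[of _ "-1"])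
    \<comment> \<open>Dividing by \<open>h\<close> multiplies the polynomial by its variable, so the
      quotient is \<open>flat_exp (pCons 0 p) h\<close>.\<close>
    moreover have "((\<lambda>h. (flat_exp p (0 + h) - flat_exp p 0) / h) \<longlongrightarrow> 0) (at_right 0)"
      by (rule Lim_transform_eventually[OF flat_exp_at_right[of "pCons 0 p"]])
        (auto simp: eventually_at_right_field flat_exp_def field_simps intro: exI[of _ 1])
    ultimately show ?thesis
      using 3 unfolding DERIV_def filterlim_at_split by (simp add: flat_exp_def)
  qed
qed

text \<open>The induction must range over all \<open>p\<close>, because each derivative replaces the
  polynomial by another one.\<close>

lemma Ck_flat_exp: "Ck k (\<lambda>x. flat_exp p (c * (x \<bullet> v) + d))"
proof (induction k arbitrary: p)
  case 0
  have "continuous_on UNIV (flat_exp p)"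
    by (intro continuous_at_imp_continuous_on ballI DERIV_isCont[OF flat_exp_DERIV])
  moreover have "continuous_on UNIV (\<lambda>x. c * (x \<bullet> v) + d)" by (intro continuous_intros)
  ultimately show ?case by (auto intro: continuous_on_compose2)
next
  case (Suc k)
  let ?p = "[:0,0,1:] * (p - pderiv p)"
  have d: "((\<lambda>x. flat_exp p (c * (x \<bullet> v) + d)) has_derivative
     (\<lambda>h. (c * (h \<bullet> v)) * flat_exp ?p (c * (x \<bullet> v) + d))) (at x)" for x
    by (rule has_derivative_eq_rhs[OF has_derivative_compose[OF _
            flat_exp_DERIV[unfolded has_field_derivative_def]]])
      (auto intro!: derivative_eq_intros)
  have "Ck k (\<lambda>x. (c * (i \<bullet> v)) * flat_exp ?p (c * (x \<bullet> v) + d))" for i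
    by (intro Ck_mult Ck_const Suc.IH)
  then show ?case
    by (auto simp only: Ck.simps frechet_derivative_eq[OF d] intro: differentiableI[OF d])
qed

lemma closed_subset_compact: "closed T \<Longrightarrow> compact S \<Longrightarrow> T \<subseteq> S \<Longrightarrow> compact T"
  using compact_Int_closed[of S T] by (simp add: Int_absorb1)

lemma test_functions_lincomb:
  assumes "\<phi> \<in> test_functions D" "\<psi> \<in> test_functions D"
  shows "(\<lambda>x. a * \<phi> x + b * \<psi> x) \<in> test_functions D"
proof -
  let ?S = "supp \<phi> \<union> supp \<psi>"
  have "closure {x. a * \<phi> x + b * \<psi> x \<noteq> 0} \<subseteq> ?S"
    unfolding closure_Un[symmetric] by (rule closure_mono) auto
  moreover have "compact ?S" using assms by (auto simp: test_functions_def intro: compact_Un)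
  ultimately have "compact (closure {x. a * \<phi> x + b * \<psi> x \<noteq> 0})"
    "closure {x. a * \<phi> x + b * \<psi> x \<noteq> 0} \<subseteq> D"
    using assms closed_subset_compact[OF closed_closure, of ?S] unfolding test_functions_def
    by blast+
  then show ?thesis
    using assms unfolding test_functions_def by (auto intro!: Ck_lincomb)
qed

section \<open>Bump functions approximating indicators of boxes\<close>

text \<open>Each factor is a smooth step in \<open>n\<close> times the signed distance to one face
  of the box. Increasing \<open>n\<close> steepens the steps, so the bumps tend pointwise to the
  indicator of the open box.\<close>

definition box_bump :: "'a::euclidean_space \<Rightarrow> 'a \<Rightarrow> nat \<Rightarrow> 'a \<Rightarrow> real" where
  "box_bump a b n x = (\<Prod>i\<in>Basis. flat_exp 1 (real n * (x \<bullet> i) + real n * - (a \<bullet> i))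
     * flat_exp 1 (- real n * (x \<bullet> i) + real n * (b \<bullet> i)))"

lemma box_bump_eq_0: "x \<notin> box a b \<Longrightarrow> box_bump a b n x = 0"
proof -
  assume "x \<notin> box a b"
  then obtain i where i: "i \<in> Basis" "x \<bullet> i \<le> a \<bullet> i \<or> b \<bullet> i \<le> x \<bullet> i"
    by (auto simp: mem_box not_less)
  then have "flat_exp 1 (real n * (x \<bullet> i) + real n * - (a \<bullet> i))
     * flat_exp 1 (- real n * (x \<bullet> i) + real n * (b \<bullet> i)) = 0"
    by (auto simp: flat_exp_def zero_less_mult_iff mult_left_mono not_less
        simp flip: right_diff_distrib)
  then show ?thesis using i(1) unfolding box_bump_def by (intro prod_zero) auto
qed

lemma box_bump_test_function:
  assumes "cbox a b \<subseteq> D"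
  shows "box_bump a b n \<in> test_functions D"
proof -
  have "closure {x. box_bump a b n x \<noteq> 0} \<subseteq> cbox a b"
    using box_bump_eq_0[of _ a b n] box_subset_cbox[of a b] by (intro closure_minimal) auto
  moreover have "Ck k (box_bump a b n)" for k
    unfolding box_bump_def[abs_def] by (intro Ck_prod Ck_mult Ck_flat_exp) auto
  ultimately show ?thesis
    using assms closed_subset_compact[OF closed_closure compact_cbox] by (auto simp: test_functions_def)
qed

lemma flat_exp_1_bounds: "0 \<le> flat_exp 1 t" "flat_exp 1 t \<le> 1"
  by (auto simp: flat_exp_def)

lemma box_bump_bound: "norm (box_bump a b n x) \<le> 1"
proof -
  have "0 \<le> box_bump a b n x" "box_bump a b n x \<le> 1"
    unfolding box_bump_def
    by (auto intro!: prod_nonneg prod_le_1 mult_nonneg_nonneg mult_le_one flat_exp_1_bounds)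
  then show ?thesis by simp
qed

lemma flat_exp_limit:
  "(\<lambda>n. flat_exp 1 (real n * t)) \<longlonglongrightarrow> (if t > 0 then 1 else 0)"
proof (cases "t > 0")
  case True
  have "filterlim (\<lambda>n. real n * t) at_top sequentially"
    using True filterlim_real_sequentially
    by (intro filterlim_at_top_mult_tendsto_pos[OF tendsto_const]) auto
  then have "(\<lambda>n. inverse (real n * t)) \<longlonglongrightarrow> 0"
    by (rule tendsto_inverse_0_at_top)
  then have "(\<lambda>n. exp (- inverse (real n * t))) \<longlonglongrightarrow> exp (- 0)"
    by (intro tendsto_intros)
  moreover have "\<forall>\<^sub>F n in sequentially. exp (- inverse (real n * t)) = flat_exp 1 (real n * t)"
    using True by (auto simp: flat_exp_def eventually_sequentially intro!: exI[of _ 1])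
  ultimately show ?thesis using True by (auto intro: Lim_transform_eventually)
next
  case False
  then have "real n * t \<le> 0" for n by (simp add: mult_nonneg_nonpos)
  then show ?thesis using False by (simp add: flat_exp_def not_less[symmetric])
qed

lemma box_bump_limit: "(\<lambda>n. box_bump a b n x) \<longlonglongrightarrow> indicator (box a b) x"
proof -
  have "(\<lambda>n. box_bump a b n x) \<longlonglongrightarrow> (\<Prod>i\<in>Basis.
     (if x \<bullet> i - a \<bullet> i > 0 then 1 else 0) * (if b \<bullet> i - x \<bullet> i > 0 then 1 else 0))"
    using tendsto_prod[of Basis, OF tendsto_mult[OF flat_exp_limit flat_exp_limit],
        of "\<lambda>i. x \<bullet> i - a \<bullet> i" "\<lambda>i. b \<bullet> i - x \<bullet> i"]
    unfolding box_bump_def by (simp add: algebra_simps)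
  moreover have "(\<Prod>i\<in>Basis.
     (if x \<bullet> i - a \<bullet> i > 0 then 1 else 0) * (if b \<bullet> i - x \<bullet> i > 0 then 1 else 0))
     = (indicator (box a b) x :: real)"
  proof (cases "x \<in> box a b")
    case True
    then show ?thesis by (auto simp: mem_box intro!: prod.neutral)
  next
    case False
    then obtain i where "i \<in> Basis" "\<not> (a \<bullet> i < x \<bullet> i \<and> x \<bullet> i < b \<bullet> i)" by (auto simp: mem_box)
    then show ?thesis using False by (auto intro!: prod_zero bexI[of _ i])
  qed
  ultimately show ?thesis by simp
qed

section \<open>Functions determined by their integrals against test functions\<close>

text \<open>Boxes form an intersection-stable generator of the Borel sets, and the sets over which
  \<open>h\<close> integrates to zero form a Dynkin system; \<open>total\<close> is what makes it
  closed under complements.\<close>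

lemma integral_zero_on_boxes_imp_AE_zero:
  fixes h :: "'a::euclidean_space \<Rightarrow> real"
  assumes h: "integrable lborel h"
    and box: "\<And>a b. (\<integral>x. indicator (box a b) x * h x \<partial>lborel) = 0"
    and total: "(\<integral>x. h x \<partial>lborel) = 0"
  shows "AE x in lborel. h x = 0"
proof (rule sigma_finite_measure.density_zero[OF sigma_finite_lborel h])
  fix A :: "'a set" assume A: "A \<in> sets lborel"
  have int: "set_integrable lborel B h" if "B \<in> sets borel" for B
    using integrable_mult_indicator[OF _ h, of B] that by (simp add: set_integrable_def)
  let ?G = "range (\<lambda>(a, b). box a b :: 'a set)"
  have sets: "sigma_sets UNIV ?G = sets borel" by (simp add: borel_eq_box)
  have stable: "Int_stable ?G" by (auto simp: Int_stable_def box_Int_box)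
  from A have A': "A \<in> sigma_sets UNIV ?G" by (simp add: sets)
  have G: "?G \<subseteq> Pow UNIV" by simp
  from stable G A' show "set_lebesgue_integral lborel A h = 0"
  proof (induction rule: sigma_sets_induct_disjoint)
    case (basic A)
    then show ?case using box by (auto simp: set_lebesgue_integral_def)
  next
    case empty
    show ?case by (simp add: set_lebesgue_integral_def)
  next
    case (compl A)
    have "(\<integral>x. h x \<partial>lborel) = set_lebesgue_integral lborel (A \<union> (UNIV - A)) h"
      by (simp add: set_lebesgue_integral_def)
    also have "\<dots> = set_lebesgue_integral lborel A h + set_lebesgue_integral lborel (UNIV - A) h"
      using compl(1) unfolding sets by (intro set_integral_Un int) auto
    finally show ?case using compl total by simp
  next
    case (union A)
    have "set_lebesgue_integral lborel (\<Union>i. A i) h = (\<Sum>i. set_lebesgue_integral lborel (A i) h)"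
      using union(1,2) unfolding sets
      by (intro lebesgue_integral_countable_add int) (auto simp: disjoint_family_on_def)
    then show ?case using union by simp
  qed
qed

lemma AE_lebesgue_on_iff:
  "D \<in> sets lebesgue \<Longrightarrow> (AE x in lebesgue_on D. P x) \<longleftrightarrow> (AE x in lebesgue. x \<in> D \<longrightarrow> P x)"
  by (rule AE_restrict_space_iff) simp

text \<open>Bumps tend boundedly to indicators of boxes, so \<open>g\<close> has zero integral over
  every box whose closure lies in \<open>D\<close>. Hence it vanishes almost everywhere on each
  closed box inside \<open>D\<close>, and countably many of these cover \<open>D\<close>.\<close>

lemma du_Bois_Reymond:
  fixes g :: "'a::euclidean_space \<Rightarrow> real"
  assumes D: "open D" and g: "integrable (lebesgue_on D) g"
    and zero: "\<And>\<phi>. \<phi> \<in> test_functions D \<Longrightarrow> (\<integral>x. \<phi> x * g x \<partial>lebesgue_on D) = 0"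
  shows "AE x in lebesgue_on D. g x = 0"
proof -
  have Dl: "D \<in> sets lebesgue" using D by auto
  have box0: "(\<integral>x. indicator (box a b) x * g x \<partial>lebesgue_on D) = 0"
    if "box a b = {} \<or> cbox a b \<subseteq> D" for a b
  proof (cases "box a b = {}")
    case False
    with that have ab: "cbox a b \<subseteq> D" by simp
    have cont: "continuous_on UNIV (box_bump a b n)" for n
      unfolding box_bump_def[abs_def] by (intro Ck_continuous[of 0] Ck_prod Ck_mult Ck_flat_exp) auto
    have "(\<lambda>n. \<integral>x. box_bump a b n x * g x \<partial>lebesgue_on D)
       \<longlonglongrightarrow> (\<integral>x. indicator (box a b) x * g x \<partial>lebesgue_on D)"
    proof (rule integral_dominated_convergence[where w="\<lambda>x. norm (g x)"])
      show "(\<lambda>x. indicator (box a b) x * g x) \<in> borel_measurable (lebesgue_on D)"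
        using borel_measurable_integrable[OF g] Dl ab box_subset_cbox[of a b]
        by (intro borel_measurable_times borel_measurable_indicator) (auto simp: sets_restrict_space_iff)
      show "(\<lambda>x. box_bump a b n x * g x) \<in> borel_measurable (lebesgue_on D)" for n
        using borel_measurable_integrable[OF g] Dl
          continuous_imp_measurable_on_sets_lebesgue[OF continuous_on_subset[OF cont]]
        by (intro borel_measurable_times) auto
      show "AE x in lebesgue_on D. (\<lambda>n. box_bump a b n x * g x) \<longlonglongrightarrow> indicator (box a b) x * g x"
        by (intro AE_I2 tendsto_intros box_bump_limit)
      show "AE x in lebesgue_on D. norm (box_bump a b n x * g x) \<le> norm (g x)" for n
        using box_bump_bound[of a b n]
        by (intro AE_I2) (auto simp: abs_mult intro: mult_left_le_one_le)
    qed (use g in auto)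
    moreover have "(\<integral>x. box_bump a b n x * g x \<partial>lebesgue_on D) = 0" for n
      by (rule zero[OF box_bump_test_function[OF ab]])
    ultimately show ?thesis by (simp add: LIMSEQ_const_iff)
  qed simp
  have box_AE: "AE x in lebesgue. x \<in> cbox c d \<longrightarrow> g x = 0" if cd: "cbox c d \<subseteq> D" for c d
  proof -
    define h where "h x = indicator (box c d) x * g x" for x
    have bcd: "box c d \<subseteq> D" using cd box_subset_cbox by blast
    have hint: "integrable lebesgue h"
    proof -
      have "integrable lebesgue (\<lambda>x. indicator (box c d) x *\<^sub>R (indicator D x *\<^sub>R g x))"
        using g integrable_restrict_space[of D lebesgue g] Dl
        by (intro integrable_mult_indicator[of "box c d"]) auto
      also have "(\<lambda>x. indicator (box c d) x *\<^sub>R (indicator D x *\<^sub>R g x)) = h"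
        using bcd by (auto simp: h_def indicator_def fun_eq_iff)
      finally show ?thesis .
    qed
    \<comment> \<open>Intersecting an arbitrary box with \<open>box c d\<close> gives a box whose
      closure stays in \<open>cbox c d\<close>, so cutting \<open>g\<close> off to
      \<open>box c d\<close> makes its integral over every box vanish.\<close>
    have hbox: "(\<integral>x. indicator (box a b) x * h x \<partial>lebesgue) = 0" for a b
    proof -
      obtain a' b' where ab': "box a b \<inter> box c d = box a' b'" using box_Int_box[of a b c d] by blast
      have "box a' b' = {} \<or> cbox a' b' \<subseteq> D"
      proof (cases "box a' b' = {}")
        case False
        have "box a' b' \<subseteq> cbox c d" using ab' box_subset_cbox[of c d] by blast
        then have "closure (box a' b') \<subseteq> cbox c d" by (intro closure_minimal closed_cbox)
        then show ?thesis using cd False by simp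
      qed simp
      from box0[OF this] have "(\<integral>x. indicator D x *\<^sub>R (indicator (box a' b') x * g x) \<partial>lebesgue) = 0"
        using Dl by (simp add: integral_restrict_space)
      also have "(\<lambda>x. indicator D x *\<^sub>R (indicator (box a' b') x * g x)) = (\<lambda>x. indicator (box a b) x * h x)"
        unfolding ab'[symmetric] using bcd by (auto simp: h_def indicator_def fun_eq_iff)
      finally show ?thesis .
    qed
    \<comment> \<open>The Dynkin argument runs over Borel sets and \<open>lborel\<close>, so the
      Lebesgue measurable \<open>h\<close> is exchanged for a Borel representative.\<close>
    obtain h' where h'm [measurable]: "h' \<in> borel_measurable lborel" and h': "AE x in lborel. h x = h' x"
      using completion_ex_borel_measurable_real[of h lborel] hint by auto
    have hm: "h \<in> borel_measurable lebesgue" and h'ml: "h' \<in> borel_measurable lebesgue"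
      using borel_measurable_integrable[OF hint] measurable_completion[OF h'm] by auto
    have hh': "AE x in lebesgue. h x = h' x" using h' by (rule AE_completion)
    have "integrable lebesgue h'"
      using hint hh' by (subst integrable_cong_AE[OF h'ml hm]) auto
    then have h'int: "integrable lborel h'" by (simp add: integrable_completion)
    have h'box: "(\<integral>x. indicator (box a b) x * h' x \<partial>lborel) = 0" for a b
    proof -
      have "(\<integral>x. indicator (box a b) x * h' x \<partial>lborel) = (\<integral>x. indicator (box a b) x * h' x \<partial>lebesgue)"
        by (rule integral_completion[symmetric]) measurable
      also have "\<dots> = (\<integral>x. indicator (box a b) x * h x \<partial>lebesgue)"
        by (rule integral_cong_AE)
          (use hh' hm h'ml in \<open>auto intro!: borel_measurable_times borel_measurable_indicator
            elim: eventually_mono\<close>)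
      finally show ?thesis using hbox by simp
    qed
    have "(\<integral>x. h' x \<partial>lborel) = 0"
    proof -
      have "(\<integral>x. h' x \<partial>lborel) = (\<integral>x. h' x \<partial>lebesgue)"
        by (rule integral_completion[symmetric]) measurable
      also have "\<dots> = (\<integral>x. h x \<partial>lebesgue)"
        by (rule integral_cong_AE)
          (use hh' hm h'ml in \<open>auto intro!: borel_measurable_times borel_measurable_indicator
            elim: eventually_mono\<close>)
      also have "h = (\<lambda>x. indicator (box c d) x * h x)" by (auto simp: h_def indicator_def)
      finally show ?thesis using hbox by simp
    qed
    from integral_zero_on_boxes_imp_AE_zero[OF h'int h'box this]
    have "AE x in lebesgue. h' x = 0" by (rule AE_completion)
    \<comment> \<open>Only the open box carries information about \<open>g\<close>; the boundary of
      the closed one is a null set.\<close>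
    moreover have "AE x in lebesgue. x \<notin> cbox c d - box c d"
      using negligible_frontier_interval[of c d] unfolding negligible_iff_null_sets
      by (rule AE_not_in)
    ultimately show ?thesis
      using hh' by eventually_elim (auto simp: h_def indicator_def split: if_splits)
  qed
  obtain \<D> where \<D>: "countable \<D>" "\<D> \<subseteq> Pow D" "\<And>X. X \<in> \<D> \<Longrightarrow> \<exists>a b. X = cbox a b" "\<Union>\<D> = D"
    using open_countable_Union_open_cbox[OF D] by metis
  have "AE x in lebesgue. \<forall>X\<in>\<D>. x \<in> X \<longrightarrow> g x = 0"
    using \<D> box_AE by (subst AE_ball_countable) (auto, blast)
  then show ?thesis
    unfolding AE_lebesgue_on_iff[OF Dl] by eventually_elim (use \<D> in blast)
qed

section \<open>Weak gradients and Sobolev spaces\<close>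

lemma compactly_supported_bounded:
  fixes h :: "'a::euclidean_space \<Rightarrow> 'b::euclidean_space"
  assumes "continuous_on UNIV h" "compact K" "\<And>x. x \<notin> K \<Longrightarrow> h x = 0"
  shows "\<exists>B\<ge>0. \<forall>x. norm (h x) \<le> B"
proof -
  have "compact (h ` K)"
    by (intro compact_continuous_image continuous_on_subset[OF assms(1)] assms(2)) auto
  then obtain B where "\<And>x. x \<in> K \<Longrightarrow> norm (h x) \<le> B"
    using compact_imp_bounded[of "h ` K"] by (auto simp: bounded_iff)
  then have "norm (h x) \<le> max B 0" for x
    using assms(3) by (cases "x \<in> K") (auto simp: le_max_iff_disj)
  then show ?thesis by (intro exI[of _ "max B 0"]) auto
qed

lemma compactly_supported_integrable:
  fixes h :: "'a::euclidean_space \<Rightarrow> 'b::euclidean_space"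
  assumes "continuous_on UNIV h" "compact K" "\<And>x. x \<notin> K \<Longrightarrow> h x = 0"
  shows "integrable lborel h"
proof -
  have "integrable lborel (\<lambda>x. indicator K x *\<^sub>R h x)"
    by (intro borel_integrable_compact continuous_on_subset[OF assms(1)] assms(2)) auto
  also have "(\<lambda>x. indicator K x *\<^sub>R h x) = h"
    using assms(3) by (auto simp: indicator_def fun_eq_iff)
  finally show ?thesis .
qed

lemma compactly_supported_L2:
  fixes h :: "'a::euclidean_space \<Rightarrow> 'b::euclidean_space"
  assumes "continuous_on UNIV h" "compact K" "\<And>x. x \<notin> K \<Longrightarrow> h x = 0" "D \<in> sets lebesgue"
  shows "h \<in> L2 D"
proof -
  have "integrable lborel (\<lambda>x. (norm (h x))\<^sup>2)"
    by (rule compactly_supported_integrable[OF _ assms(2)])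
      (auto intro!: continuous_intros assms simp: assms(3))
  then have "integrable lebesgue (\<lambda>x. (norm (h x))\<^sup>2)"
    by (subst integrable_completion) auto
  then have "integrable (lebesgue_on D) (\<lambda>x. (norm (h x))\<^sup>2)"
    using integrable_restrict_space[of D lebesgue "\<lambda>x. (norm (h x))\<^sup>2"] assms(4)
      integrable_mult_indicator[of D lebesgue "\<lambda>x. (norm (h x))\<^sup>2"] by auto
  moreover have "h \<in> borel_measurable (lebesgue_on D)"
    by (intro continuous_imp_measurable_on_sets_lebesgue continuous_on_subset[OF assms(1)] assms(4)) auto
  ultimately show ?thesis by (simp add: L2_def)
qed

lemma integral_lebesgue_on_eq_lborel:
  fixes h :: "'a::euclidean_space \<Rightarrow> 'b::euclidean_space"
  assumes "D \<in> sets lebesgue" "h \<in> borel_measurable borel" "\<And>x. x \<notin> D \<Longrightarrow> h x = 0"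
  shows "(\<integral>x. h x \<partial>lebesgue_on D) = (\<integral>x. h x \<partial>lborel)"
proof -
  have "(\<integral>x. h x \<partial>lebesgue_on D) = (\<integral>x. indicator D x *\<^sub>R h x \<partial>lebesgue)"
    using assms(1) by (intro integral_restrict_space) auto
  also have "(\<lambda>x. indicator D x *\<^sub>R h x) = h"
    using assms(3) by (auto simp: indicator_def fun_eq_iff)
  also have "(\<integral>x. h x \<partial>lebesgue) = (\<integral>x. h x \<partial>lborel)"
    using assms(2) by (intro integral_completion) auto
  finally show ?thesis .
qed

lemma lborel_integral_translation:
  fixes h :: "'a::euclidean_space \<Rightarrow> 'b::euclidean_space"
  assumes [measurable]: "h \<in> borel_measurable borel"
  shows "(\<integral>x. h (x + c) \<partial>lborel) = (\<integral>x. h x \<partial>lborel)"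
proof -
  have "(\<integral>x. h x \<partial>lborel) = (\<integral>x. h x \<partial>distr lborel borel ((+) c))"
    by (simp add: lborel_distr_plus)
  also have "\<dots> = (\<integral>x. h (c + x) \<partial>lborel)"
    by (rule integral_distr) measurable
  finally show ?thesis by (simp add: add.commute)
qed

lemma frechet_derivative_outside_support:
  assumes "x \<notin> supp \<phi>"
  shows "frechet_derivative \<phi> (at x) = (\<lambda>h. 0)"
proof (rule frechet_derivative_eq)
  have "((\<lambda>x. 0) has_derivative (\<lambda>h. 0)) (at x)" by simp
  then show "(\<phi> has_derivative (\<lambda>h. 0)) (at x)"
    by (rule has_derivative_transform_within_open[where s="- supp \<phi>"])
      (use assms closure_subset[of "{x. \<phi> x \<noteq> 0}"] in auto)
qed

lemma grad_inner_Basis: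
  "i \<in> Basis \<Longrightarrow> grad \<phi> x \<bullet> i = frechet_derivative \<phi> (at x) i"
  by (simp add: grad_def inner_sum_left_Basis)

lemma frechet_derivative_eq_grad:
  assumes "\<phi> differentiable (at x)"
  shows "frechet_derivative \<phi> (at x) h = grad \<phi> x \<bullet> h"
proof -
  interpret linear "frechet_derivative \<phi> (at x)"
    using assms by (rule linear_frechet_derivative)
  have "frechet_derivative \<phi> (at x) h = frechet_derivative \<phi> (at x) (\<Sum>i\<in>Basis. (h \<bullet> i) *\<^sub>R i)"
    by (simp add: euclidean_representation)
  also have "\<dots> = (\<Sum>i\<in>Basis. (h \<bullet> i) * frechet_derivative \<phi> (at x) i)"
    by (simp add: sum scale)
  also have "\<dots> = grad \<phi> x \<bullet> h"
    by (subst (2) euclidean_inner) (simp add: grad_inner_Basis mult.commute)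
  finally show ?thesis .
qed

lemma grad_continuous: "Ck 1 \<phi> \<Longrightarrow> continuous_on UNIV (grad \<phi>)"
  unfolding grad_def[abs_def] by (intro continuous_intros) auto

lemma grad_outside_support: "x \<notin> supp \<phi> \<Longrightarrow> grad \<phi> x = 0"
  by (simp add: grad_def frechet_derivative_outside_support)

section \<open>Difference quotients and integration by parts\<close>

lemma has_real_derivative_along_line:
  assumes "\<And>x. \<phi> differentiable (at x)"
  shows "((\<lambda>t. \<phi> (x + t *\<^sub>R z)) has_real_derivative grad \<phi> (x + t *\<^sub>R z) \<bullet> z) (at t)"
proof -
  have "((\<lambda>t. x + t *\<^sub>R z) has_derivative (\<lambda>h. h *\<^sub>R z)) (at t)"
    by (auto intro!: derivative_eq_intros)
  from has_derivative_compose[OF this frechet_derivative_works[THEN iffD1, OF assms]]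
  show ?thesis
    unfolding has_field_derivative_def
    by (rule has_derivative_eq_rhs) (simp add: frechet_derivative_eq_grad[OF assms] fun_eq_iff)
qed

lemma difference_quotient_bound:
  assumes d: "\<And>x. \<phi> differentiable (at x)" and B: "\<And>x. norm (grad \<phi> x) \<le> B"
  shows "\<bar>\<phi> x - \<phi> y\<bar> \<le> B * norm (x - y)"
proof -
  have "norm (\<phi> x - \<phi> y) \<le> B * norm (x - y)"
  proof (rule differentiable_bound[where S=UNIV and f'="\<lambda>x. frechet_derivative \<phi> (at x)"])
    show "(\<phi> has_derivative frechet_derivative \<phi> (at x)) (at x within UNIV)" for x
      using d frechet_derivative_works by blast
    show "onorm (frechet_derivative \<phi> (at x)) \<le> B" for x
    proof (rule onorm_le)
      fix h
      have "norm (frechet_derivative \<phi> (at x) h) \<le> norm (grad \<phi> x) * norm h"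
        by (simp add: frechet_derivative_eq_grad[OF d] Cauchy_Schwarz_ineq2)
      also have "\<dots> \<le> B * norm h" by (intro mult_right_mono B) simp
      finally show "norm (frechet_derivative \<phi> (at x) h) \<le> B * norm h" .
    qed
  qed auto
  then show ?thesis by simp
qed

lemma difference_quotient_limit:
  assumes "\<And>x. \<phi> differentiable (at x)"
  shows "(\<lambda>n. real (Suc n) * (\<phi> (x + (1 / real (Suc n)) *\<^sub>R z) - \<phi> x)) \<longlonglongrightarrow> grad \<phi> x \<bullet> z"
proof -
  have "((\<lambda>h. (\<phi> (x + (0 + h) *\<^sub>R z) - \<phi> (x + 0 *\<^sub>R z)) / h) \<longlongrightarrow> grad \<phi> (x + 0 *\<^sub>R z) \<bullet> z) (at 0)"
    using has_real_derivative_along_line[OF assms, of x z 0] unfolding DERIV_def .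
  then have "((\<lambda>h. (\<phi> (x + h *\<^sub>R z) - \<phi> x) / h) \<longlongrightarrow> grad \<phi> x \<bullet> z) (at 0)" by simp
  moreover have "filterlim (\<lambda>n. 1 / real (Suc n)) (at 0) sequentially"
    unfolding filterlim_at using LIMSEQ_inverse_real_of_nat by (auto simp: inverse_eq_divide)
  ultimately have "(\<lambda>n. (\<phi> (x + (1 / real (Suc n)) *\<^sub>R z) - \<phi> x) / (1 / real (Suc n)))
     \<longlonglongrightarrow> grad \<phi> x \<bullet> z"
    by (rule filterlim_compose)
  then show ?thesis by (simp add: mult.commute)
qed

text \<open>Dominated convergence: the mean value inequality bounds all quotients by
  \<open>B * norm z\<close>, and all of them vanish outside the ball of radius
  \<open>R + norm z\<close>, where \<open>G 0 = 0\<close> keeps the integrand zero. The identity as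
  \<open>G\<close> serves for integrating gradients, the square for the translation
  estimate.\<close>

lemma integral_difference_quotient_limit:
  fixes \<psi> :: "'a::euclidean_space \<Rightarrow> real" and G :: "real \<Rightarrow> real"
  assumes C1: "Ck 1 \<psi>" and K: "compact (supp \<psi>)"
    and G: "continuous_on UNIV G" "G 0 = 0"
  shows "(\<lambda>n. \<integral>x. G (real (Suc n) * (\<psi> (x + (1 / real (Suc n)) *\<^sub>R z) - \<psi> x)) \<partial>lborel)
    \<longlonglongrightarrow> (\<integral>x. G (grad \<psi> x \<bullet> z) \<partial>lborel)"
proof -
  let ?K = "supp \<psi>"
  have d: "\<psi> differentiable (at x)" for x using C1 by simp
  have cont: "continuous_on UNIV \<psi>" using C1 by (rule Ck_continuous)
  have out: "\<psi> x = 0" if "x \<notin> ?K" for x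
    using that closure_subset[of "{x. \<psi> x \<noteq> 0}"] by auto
  obtain B where B: "B \<ge> 0" "\<And>x. norm (grad \<psi> x) \<le> B"
    using compactly_supported_bounded[OF grad_continuous[OF C1] K grad_outside_support] by auto
  obtain R where R: "R > 0" "?K \<subseteq> cball 0 R"
    using bounded_subset_ballD[OF compact_imp_bounded[OF K], of 0] ball_subset_cball by blast
  have "compact (G ` {- (B * norm z)..B * norm z})"
    by (intro compact_continuous_image continuous_on_subset[OF G(1)]) auto
  then obtain C where "\<forall>y\<in>{- (B * norm z)..B * norm z}. norm (G y) \<le> C"
    using compact_imp_bounded[of "G ` {- (B * norm z)..B * norm z}"] unfolding bounded_iff by blast
  then have C: "\<bar>G y\<bar> \<le> C" if "\<bar>y\<bar> \<le> B * norm z" for y using that by (auto simp: abs_le_iff)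
  let ?q = "\<lambda>n x. real (Suc n) * (\<psi> (x + (1 / real (Suc n)) *\<^sub>R z) - \<psi> x)"
  have meas [measurable]: "\<psi> \<in> borel_measurable borel" "G \<in> borel_measurable borel"
    using cont G(1) by (auto intro: borel_measurable_continuous_onI)
  show ?thesis
  proof (rule integral_dominated_convergence[where w="\<lambda>x. C * indicator (cball 0 (R + norm z)) x"])
    show "(\<lambda>x. G (grad \<psi> x \<bullet> z)) \<in> borel_measurable lborel"
      using borel_measurable_continuous_onI[OF grad_continuous[OF C1]] by measurable
    show "(\<lambda>x. G (?q n x)) \<in> borel_measurable lborel" for n by measurable
    show "integrable lborel (\<lambda>x. C * indicator (cball 0 (R + norm z)) x :: real)"
      by (intro integrable_mult_right integrable_real_indicator emeasure_bounded_finite) auto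
    have "isCont G y" for y using G(1) continuous_on_eq_continuous_at[OF open_UNIV] by auto
    then show "AE x in lborel. (\<lambda>n. G (?q n x)) \<longlonglongrightarrow> G (grad \<psi> x \<bullet> z)"
      by (intro AE_I2 isCont_tendsto_compose[OF _ difference_quotient_limit] d)
    show "AE x in lborel. norm (G (?q n x)) \<le> C * indicator (cball 0 (R + norm z)) x" for n
    proof (rule AE_I2)
      fix x :: 'a
      let ?y = "x + (1 / real (Suc n)) *\<^sub>R z"
      have "\<bar>?q n x\<bar> = real (Suc n) * \<bar>\<psi> ?y - \<psi> x\<bar>"
        by (simp add: abs_mult)
      also have "\<dots> \<le> real (Suc n) * (B * norm (?y - x))"
        by (intro mult_left_mono difference_quotient_bound d B) simp
      also have "\<dots> = B * norm z" by simp
      finally have 1: "\<bar>?q n x\<bar> \<le> B * norm z" .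
      show "norm (G (?q n x)) \<le> C * indicator (cball 0 (R + norm z)) x"
      proof (cases "x \<in> cball 0 (R + norm z)")
        case True
        then show ?thesis using C[OF 1] by simp
      next
        case False
        have "norm x \<le> norm ?y + norm ((1 / real (Suc n)) *\<^sub>R z)"
          using norm_triangle_ineq4[of ?y "(1 / real (Suc n)) *\<^sub>R z"] by simp
        also have "norm ((1 / real (Suc n)) *\<^sub>R z) \<le> norm z"
          using mult_left_le_one_le[of "norm z" "1 / real (Suc n)"] by simp
        finally have "norm x \<le> norm ?y + norm z" by simp
        then have "?y \<notin> cball 0 R" "x \<notin> cball 0 R"
          using False norm_ge_zero[of z] unfolding mem_cball_0 by linarith+
        then have "\<psi> ?y = 0" "\<psi> x = 0" using R(2) out by blast+
        then have "?q n x = 0" by simp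
        then show ?thesis using False G(2) by simp
      qed
    qed
  qed
qed

text \<open>By translation invariance the difference quotients of a compactly supported function
  have integral zero.\<close>

lemma integral_grad_eq_0:
  fixes \<psi> :: "'a::euclidean_space \<Rightarrow> real"
  assumes C1: "Ck 1 \<psi>" and K: "compact (supp \<psi>)"
  shows "(\<integral>x. grad \<psi> x \<bullet> z \<partial>lborel) = 0"
proof -
  let ?q = "\<lambda>n x. real (Suc n) * (\<psi> (x + (1 / real (Suc n)) *\<^sub>R z) - \<psi> x)"
  have cont: "continuous_on UNIV \<psi>" using C1 by (rule Ck_continuous)
  have int: "integrable lborel \<psi>"
    using closure_subset[of "{x. \<psi> x \<noteq> 0}"]
    by (intro compactly_supported_integrable[OF cont K]) auto
  have meas [measurable]: "\<psi> \<in> borel_measurable borel"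
    using cont by (rule borel_measurable_continuous_onI)
  have "(\<integral>x. ?q n x \<partial>lborel) = 0" for n
  proof -
    have int': "integrable lborel (\<lambda>x. \<psi> (x + c))" for c
    proof -
      have "integrable (distr lborel borel ((+) c)) \<psi>" using int by (simp add: lborel_distr_plus)
      then show ?thesis by (subst (asm) integrable_distr_eq) (auto simp: add.commute)
    qed
    show ?thesis
      using int int' lborel_integral_translation[OF meas] by simp
  qed
  then show ?thesis
    using integral_difference_quotient_limit[OF C1 K continuous_on_id, of z] by (simp add: LIMSEQ_const_iff)
qed

lemma test_functionsD:
  assumes "\<phi> \<in> test_functions D"
  shows "Ck k \<phi>" "compact (supp \<phi>)" "supp \<phi> \<subseteq> D"
    "\<phi> differentiable (at x)" "continuous_on UNIV \<phi>" "continuous_on UNIV (grad \<phi>)"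
proof -
  have C: "Ck k \<phi>" for k using assms by (simp add: test_functions_def)
  show "Ck k \<phi>" by (rule C)
  show "compact (supp \<phi>)" "supp \<phi> \<subseteq> D"
    using assms by (simp_all add: test_functions_def)
  show "\<phi> differentiable (at x)" using C[of "Suc 0"] by simp
  show "continuous_on UNIV \<phi>" by (rule Ck_continuous[OF C])
  show "continuous_on UNIV (grad \<phi>)" by (rule grad_continuous[OF C])
qed

lemma test_function_outside: "x \<notin> supp \<phi> \<Longrightarrow> \<phi> x = 0"
  using closure_subset[of "{x. \<phi> x \<noteq> 0}"] by auto

lemma test_function_L2:
  assumes "\<phi> \<in> test_functions D" "X \<in> sets lebesgue"
  shows "\<phi> \<in> L2 X" "grad \<phi> \<in> L2 X"
  by (rule compactly_supported_L2[OF test_functionsD(5,2)[OF assms(1)] _ assms(2)],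
      erule test_function_outside)
    (rule compactly_supported_L2[OF test_functionsD(6,2)[OF assms(1)] grad_outside_support assms(2)])

lemma L2_norm_fun: "g \<in> L2 D \<Longrightarrow> (\<lambda>x. norm (g x)) \<in> L2 D"
  by (rule L2_bounded_by) (auto dest: L2_measurable)

lemma L2_scaleR_integrable:
  assumes u: "u \<in> L2 D" and g: "g \<in> L2 D"
  shows "integrable (lebesgue_on D) (\<lambda>x. u x *\<^sub>R g x)"
proof (rule Bochner_Integration.integrable_bound[OF L2_mult_integrable[OF L2_norm_fun[OF u] L2_norm_fun[OF g]]])
  show "(\<lambda>x. u x *\<^sub>R g x) \<in> borel_measurable (lebesgue_on D)"
    by (intro borel_measurable_scaleR L2_measurable[OF u] L2_measurable[OF g])
qed simp

lemma L2_scaleR_bound: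
  assumes u: "u \<in> L2 D" and g: "g \<in> L2 D"
  shows "norm (\<integral>x. u x *\<^sub>R g x \<partial>lebesgue_on D) \<le> L2_norm D u * L2_norm D g"
proof -
  have "norm (\<integral>x. u x *\<^sub>R g x \<partial>lebesgue_on D) \<le> (\<integral>x. norm (u x *\<^sub>R g x) \<partial>lebesgue_on D)"
    by (rule integral_norm_bound)
  also have "\<dots> = (\<integral>x. norm (u x) \<bullet> norm (g x) \<partial>lebesgue_on D)" by simp
  also have "\<dots> \<le> L2_norm D (\<lambda>x. norm (u x)) * L2_norm D (\<lambda>x. norm (g x))"
    using L2_Cauchy_Schwarz[OF L2_norm_fun[OF u] L2_norm_fun[OF g]] by linarith
  finally show ?thesis by (simp add: L2_norm_def)
qed

lemma grad_mult:
  assumes "\<phi> differentiable (at x)" "\<psi> differentiable (at x)"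
  shows "grad (\<lambda>x. \<phi> x * \<psi> x) x = \<phi> x *\<^sub>R grad \<psi> x + \<psi> x *\<^sub>R grad \<phi> x"
proof -
  have d: "((\<lambda>x. \<phi> x * \<psi> x) has_derivative
    (\<lambda>h. \<phi> x * frechet_derivative \<psi> (at x) h + frechet_derivative \<phi> (at x) h * \<psi> x)) (at x)"
    using assms by (auto intro!: derivative_intros simp: frechet_derivative_works[symmetric])
  show ?thesis
    unfolding grad_def frechet_derivative_eq[OF d]
    by (simp add: scaleR_sum_right sum.distrib[symmetric] algebra_simps)
qed

text \<open>The gradient of the compactly supported product \<phi> \<psi> has integral zero; the
  product rule turns this into integration by parts.\<close>

lemma test_function_weak_gradient:
  fixes D :: "'a::euclidean_space set"
  assumes \<phi>: "\<phi> \<in> test_functions D" and D: "D \<in> sets lebesgue"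
  shows "has_weak_gradient D \<phi> (grad \<phi>)"
  unfolding has_weak_gradient_def
proof
  fix \<psi> assume \<psi>: "\<psi> \<in> test_functions D"
  let ?p = "\<lambda>x. \<phi> x * \<psi> x"
  have p1: "Ck 1 ?p" by (intro Ck_mult test_functionsD(1)[OF \<phi>] test_functionsD(1)[OF \<psi>])
  have sub: "supp ?p \<subseteq> supp \<phi>"
    by (intro closure_mono) auto
  have pK: "compact (supp ?p)"
    using closed_subset_compact[OF closed_closure test_functionsD(2)[OF \<phi>] sub] .
  have meas: "grad ?p \<in> borel_measurable borel"
    by (rule borel_measurable_continuous_onI[OF grad_continuous[OF p1]])
  have gint: "integrable lborel (grad ?p)"
    by (rule compactly_supported_integrable[OF grad_continuous[OF p1] pK grad_outside_support])
  have zero: "(\<integral>x. grad ?p x \<partial>lborel) = 0"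
  proof (rule euclidean_eqI)
    fix i :: 'a
    assume "i \<in> Basis"
    show "(\<integral>x. grad ?p x \<partial>lborel) \<bullet> i = 0 \<bullet> i"
      using integral_grad_eq_0[OF p1 pK, of i] gint by simp
  qed
  have "(\<integral>x. grad ?p x \<partial>lebesgue_on D) = (\<integral>x. grad ?p x \<partial>lborel)"
    using sub test_functionsD(3)[OF \<phi>]
    by (intro integral_lebesgue_on_eq_lborel D meas grad_outside_support) auto
  moreover have "grad ?p x = \<phi> x *\<^sub>R grad \<psi> x + \<psi> x *\<^sub>R grad \<phi> x" for x
    by (intro grad_mult test_functionsD(4)[OF \<phi>] test_functionsD(4)[OF \<psi>])
  ultimately have "(\<integral>x. \<phi> x *\<^sub>R grad \<psi> x + \<psi> x *\<^sub>R grad \<phi> x \<partial>lebesgue_on D) = 0"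
    using zero by simp
  then show "(\<integral>x. \<phi> x *\<^sub>R grad \<psi> x \<partial>lebesgue_on D) = - (\<integral>x. \<psi> x *\<^sub>R grad \<phi> x \<partial>lebesgue_on D)"
    using L2_scaleR_integrable[OF test_function_L2(1)[OF \<phi> D] test_function_L2(2)[OF \<psi> D]]
      L2_scaleR_integrable[OF test_function_L2(1)[OF \<psi> D] test_function_L2(2)[OF \<phi> D]]
    by (simp add: add_eq_0_iff2)
qed

section \<open>The Sobolev space H1 and its norms on a bounded open set\<close>

locale bounded_open_domain =
  fixes \<Omega> :: "'a::euclidean_space set"
  assumes open_domain: "open \<Omega>" and bounded_domain: "bounded \<Omega>"
begin

abbreviation domain_measure ("\<mu>") where "\<mu> \<equiv> lebesgue_on \<Omega>"
abbreviation nrm where "nrm \<equiv> L2_norm \<Omega>"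
abbreviation nrm1 where "nrm1 \<equiv> H1_norm \<Omega>"
abbreviation weak_gradient ("\<nabla>") where "\<nabla> \<equiv> wgrad \<Omega>"

lemma domain_lmeasurable: "\<Omega> \<in> lmeasurable"
  by (rule lmeasurable_open[OF bounded_domain open_domain])

lemma domain_lebesgue [simp]: "\<Omega> \<in> sets lebesgue"
  using domain_lmeasurable by auto

lemmas test_L2 = test_function_L2[OF _ domain_lebesgue]

lemma has_weak_gradient_lincomb:
  assumes u: "u \<in> L2 \<Omega>" "g \<in> L2 \<Omega>" "has_weak_gradient \<Omega> u g"
    and v: "v \<in> L2 \<Omega>" "h \<in> L2 \<Omega>" "has_weak_gradient \<Omega> v h"
  shows "has_weak_gradient \<Omega> (\<lambda>x. a * u x + b * v x) (\<lambda>x. a *\<^sub>R g x + b *\<^sub>R h x)"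
  unfolding has_weak_gradient_def
proof
  fix \<phi> assume \<phi>: "\<phi> \<in> test_functions \<Omega>"
  note i = L2_scaleR_integrable[OF u(1) test_L2(2)[OF \<phi>]] L2_scaleR_integrable[OF v(1) test_L2(2)[OF \<phi>]]
    L2_scaleR_integrable[OF test_L2(1)[OF \<phi>] u(2)] L2_scaleR_integrable[OF test_L2(1)[OF \<phi>] v(2)]
  have "(\<integral>x. (a * u x + b * v x) *\<^sub>R grad \<phi> x \<partial>\<mu>)
    = (\<integral>x. a *\<^sub>R (u x *\<^sub>R grad \<phi> x) + b *\<^sub>R (v x *\<^sub>R grad \<phi> x) \<partial>\<mu>)"
    by (simp add: scaleR_add_left)
  also have "\<dots> = a *\<^sub>R (- (\<integral>x. \<phi> x *\<^sub>R g x \<partial>\<mu>)) + b *\<^sub>R (- (\<integral>x. \<phi> x *\<^sub>R h x \<partial>\<mu>))"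
    using u(3) v(3) \<phi> i by (simp add: has_weak_gradient_def del: scaleR_scaleR)
  also have "\<dots> = - (\<integral>x. a *\<^sub>R (\<phi> x *\<^sub>R g x) + b *\<^sub>R (\<phi> x *\<^sub>R h x) \<partial>\<mu>)"
    using i by (simp del: scaleR_scaleR)
  finally show "(\<integral>x. (a * u x + b * v x) *\<^sub>R grad \<phi> x \<partial>\<mu>)
      = - (\<integral>x. \<phi> x *\<^sub>R (a *\<^sub>R g x + b *\<^sub>R h x) \<partial>\<mu>)"
    by (simp add: scaleR_add_right mult.commute)
qed

text \<open>The du Bois-Reymond lemma applied to each component of the difference. This is what
  makes the choice in \<open>wgrad\<close> harmless.\<close>

lemma has_weak_gradient_unique:
  assumes g: "g \<in> L2 \<Omega>" "has_weak_gradient \<Omega> u g" and h: "h \<in> L2 \<Omega>" "has_weak_gradient \<Omega> u h"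
  shows "AE x in \<mu>. g x = h x"
proof -
  have "AE x in \<mu>. (g x - h x) \<bullet> i = 0" for i
  proof (rule du_Bois_Reymond[OF open_domain])
    show "integrable \<mu> (\<lambda>x. (g x - h x) \<bullet> i)"
      using L2_integrable[OF domain_lmeasurable L2_diff[OF g(1) h(1)]] by simp
    fix \<phi> assume \<phi>: "\<phi> \<in> test_functions \<Omega>"
    note i = L2_scaleR_integrable[OF test_L2(1)[OF \<phi>] g(1)] L2_scaleR_integrable[OF test_L2(1)[OF \<phi>] h(1)]
    have "(\<integral>x. \<phi> x * ((g x - h x) \<bullet> i) \<partial>\<mu>)
        = (\<integral>x. (\<phi> x *\<^sub>R g x) \<bullet> i - (\<phi> x *\<^sub>R h x) \<bullet> i \<partial>\<mu>)"
      by (simp add: inner_diff_left right_diff_distrib)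
    also have "\<dots> = (\<integral>x. \<phi> x *\<^sub>R g x \<partial>\<mu>) \<bullet> i - (\<integral>x. \<phi> x *\<^sub>R h x \<partial>\<mu>) \<bullet> i"
      using i integrable_inner_left[OF i(1), of i] integrable_inner_left[OF i(2), of i]
      by (simp del: inner_scaleR_left)
    also have "\<dots> = 0" using g(2) h(2) \<phi> by (simp add: has_weak_gradient_def)
    finally show "(\<integral>x. \<phi> x * ((g x - h x) \<bullet> i) \<partial>\<mu>) = 0" .
  qed
  then have "AE x in \<mu>. \<forall>i\<in>Basis. (g x - h x) \<bullet> i = 0"
    by (intro AE_finite_allI) auto
  then show ?thesis
    by eventually_elim (auto intro: euclidean_eqI simp: inner_diff_left)
qed

lemma H1I: "u \<in> L2 \<Omega> \<Longrightarrow> g \<in> L2 \<Omega> \<Longrightarrow> has_weak_gradient \<Omega> u g \<Longrightarrow> u \<in> H1 \<Omega>"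
  by (auto simp: H1_def)

lemma H1_L2: "u \<in> H1 \<Omega> \<Longrightarrow> u \<in> L2 \<Omega>"
  by (simp add: H1_def)

lemma wgrad:
  assumes "u \<in> H1 \<Omega>"
  shows wgrad_L2: "\<nabla> u \<in> L2 \<Omega>" and wgrad_weak: "has_weak_gradient \<Omega> u (\<nabla> u)"
proof -
  obtain g where "g \<in> L2 \<Omega> \<and> has_weak_gradient \<Omega> u g" using assms by (auto simp: H1_def)
  then have "\<nabla> u \<in> L2 \<Omega> \<and> has_weak_gradient \<Omega> u (\<nabla> u)"
    unfolding wgrad_def by (rule someI[of "\<lambda>g. g \<in> L2 \<Omega> \<and> has_weak_gradient \<Omega> u g"])
  then show "\<nabla> u \<in> L2 \<Omega>" "has_weak_gradient \<Omega> u (\<nabla> u)" by auto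
qed

lemma wgrad_AE_eq:
  assumes "u \<in> L2 \<Omega>" "g \<in> L2 \<Omega>" "has_weak_gradient \<Omega> u g"
  shows "AE x in \<mu>. \<nabla> u x = g x"
  using has_weak_gradient_unique[OF wgrad[OF H1I[OF assms]] assms(2,3)] .

lemma H1_lincomb:
  assumes u: "u \<in> H1 \<Omega>" and v: "v \<in> H1 \<Omega>"
  shows "(\<lambda>x. a * u x + b * v x) \<in> H1 \<Omega>"
    and "AE x in \<mu>. \<nabla> (\<lambda>x. a * u x + b * v x) x = a *\<^sub>R \<nabla> u x + b *\<^sub>R \<nabla> v x"
proof -
  note h = L2_lincomb[OF H1_L2[OF u] H1_L2[OF v], of a b]
    L2_add[OF L2_scaleR[OF wgrad_L2[OF u], of a] L2_scaleR[OF wgrad_L2[OF v], of b]]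
    has_weak_gradient_lincomb[OF H1_L2[OF u] wgrad[OF u] H1_L2[OF v] wgrad[OF v], of a b]
  show "(\<lambda>x. a * u x + b * v x) \<in> H1 \<Omega>" by (rule H1I[OF h])
  show "AE x in \<mu>. \<nabla> (\<lambda>x. a * u x + b * v x) x = a *\<^sub>R \<nabla> u x + b *\<^sub>R \<nabla> v x"
    by (rule wgrad_AE_eq[OF h])
qed

lemma test_H1:
  assumes "\<phi> \<in> test_functions \<Omega>"
  shows "\<phi> \<in> H1 \<Omega>" "AE x in \<mu>. \<nabla> \<phi> x = grad \<phi> x"
  using H1I[OF test_L2[OF assms] test_function_weak_gradient[OF assms domain_lebesgue]]
    wgrad_AE_eq[OF test_L2[OF assms] test_function_weak_gradient[OF assms domain_lebesgue]] by auto

text \<open>The \<open>\<lambda>\<close>-weighted jet turns \<open>trinorm\<close> and \<open>B_form\<close> into the norm and the inner product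
  of \<open>L\<^sup>2(\<Omega>; \<real> \<times> \<real>\<^sup>d)\<close>.\<close>

definition jet :: "real \<Rightarrow> ('a \<Rightarrow> real) \<Rightarrow> 'a \<Rightarrow> real \<times> 'a" where
  "jet lam u = (\<lambda>x. (u x, sqrt lam *\<^sub>R \<nabla> u x))"

lemma jet_L2: "u \<in> H1 \<Omega> \<Longrightarrow> jet lam u \<in> L2 \<Omega>"
  unfolding jet_def L2_Pair_iff by (intro conjI H1_L2 L2_scaleR wgrad_L2)

lemma jet_lincomb:
  assumes u: "u \<in> H1 \<Omega>" and v: "v \<in> H1 \<Omega>"
  shows "AE x in \<mu>. jet lam (\<lambda>x. a * u x + b * v x) x = a *\<^sub>R jet lam u x + b *\<^sub>R jet lam v x"
  using H1_lincomb(2)[OF u v, of a b] by eventually_elim (simp add: jet_def algebra_simps)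

lemma trinorm_eq_jet: "u \<in> H1 \<Omega> \<Longrightarrow> lam \<ge> 0 \<Longrightarrow> trinorm \<Omega> lam u = nrm (jet lam u)"
  unfolding jet_def
  by (subst L2_norm_Pair) (auto simp: H1_L2 L2_scaleR wgrad_L2 trinorm_def L2_norm_scaleR power_mult_distrib add.commute)

lemma H1_norm_eq_trinorm: "nrm1 u = trinorm \<Omega> 1 u"
  by (simp add: H1_norm_def trinorm_def)

lemma B_form_eq_jet:
  assumes "lam \<ge> 0"
  shows "B_form \<Omega> lam u v = (\<integral>x. jet lam u x \<bullet> jet lam v x \<partial>\<mu>)"
  using assms by (simp add: B_form_def jet_def inner_prod_def add.commute mult.assoc[symmetric])

lemma trinorm_nonneg [simp]: "lam \<ge> 0 \<Longrightarrow> 0 \<le> trinorm \<Omega> lam u"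
  by (simp add: trinorm_def)

lemma H1_norm_nonneg [simp]: "0 \<le> nrm1 u"
  by (simp add: H1_norm_def)

lemma trinorm_power2: "lam \<ge> 0 \<Longrightarrow> (trinorm \<Omega> lam v)\<^sup>2 = lam * (nrm (\<nabla> v))\<^sup>2 + (nrm v)\<^sup>2"
  by (simp add: trinorm_def)

lemma B_form_self: "u \<in> H1 \<Omega> \<Longrightarrow> lam \<ge> 0 \<Longrightarrow> B_form \<Omega> lam u u = (trinorm \<Omega> lam u)\<^sup>2"
  by (simp add: B_form_eq_jet trinorm_eq_jet L2_norm_power2 power2_norm_eq_inner)

lemma B_form_commute: "B_form \<Omega> lam u v = B_form \<Omega> lam v u"
  by (simp add: B_form_def inner_commute mult.commute)

lemma B_form_bound:
  assumes "u \<in> H1 \<Omega>" "v \<in> H1 \<Omega>" "lam \<ge> 0"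
  shows "\<bar>B_form \<Omega> lam u v\<bar> \<le> trinorm \<Omega> lam u * trinorm \<Omega> lam v"
  using L2_Cauchy_Schwarz[OF jet_L2[OF assms(1)] jet_L2[OF assms(2)], of lam lam] assms
  by (simp add: B_form_eq_jet trinorm_eq_jet)

lemma B_form_lincomb:
  assumes "u \<in> H1 \<Omega>" "v \<in> H1 \<Omega>" "w \<in> H1 \<Omega>" "lam \<ge> 0"
  shows "B_form \<Omega> lam (\<lambda>x. a * u x + b * v x) w = a * B_form \<Omega> lam u w + b * B_form \<Omega> lam v w"
proof -
  note H = H1_lincomb(1)[OF assms(1,2)]
  have "B_form \<Omega> lam (\<lambda>x. a * u x + b * v x) w
      = (\<integral>x. a * (jet lam u x \<bullet> jet lam w x) + b * (jet lam v x \<bullet> jet lam w x) \<partial>\<mu>)"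
    unfolding B_form_eq_jet[OF assms(4)]
  proof (rule integral_cong_AE)
    show "AE x in \<mu>. jet lam (\<lambda>x. a * u x + b * v x) x \<bullet> jet lam w x
      = a * (jet lam u x \<bullet> jet lam w x) + b * (jet lam v x \<bullet> jet lam w x)"
      using jet_lincomb[OF assms(1,2), of lam a b] by eventually_elim (simp add: inner_add_left)
  qed (intro borel_measurable_integrable L2_inner_integrable jet_L2 H assms
      Bochner_Integration.integrable_add integrable_mult_right)+
  then show ?thesis
    using assms by (simp add: B_form_eq_jet L2_inner_integrable jet_L2)
qed

lemma trinorm_lincomb_le:
  assumes u: "u \<in> H1 \<Omega>" and v: "v \<in> H1 \<Omega>" and lam: "lam \<ge> 0"
  shows "trinorm \<Omega> lam (\<lambda>x. a * u x + b * v x) \<le> \<bar>a\<bar> * trinorm \<Omega> lam u + \<bar>b\<bar> * trinorm \<Omega> lam v"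
proof -
  note H = H1_lincomb(1)[OF u v]
  have "trinorm \<Omega> lam (\<lambda>x. a * u x + b * v x) = nrm (\<lambda>x. a *\<^sub>R jet lam u x + b *\<^sub>R jet lam v x)"
    unfolding trinorm_eq_jet[OF H lam]
    by (intro L2_norm_cong_AE jet_lincomb u v L2_measurable jet_L2 H L2_add L2_scaleR)
  also have "\<dots> \<le> nrm (\<lambda>x. a *\<^sub>R jet lam u x) + nrm (\<lambda>x. b *\<^sub>R jet lam v x)"
    by (intro L2_norm_triangle L2_scaleR jet_L2 u v)
  finally show ?thesis by (simp add: L2_norm_scaleR trinorm_eq_jet u v lam)
qed

lemma trinorm_triangle_diff:
  assumes "u \<in> H1 \<Omega>" "v \<in> H1 \<Omega>" "w \<in> H1 \<Omega>" "lam \<ge> 0"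
  shows "trinorm \<Omega> lam (\<lambda>x. u x - w x) \<le> trinorm \<Omega> lam (\<lambda>x. u x - v x) + trinorm \<Omega> lam (\<lambda>x. v x - w x)"
  using trinorm_lincomb_le[OF H1_lincomb(1)[OF assms(1,2), of 1 "-1"] H1_lincomb(1)[OF assms(2,3), of 1 "-1"] assms(4), of 1 1]
  by simp

lemma H1_diff: "u \<in> H1 \<Omega> \<Longrightarrow> v \<in> H1 \<Omega> \<Longrightarrow> (\<lambda>x. u x - v x) \<in> H1 \<Omega>"
  using H1_lincomb(1)[of u v 1 "-1"] by simp

lemma trinorm_diff_eq:
  assumes u: "u \<in> H1 \<Omega>" and v: "v \<in> H1 \<Omega>" and lam: "lam \<ge> 0"
  shows "trinorm \<Omega> lam (\<lambda>x. u x - v x) = nrm (\<lambda>x. jet lam u x - jet lam v x)"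
  unfolding trinorm_eq_jet[OF H1_diff[OF u v] lam]
  using jet_lincomb[OF u v, of lam 1 "-1"]
  by (intro L2_norm_cong_AE L2_measurable jet_L2 H1_diff u v L2_diff) simp

lemma L2_norm_le_trinorm: "lam \<ge> 0 \<Longrightarrow> nrm u \<le> trinorm \<Omega> lam u"
  unfolding trinorm_def by (rule real_le_rsqrt) simp

lemma L2_norm_wgrad_le_H1_norm: "nrm (\<nabla> u) \<le> nrm1 u"
  unfolding H1_norm_def by (rule real_le_rsqrt) simp

lemma H1_norm_le_trinorm:
  assumes "lam > 0"
  shows "nrm1 u \<le> sqrt (max 1 (1 / lam)) * trinorm \<Omega> lam u"
proof -
  have "(nrm (\<nabla> u))\<^sup>2 + (nrm u)\<^sup>2
      \<le> max 1 (1 / lam) * (lam * (nrm (\<nabla> u))\<^sup>2) + max 1 (1 / lam) * (nrm u)\<^sup>2"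
  proof (rule add_mono)
    have "(nrm (\<nabla> u))\<^sup>2 = 1 / lam * (lam * (nrm (\<nabla> u))\<^sup>2)" using assms by simp
    also have "\<dots> \<le> max 1 (1 / lam) * (lam * (nrm (\<nabla> u))\<^sup>2)"
      using assms by (intro mult_right_mono) auto
    finally show "(nrm (\<nabla> u))\<^sup>2 \<le> max 1 (1 / lam) * (lam * (nrm (\<nabla> u))\<^sup>2)" .
    show "(nrm u)\<^sup>2 \<le> max 1 (1 / lam) * (nrm u)\<^sup>2"
      using mult_right_mono[of 1 "max 1 (1 / lam)" "(nrm u)\<^sup>2"] by simp
  qed
  then show ?thesis
    unfolding H1_norm_def trinorm_def real_sqrt_mult[symmetric] by (simp add: distrib_left)
qed

lemma trinorm_le_H1_norm:
  assumes "lam \<ge> 0"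
  shows "trinorm \<Omega> lam u \<le> sqrt (max 1 lam) * nrm1 u"
proof -
  have "lam * (nrm (\<nabla> u))\<^sup>2 + (nrm u)\<^sup>2
      \<le> max 1 lam * (nrm (\<nabla> u))\<^sup>2 + max 1 lam * (nrm u)\<^sup>2"
    using assms mult_right_mono[of 1 "max 1 lam" "(nrm u)\<^sup>2"]
    by (intro add_mono mult_right_mono) auto
  then show ?thesis
    unfolding H1_norm_def trinorm_def real_sqrt_mult[symmetric] by (simp add: distrib_left)
qed

section \<open>The closure H10 of the test functions\<close>

lemma H10_H1: "u \<in> H10 \<Omega> \<Longrightarrow> u \<in> H1 \<Omega>"
  by (simp add: H10_def)

lemma H10_L2: "u \<in> H10 \<Omega> \<Longrightarrow> u \<in> L2 \<Omega>"
  by (simp add: H10_H1 H1_L2)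

lemma H10_lincomb:
  assumes u: "u \<in> H10 \<Omega>" and v: "v \<in> H10 \<Omega>"
  shows "(\<lambda>x. a * u x + b * v x) \<in> H10 \<Omega>"
proof -
  obtain \<phi> \<psi> where \<phi>: "\<And>n. \<phi> n \<in> test_functions \<Omega>" "(\<lambda>n::nat. nrm1 (\<lambda>x. u x - \<phi> n x)) \<longlonglongrightarrow> 0"
    and \<psi>: "\<And>n. \<psi> n \<in> test_functions \<Omega>" "(\<lambda>n::nat. nrm1 (\<lambda>x. v x - \<psi> n x)) \<longlonglongrightarrow> 0"
    using u v by (auto simp: H10_def)
  have le: "nrm1 (\<lambda>x. (a * u x + b * v x) - (a * \<phi> n x + b * \<psi> n x))
     \<le> \<bar>a\<bar> * nrm1 (\<lambda>x. u x - \<phi> n x) + \<bar>b\<bar> * nrm1 (\<lambda>x. v x - \<psi> n x)" for n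
    using trinorm_lincomb_le[OF H1_diff[OF H10_H1[OF u] test_H1(1)[OF \<phi>(1)]]
        H1_diff[OF H10_H1[OF v] test_H1(1)[OF \<psi>(1)]], of 1 a n b n]
    unfolding H1_norm_eq_trinorm by (simp add: algebra_simps)
  have "(\<lambda>n. \<bar>a\<bar> * nrm1 (\<lambda>x. u x - \<phi> n x) + \<bar>b\<bar> * nrm1 (\<lambda>x. v x - \<psi> n x)) \<longlonglongrightarrow> 0"
    by (auto intro!: tendsto_eq_intros \<phi>(2) \<psi>(2))
  then have "(\<lambda>n. nrm1 (\<lambda>x. (a * u x + b * v x) - (a * \<phi> n x + b * \<psi> n x))) \<longlonglongrightarrow> 0"
    by (rule tendsto_sandwich[OF _ _ tendsto_const, rotated -1]) (use le in auto)
  moreover have "(\<lambda>x. a * \<phi> n x + b * \<psi> n x) \<in> test_functions \<Omega>" for n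
    by (intro test_functions_lincomb \<phi> \<psi>)
  ultimately show ?thesis
    using H1_lincomb(1)[OF H10_H1[OF u] H10_H1[OF v]]
    unfolding H10_def by (auto intro!: exI[of _ "\<lambda>n x. a * \<phi> n x + b * \<psi> n x"])
qed

lemma H10_diff: "u \<in> H10 \<Omega> \<Longrightarrow> v \<in> H10 \<Omega> \<Longrightarrow> (\<lambda>x. u x - v x) \<in> H10 \<Omega>"
  using H10_lincomb[of u v 1 "-1"] by simp

lemma H10_approx:
  assumes "u \<in> H10 \<Omega>" "e > 0"
  obtains \<phi> where "\<phi> \<in> test_functions \<Omega>" "nrm1 (\<lambda>x. u x - \<phi> x) < e"
proof -
  obtain \<phi> where \<phi>: "\<And>n. \<phi> n \<in> test_functions \<Omega>" "(\<lambda>n::nat. nrm1 (\<lambda>x. u x - \<phi> n x)) \<longlonglongrightarrow> 0"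
    using assms by (auto simp: H10_def)
  from LIMSEQ_D[OF \<phi>(2) assms(2)] obtain n where "nrm1 (\<lambda>x. u x - \<phi> n x) < e" by auto
  then show ?thesis using \<phi>(1) by (rule that[rotated])
qed

text \<open>The jets form a Cauchy sequence in L2, and the two components of their limit are a
  function and its weak gradient because the defining identity survives L2 limits. Membership in the
  closure is then regained from test functions close to the members of the sequence.\<close>

lemma H10_complete:
  fixes X :: "nat \<Rightarrow> 'a \<Rightarrow> real"
  assumes X: "\<And>k. X k \<in> H10 \<Omega>"
    and Cauchy: "\<And>e. e > 0 \<Longrightarrow> \<exists>K. \<forall>m\<ge>K. \<forall>n\<ge>K. nrm1 (\<lambda>x. X m x - X n x) < e"
  obtains u where "u \<in> H10 \<Omega>" "(\<lambda>k. nrm1 (\<lambda>x. X k x - u x)) \<longlonglongrightarrow> 0"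
proof -
  note XH = H10_H1[OF X]
  have eqd: "nrm1 (\<lambda>x. X m x - X n x) = nrm (\<lambda>x. jet 1 (X m) x - jet 1 (X n) x)" for m n
    using trinorm_diff_eq[OF XH XH, of 1] by (simp add: H1_norm_eq_trinorm)
  obtain p where p: "p \<in> L2 \<Omega>" "(\<lambda>k. nrm (\<lambda>x. jet 1 (X k) x - p x)) \<longlonglongrightarrow> 0"
    using L2_complete[OF domain_lmeasurable, of "\<lambda>k. jet 1 (X k)"] jet_L2[OF XH] Cauchy
    unfolding eqd by blast
  define u g where "u x = fst (p x)" and "g x = snd (p x)" for x
  have pug: "p = (\<lambda>x. (u x, g x))" by (simp add: u_def g_def)
  have u: "u \<in> L2 \<Omega>" and g: "g \<in> L2 \<Omega>" using p(1) unfolding pug L2_Pair_iff by auto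
  have split: "(nrm (\<lambda>x. jet 1 (X k) x - p x))\<^sup>2
      = (nrm (\<lambda>x. X k x - u x))\<^sup>2 + (nrm (\<lambda>x. \<nabla> (X k) x - g x))\<^sup>2" for k
    unfolding pug jet_def using L2_norm_Pair[OF L2_diff[OF H1_L2[OF XH] u] L2_diff[OF wgrad_L2[OF XH] g]]
    by simp
  have l: "(\<lambda>k. nrm (\<lambda>x. X k x - u x)) \<longlonglongrightarrow> 0"
    by (rule tendsto_sandwich[OF _ _ tendsto_const p(2)])
      (auto intro!: always_eventually power2_le_imp_le[of "nrm (\<lambda>x. X _ x - u x)"] simp: split)
  have lg: "(\<lambda>k. nrm (\<lambda>x. \<nabla> (X k) x - g x)) \<longlonglongrightarrow> 0"
    by (rule tendsto_sandwich[OF _ _ tendsto_const p(2)])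
      (auto intro!: always_eventually power2_le_imp_le[of "nrm (\<lambda>x. \<nabla> (X _) x - g x)"] simp: split)
  \<comment> \<open>For a fixed test function both sides of the identity are continuous in L2 by
    Cauchy-Schwarz, so it passes from \<open>X k\<close> to the limit pair.\<close>
  have weak: "has_weak_gradient \<Omega> u g"
    unfolding has_weak_gradient_def
  proof
    fix \<phi> assume \<phi>: "\<phi> \<in> test_functions \<Omega>"
    note \<phi>2 = test_L2[OF \<phi>]
    have "(\<lambda>k. (\<integral>x. X k x *\<^sub>R grad \<phi> x \<partial>\<mu>) - (\<integral>x. u x *\<^sub>R grad \<phi> x \<partial>\<mu>)) \<longlonglongrightarrow> 0"
    proof (rule Lim_null_comparison)
      show "(\<lambda>k. nrm (\<lambda>x. X k x - u x) * nrm (grad \<phi>)) \<longlonglongrightarrow> 0"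
        by (auto intro!: tendsto_eq_intros l)
      have "norm ((\<integral>x. X k x *\<^sub>R grad \<phi> x \<partial>\<mu>) - (\<integral>x. u x *\<^sub>R grad \<phi> x \<partial>\<mu>))
          \<le> nrm (\<lambda>x. X k x - u x) * nrm (grad \<phi>)" for k
        using L2_scaleR_bound[OF L2_diff[OF H1_L2[OF XH[of k]] u] \<phi>2(2)]
          L2_scaleR_integrable[OF H1_L2[OF XH[of k]] \<phi>2(2)] L2_scaleR_integrable[OF u \<phi>2(2)]
        by (simp add: scaleR_diff_left)
      then show "\<forall>\<^sub>F k in sequentially. norm ((\<integral>x. X k x *\<^sub>R grad \<phi> x \<partial>\<mu>) - (\<integral>x. u x *\<^sub>R grad \<phi> x \<partial>\<mu>))
          \<le> nrm (\<lambda>x. X k x - u x) * nrm (grad \<phi>)"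
        by simp
    qed
    then have 1: "(\<lambda>k. \<integral>x. X k x *\<^sub>R grad \<phi> x \<partial>\<mu>) \<longlonglongrightarrow> (\<integral>x. u x *\<^sub>R grad \<phi> x \<partial>\<mu>)"
      by (simp add: LIM_zero_iff)
    have "(\<lambda>k. (\<integral>x. \<phi> x *\<^sub>R \<nabla> (X k) x \<partial>\<mu>) - (\<integral>x. \<phi> x *\<^sub>R g x \<partial>\<mu>)) \<longlonglongrightarrow> 0"
    proof (rule Lim_null_comparison)
      show "(\<lambda>k. nrm \<phi> * nrm (\<lambda>x. \<nabla> (X k) x - g x)) \<longlonglongrightarrow> 0"
        by (auto intro!: tendsto_eq_intros lg)
      have "norm ((\<integral>x. \<phi> x *\<^sub>R \<nabla> (X k) x \<partial>\<mu>) - (\<integral>x. \<phi> x *\<^sub>R g x \<partial>\<mu>))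
          \<le> nrm \<phi> * nrm (\<lambda>x. \<nabla> (X k) x - g x)" for k
        using L2_scaleR_bound[OF \<phi>2(1) L2_diff[OF wgrad_L2[OF XH[of k]] g]]
          L2_scaleR_integrable[OF \<phi>2(1) wgrad_L2[OF XH[of k]]] L2_scaleR_integrable[OF \<phi>2(1) g]
        by (simp add: scaleR_diff_right)
      then show "\<forall>\<^sub>F k in sequentially. norm ((\<integral>x. \<phi> x *\<^sub>R \<nabla> (X k) x \<partial>\<mu>) - (\<integral>x. \<phi> x *\<^sub>R g x \<partial>\<mu>))
          \<le> nrm \<phi> * nrm (\<lambda>x. \<nabla> (X k) x - g x)"
        by simp
    qed
    then have "(\<lambda>k. \<integral>x. \<phi> x *\<^sub>R \<nabla> (X k) x \<partial>\<mu>) \<longlonglongrightarrow> (\<integral>x. \<phi> x *\<^sub>R g x \<partial>\<mu>)"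
      by (simp add: LIM_zero_iff)
    then have "(\<lambda>k. \<integral>x. X k x *\<^sub>R grad \<phi> x \<partial>\<mu>) \<longlonglongrightarrow> - (\<integral>x. \<phi> x *\<^sub>R g x \<partial>\<mu>)"
      using wgrad_weak[OF XH] \<phi> by (auto simp: has_weak_gradient_def intro: tendsto_minus)
    from LIMSEQ_unique[OF 1 this]
    show "(\<integral>x. u x *\<^sub>R grad \<phi> x \<partial>\<mu>) = - (\<integral>x. \<phi> x *\<^sub>R g x \<partial>\<mu>)" .
  qed
  have uH: "u \<in> H1 \<Omega>" by (rule H1I[OF u g weak])
  have "AE x in \<mu>. jet 1 u x = p x"
    using wgrad_AE_eq[OF u g weak] by eventually_elim (simp add: jet_def pug)
  then have "AE x in \<mu>. jet 1 (X k) x - jet 1 u x = jet 1 (X k) x - p x" for k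
    by eventually_elim simp
  then have "nrm (\<lambda>x. jet 1 (X k) x - jet 1 u x) = nrm (\<lambda>x. jet 1 (X k) x - p x)" for k
    by (intro L2_norm_cong_AE L2_measurable L2_diff jet_L2 XH uH p(1)) auto
  then have lim: "(\<lambda>k. nrm1 (\<lambda>x. X k x - u x)) \<longlonglongrightarrow> 0"
    using p(2) trinorm_diff_eq[OF XH uH, of 1] by (simp add: H1_norm_eq_trinorm)
  \<comment> \<open>One test function per member, at distance below \<open>1 / Suc k\<close>, gives
    a single sequence of test functions tending to the limit.\<close>
  have "\<exists>\<phi>. \<phi> \<in> test_functions \<Omega> \<and> nrm1 (\<lambda>x. X k x - \<phi> x) < inverse (real (Suc k))" for k
    using H10_approx[OF X, of "inverse (real (Suc k))" k] by (metis inverse_positive_iff_positive of_nat_0_less_iff zero_less_Suc)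
  then obtain \<phi> where \<phi>: "\<And>k. \<phi> k \<in> test_functions \<Omega>"
    "\<And>k. nrm1 (\<lambda>x. X k x - \<phi> k x) < inverse (real (Suc k))" by metis
  have "(\<lambda>k. nrm1 (\<lambda>x. u x - \<phi> k x)) \<longlonglongrightarrow> 0"
  proof (rule tendsto_sandwich[OF _ _ tendsto_const])
    show "(\<lambda>k. nrm1 (\<lambda>x. X k x - u x) + inverse (real (Suc k))) \<longlonglongrightarrow> 0"
      using tendsto_add[OF lim LIMSEQ_inverse_real_of_nat] by simp
    have "nrm1 (\<lambda>x. u x - \<phi> k x) \<le> nrm1 (\<lambda>x. X k x - u x) + inverse (real (Suc k))" for k
    proof -
      have "nrm1 (\<lambda>x. u x - X k x) = nrm1 (\<lambda>x. X k x - u x)"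
        unfolding H1_norm_eq_trinorm
        by (simp add: trinorm_diff_eq uH XH L2_norm_minus_commute)
      then show ?thesis
        using trinorm_triangle_diff[OF uH XH[of k] test_H1(1)[OF \<phi>(1)[of k]], of 1] \<phi>(2)[of k]
        unfolding H1_norm_eq_trinorm by simp
    qed
    then show "\<forall>\<^sub>F k in sequentially. nrm1 (\<lambda>x. u x - \<phi> k x) \<le> nrm1 (\<lambda>x. X k x - u x) + inverse (real (Suc k))"
      by simp
  qed simp
  then have "u \<in> H10 \<Omega>" using uH \<phi>(1) by (auto simp: H10_def)
  then show ?thesis using lim by (rule that)
qed

end

section \<open>Rellich's compactness theorem\<close>

lemma L2_norm_UNIV_power2:
  "h \<in> borel_measurable borel \<Longrightarrow> (L2_norm UNIV h)\<^sup>2 = (\<integral>x. (norm (h x))\<^sup>2 \<partial>lborel)"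
  unfolding L2_norm_power2 by (subst integral_lebesgue_on_eq_lborel) auto

lemma L2_norm_UNIV_translation:
  assumes [measurable]: "h \<in> borel_measurable borel"
  shows "L2_norm UNIV (\<lambda>x. h (x + c)) = L2_norm UNIV h"
proof -
  have "(L2_norm UNIV (\<lambda>x. h (x + c)))\<^sup>2 = (L2_norm UNIV h)\<^sup>2"
    by (subst (1 2) L2_norm_UNIV_power2)
      (use lborel_integral_translation[of "\<lambda>x. (norm (h x))\<^sup>2" c] in auto)
  then show ?thesis by simp
qed

text \<open>A shift by \<open>z\<close> is split into \<open>Suc n\<close> shifts by
  \<open>z / Suc n\<close>, each contributing the same L2 norm by translation invariance. As
  \<open>n\<close> grows, the bound becomes the norm of the directional derivative, and
  Cauchy-Schwarz finishes.\<close>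

lemma translation_difference_bound:
  fixes \<psi> :: "'a::euclidean_space \<Rightarrow> real"
  assumes C1: "Ck 1 \<psi>" and K: "compact (supp \<psi>)"
  shows "(\<integral>x. (\<psi> (x + z) - \<psi> x)\<^sup>2 \<partial>lborel) \<le> (norm z)\<^sup>2 * (\<integral>x. (norm (grad \<psi> x))\<^sup>2 \<partial>lborel)"
proof -
  have cont: "continuous_on UNIV \<psi>" using C1 by (rule Ck_continuous)
  have meas [measurable]: "\<psi> \<in> borel_measurable borel"
    using cont by (rule borel_measurable_continuous_onI)
  have gm [measurable]: "grad \<psi> \<in> borel_measurable borel"
    by (rule borel_measurable_continuous_onI[OF grad_continuous[OF C1]])
  let ?N = "\<lambda>c. L2_norm UNIV (\<lambda>x. \<psi> (x + c) - \<psi> x)"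
  have L2: "(\<lambda>x. \<psi> (x + c)) \<in> L2 UNIV" for c
  proof (rule compactly_supported_L2)
    show "continuous_on UNIV (\<lambda>x. \<psi> (x + c))"
      by (intro continuous_on_compose2[OF cont] continuous_intros) auto
    show "compact ((\<lambda>x. x - c) ` supp \<psi>)"
      using compact_translation_subtract[OF K] .
    fix x assume "x \<notin> (\<lambda>x. x - c) ` supp \<psi>"
    then have "x + c \<notin> supp \<psi>" by (force intro: image_eqI[of _ _ "x + c"])
    then show "\<psi> (x + c) = 0" by (rule test_function_outside)
  qed simp
  have L20: "\<psi> \<in> L2 UNIV" using L2[of 0] by simp
  \<comment> \<open>Telescoping over \<open>k\<close> equal shifts.\<close>
  have mult: "?N (real k *\<^sub>R c) \<le> real k * ?N c" for k c
  proof (induction k)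
    case 0
    then show ?case by (simp add: L2_norm_def)
  next
    case (Suc k)
    have "?N (real (Suc k) *\<^sub>R c) = L2_norm UNIV (\<lambda>x. (\<psi> ((x + real k *\<^sub>R c) + c) - \<psi> (x + real k *\<^sub>R c))
        + (\<psi> (x + real k *\<^sub>R c) - \<psi> x))"
      by (simp add: algebra_simps)
    also have "\<dots> \<le> L2_norm UNIV (\<lambda>x. \<psi> ((x + real k *\<^sub>R c) + c) - \<psi> (x + real k *\<^sub>R c)) + ?N (real k *\<^sub>R c)"
      using L2[of "real k *\<^sub>R c + c"] by (intro L2_norm_triangle L2_diff L2 L20) (simp add: add.assoc)
    also have "L2_norm UNIV (\<lambda>x. \<psi> ((x + real k *\<^sub>R c) + c) - \<psi> (x + real k *\<^sub>R c)) = ?N c"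
      by (rule L2_norm_UNIV_translation[of "\<lambda>x. \<psi> (x + c) - \<psi> x"]) measurable
    finally show ?case using Suc by (simp add: algebra_simps)
  qed
  have le: "(\<integral>x. (\<psi> (x + z) - \<psi> x)\<^sup>2 \<partial>lborel)
      \<le> (\<integral>x. (real (Suc n) * (\<psi> (x + (1 / real (Suc n)) *\<^sub>R z) - \<psi> x))\<^sup>2 \<partial>lborel)" for n
  proof -
    have "(?N z)\<^sup>2 \<le> (real (Suc n) * ?N ((1 / real (Suc n)) *\<^sub>R z))\<^sup>2"
      using mult[of "Suc n" "(1 / real (Suc n)) *\<^sub>R z"] by (intro power_mono) (auto simp del: of_nat_Suc)
    then show ?thesis
      by (simp add: power_mult_distrib L2_norm_UNIV_power2 del: of_nat_Suc)
  qed
  have lim: "(\<lambda>n. \<integral>x. (real (Suc n) * (\<psi> (x + (1 / real (Suc n)) *\<^sub>R z) - \<psi> x))\<^sup>2 \<partial>lborel)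
      \<longlonglongrightarrow> (\<integral>x. (grad \<psi> x \<bullet> z)\<^sup>2 \<partial>lborel)"
    by (rule integral_difference_quotient_limit[OF C1 K]) (auto intro!: continuous_intros)
  have "(\<integral>x. (\<psi> (x + z) - \<psi> x)\<^sup>2 \<partial>lborel) \<le> (\<integral>x. (grad \<psi> x \<bullet> z)\<^sup>2 \<partial>lborel)"
    by (rule LIMSEQ_le_const[OF lim]) (use le in blast)
  also have "\<dots> \<le> (\<integral>x. (norm z)\<^sup>2 * (norm (grad \<psi> x))\<^sup>2 \<partial>lborel)"
  proof (rule integral_mono)
    have gc: "continuous_on UNIV (grad \<psi>)" by (rule grad_continuous[OF C1])
    show "integrable lborel (\<lambda>x. (grad \<psi> x \<bullet> z)\<^sup>2)"
      by (rule compactly_supported_integrable[OF _ K]) (auto intro!: continuous_intros gc simp: grad_outside_support)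
    show "integrable lborel (\<lambda>x. (norm z)\<^sup>2 * (norm (grad \<psi> x))\<^sup>2)"
      by (rule compactly_supported_integrable[OF _ K]) (auto intro!: continuous_intros gc simp: grad_outside_support)
    show "(grad \<psi> x \<bullet> z)\<^sup>2 \<le> (norm z)\<^sup>2 * (norm (grad \<psi> x))\<^sup>2" for x
      using Cauchy_Schwarz_ineq[of "grad \<psi> x" z] by (simp add: power2_norm_eq_inner mult.commute)
  qed
  finally show ?thesis by simp
qed

section \<open>Grid cubes and a Poincare inequality on them\<close>

text \<open>The integer index vector of the half-open grid cube of side \<open>1 / Suc m\<close>
  containing \<open>x\<close>, not scaled back to a corner. A cube is then a fibre of
  \<open>cell m\<close>, which makes the cubes disjoint and covering by construction.\<close>

definition cell :: "nat \<Rightarrow> 'a::euclidean_space \<Rightarrow> 'a" where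
  "cell m x = (\<Sum>i\<in>Basis. of_int \<lfloor>real (Suc m) * (x \<bullet> i)\<rfloor> *\<^sub>R i)"

lemma cell_inner: "i \<in> Basis \<Longrightarrow> cell m x \<bullet> i = of_int \<lfloor>real (Suc m) * (x \<bullet> i)\<rfloor>"
  by (simp add: cell_def inner_sum_left_Basis del: of_nat_Suc)

lemma cell_measurable [measurable]: "cell m \<in> borel_measurable borel"
  unfolding cell_def[abs_def] by measurable

lemma finite_cells: "finite (cell m ` cball (0::'a::euclidean_space) R)"
proof (rule finite_subset)
  let ?I = "{\<lfloor>- (real (Suc m) * R)\<rfloor>..\<lfloor>real (Suc m) * R\<rfloor>}"
  let ?h = "\<lambda>k :: 'a \<Rightarrow> int. \<Sum>i\<in>Basis. of_int (k i) *\<^sub>R i"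
  show "finite (?h ` (Basis \<rightarrow>\<^sub>E ?I))" by (intro finite_imageI finite_PiE) auto
  show "cell m ` cball (0::'a) R \<subseteq> ?h ` (Basis \<rightarrow>\<^sub>E ?I)"
  proof
    fix y assume "y \<in> cell m ` cball (0::'a) R"
    then obtain x where x: "norm x \<le> R" "y = cell m x" by auto
    let ?k = "restrict (\<lambda>i. \<lfloor>real (Suc m) * (x \<bullet> i)\<rfloor>) Basis"
    have "?k \<in> Basis \<rightarrow>\<^sub>E ?I"
    proof (rule restrict_PiE_iff[THEN iffD2], rule ballI)
      fix i :: 'a assume i: "i \<in> Basis"
      have "\<bar>x \<bullet> i\<bar> \<le> R" using Basis_le_norm[OF i, of x] x(1) by linarith
      then have "\<bar>real (Suc m) * (x \<bullet> i)\<bar> \<le> real (Suc m) * R"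
        unfolding abs_mult by (intro mult_mono) auto
      then have "- (real (Suc m) * R) \<le> real (Suc m) * (x \<bullet> i)" "real (Suc m) * (x \<bullet> i) \<le> real (Suc m) * R"
        by linarith+
      then show "\<lfloor>real (Suc m) * (x \<bullet> i)\<rfloor> \<in> ?I"
        unfolding atLeastAtMost_iff by (intro conjI floor_mono)
    qed
    moreover have "y = ?h ?k" unfolding x(2) cell_def by simp
    ultimately show "y \<in> ?h ` (Basis \<rightarrow>\<^sub>E ?I)" by blast
  qed
qed

lemma cell_eq_imp_close:
  assumes "cell m x = cell m y" "i \<in> Basis"
  shows "\<bar>(y - x) \<bullet> i\<bar> \<le> 1 / real (Suc m)"
proof -
  have "\<lfloor>real (Suc m) * (x \<bullet> i)\<rfloor> = \<lfloor>real (Suc m) * (y \<bullet> i)\<rfloor>"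
    using assms cell_inner[of i m x] cell_inner[of i m y] by (simp del: of_nat_Suc)
  then have "\<bar>real (Suc m) * (y \<bullet> i) - real (Suc m) * (x \<bullet> i)\<bar> < 1" by linarith
  then have "real (Suc m) * \<bar>(y - x) \<bullet> i\<bar> < 1"
    unfolding right_diff_distrib[symmetric] inner_diff_left[symmetric] abs_mult by simp
  then show ?thesis by (simp add: field_simps del: of_nat_Suc)
qed

text \<open>An open box with the side length of the grid fits into the fibre, and a closed box
  contains it. The exact measure of a cube is not computed, since the lower bound and finiteness
  suffice for the estimates below.\<close>

lemma cell_measure:
  fixes x :: "'a::euclidean_space" and m :: nat
  defines "Q \<equiv> {y. cell m y = cell m x}"
  shows "Q \<in> sets borel" "emeasure lborel Q < \<infinity>" "(1 / real (Suc m)) ^ DIM('a) \<le> measure lborel Q"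
proof -
  let ?n = "real (Suc m)"
  have n: "?n > 0" by simp
  show Q: "Q \<in> sets borel"
    unfolding Q_def using measurable_sets_borel[OF cell_measurable, of "{cell m x}" m]
    by (simp add: vimage_def)
  have "Q \<subseteq> cbox (x - (1 / ?n) *\<^sub>R One) (x + (1 / ?n) *\<^sub>R One)"
  proof
    fix y assume "y \<in> Q"
    then have y: "cell m x = cell m y" by (simp add: Q_def)
    show "y \<in> cbox (x - (1 / ?n) *\<^sub>R One) (x + (1 / ?n) *\<^sub>R One)"
      unfolding mem_box
    proof
      fix i :: 'a assume i: "i \<in> Basis"
      from cell_eq_imp_close[OF y i]
      show "(x - (1 / ?n) *\<^sub>R One) \<bullet> i \<le> y \<bullet> i \<and> y \<bullet> i \<le> (x + (1 / ?n) *\<^sub>R One) \<bullet> i"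
        using i by (simp add: inner_diff_left inner_add_left abs_le_iff del: of_nat_Suc)
    qed
  qed
  then show fin: "emeasure lborel Q < \<infinity>"
    using bounded_subset[OF bounded_cbox] by (intro emeasure_bounded_finite)
  let ?a = "(1 / ?n) *\<^sub>R cell m x" and ?b = "(1 / ?n) *\<^sub>R (cell m x + One)"
  have "box ?a ?b \<subseteq> Q"
  proof
    fix y assume y: "y \<in> box ?a ?b"
    show "y \<in> Q" unfolding Q_def mem_Collect_eq
    proof (rule euclidean_eqI)
      fix i :: 'a assume i: "i \<in> Basis"
      have "(1 / ?n) * (cell m x \<bullet> i) < y \<bullet> i" "y \<bullet> i < (1 / ?n) * (cell m x \<bullet> i + 1)"
        using y i by (auto simp: mem_box inner_add_left simp del: of_nat_Suc)
      then have "cell m x \<bullet> i < ?n * (y \<bullet> i)" "?n * (y \<bullet> i) < cell m x \<bullet> i + 1"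
        using n by (auto simp: field_simps simp del: of_nat_Suc)
      then show "cell m y \<bullet> i = cell m x \<bullet> i"
        unfolding cell_inner[OF i] of_int_eq_iff by linarith
    qed
  qed
  then have "measure lborel (box ?a ?b) \<le> measure lborel Q"
    using Q fin by (intro measure_mono_fmeasurable) (auto simp: fmeasurable_def)
  also have "measure lborel (box ?a ?b) = (1 / ?n) ^ DIM('a)"
    by (subst measure_lborel_box_eq)
      (simp add: inner_add_left field_simps prod_constant del: of_nat_Suc)
  finally show "(1 / ?n) ^ DIM('a) \<le> measure lborel Q" .
qed

lemma nn_integral_lborel_translation:
  assumes [measurable]: "h \<in> borel_measurable borel"
  shows "(\<integral>\<^sup>+x. h (c + x) \<partial>lborel) = (\<integral>\<^sup>+x. h x \<partial>lborel)"
proof -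
  have "(\<integral>\<^sup>+x. h x \<partial>lborel) = (\<integral>\<^sup>+x. h x \<partial>distr lborel borel ((+) c))"
    by (simp add: lborel_distr_plus)
  also have "\<dots> = (\<integral>\<^sup>+x. h (c + x) \<partial>lborel)"
    by (rule nn_integral_distr) measurable
  finally show ?thesis by simp
qed

text \<open>The variance identity: expand the square and integrate each variable over
  \<open>Q\<close>. The left side is a nonnegative integral so that it can later be summed, shifted
  and reordered without integrability conditions.\<close>

lemma nn_integral_cell_pairs:
  fixes \<psi> :: "'a::euclidean_space \<Rightarrow> real"
  assumes Q: "Q \<in> sets borel" "emeasure lborel Q < \<infinity>"
    and \<psi>: "integrable lborel \<psi>" "integrable lborel (\<lambda>x. (\<psi> x)\<^sup>2)"
  shows "(\<integral>\<^sup>+x. \<integral>\<^sup>+y. ennreal (indicator Q x * indicator Q y * (\<psi> x - \<psi> y)\<^sup>2) \<partial>lborel \<partial>lborel)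
    = ennreal (2 * measure lborel Q * (\<integral>x. indicator Q x * (\<psi> x)\<^sup>2 \<partial>lborel)
        - 2 * (\<integral>x. indicator Q x * \<psi> x \<partial>lborel)\<^sup>2)"
proof -
  define q S I where "q = measure lborel Q" and "S = (\<integral>x. indicator Q x * (\<psi> x)\<^sup>2 \<partial>lborel)"
    and "I = (\<integral>x. indicator Q x * \<psi> x \<partial>lborel)"
  note q' = q_def[symmetric] S_def[symmetric] I_def[symmetric]
  have i0: "integrable lborel (\<lambda>x. indicator Q x :: real)" using Q by (intro integrable_real_indicator) auto
  have i1: "integrable lborel (\<lambda>x. indicator Q x * \<psi> x)"
    using integrable_mult_indicator[OF _ \<psi>(1), of Q] Q by simp
  have i2: "integrable lborel (\<lambda>x. indicator Q x * (\<psi> x)\<^sup>2)"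
    using integrable_mult_indicator[OF _ \<psi>(2), of Q] Q by simp
  have q: "(\<integral>x. indicator Q x \<partial>lborel) = q" by (simp add: q_def)
  have inner: "(\<integral>\<^sup>+y. ennreal (indicator Q x * indicator Q y * (\<psi> x - \<psi> y)\<^sup>2) \<partial>lborel)
      = ennreal (indicator Q x * (q * (\<psi> x)\<^sup>2 - 2 * \<psi> x * I + S))" for x
  proof -
    let ?k = "indicator Q x :: real"
    have eq: "indicator Q x * indicator Q y * (\<psi> x - \<psi> y)\<^sup>2
        = ?k * ((\<psi> x)\<^sup>2 * indicator Q y - 2 * \<psi> x * (indicator Q y * \<psi> y) + indicator Q y * (\<psi> y)\<^sup>2)" for y
      by (simp add: power2_eq_square algebra_simps)
    have int: "integrable lborel (\<lambda>y. ?k * ((\<psi> x)\<^sup>2 * indicator Q y - 2 * \<psi> x * (indicator Q y * \<psi> y) + indicator Q y * (\<psi> y)\<^sup>2))"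
      by (intro integrable_mult_right Bochner_Integration.integrable_add
          Bochner_Integration.integrable_diff i0 i1 i2)
    have "(\<integral>\<^sup>+y. ennreal (indicator Q x * indicator Q y * (\<psi> x - \<psi> y)\<^sup>2) \<partial>lborel)
        = ennreal (\<integral>y. indicator Q x * indicator Q y * (\<psi> x - \<psi> y)\<^sup>2 \<partial>lborel)"
      using int by (intro nn_integral_eq_integral) (simp_all add: eq[symmetric])
    also have "(\<integral>y. indicator Q x * indicator Q y * (\<psi> x - \<psi> y)\<^sup>2 \<partial>lborel)
        = ?k * ((\<psi> x)\<^sup>2 * q - 2 * \<psi> x * I + S)"
      unfolding eq S_def I_def using i0 i1 i2 q by simp
    finally show ?thesis by (simp add: mult.commute)
  qed
  have eq: "indicator Q x * (q * (\<psi> x)\<^sup>2 - 2 * \<psi> x * I + S)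
      = q * (indicator Q x * (\<psi> x)\<^sup>2) - 2 * I * (indicator Q x * \<psi> x) + S * indicator Q x" for x
    by (simp add: algebra_simps)
  have int: "integrable lborel (\<lambda>x. indicator Q x * (q * (\<psi> x)\<^sup>2 - 2 * \<psi> x * I + S))"
    unfolding eq by (intro integrable_mult_right Bochner_Integration.integrable_add
          Bochner_Integration.integrable_diff i0 i1 i2)
  \<comment> \<open>The expression is itself the inner integral of a square over
    \<open>Q\<close>.\<close>
  have nonneg: "0 \<le> indicator Q x * (q * (\<psi> x)\<^sup>2 - 2 * \<psi> x * I + S)" for x
  proof -
    have "0 \<le> (\<integral>y. (\<psi> x)\<^sup>2 * indicator Q y - 2 * \<psi> x * (indicator Q y * \<psi> y) + indicator Q y * (\<psi> y)\<^sup>2 \<partial>lborel)"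
    proof (rule integral_nonneg_AE, rule AE_I2)
      fix y
      have "(\<psi> x)\<^sup>2 * indicator Q y - 2 * \<psi> x * (indicator Q y * \<psi> y) + indicator Q y * (\<psi> y)\<^sup>2
          = indicator Q y * (\<psi> x - \<psi> y)\<^sup>2"
        by (simp add: power2_eq_square algebra_simps)
      then show "0 \<le> (\<psi> x)\<^sup>2 * indicator Q y - 2 * \<psi> x * (indicator Q y * \<psi> y) + indicator Q y * (\<psi> y)\<^sup>2"
        by simp
    qed
    then show ?thesis unfolding S_def I_def using i0 i1 i2 q by (simp add: mult.commute)
  qed
  have "(\<integral>\<^sup>+x. \<integral>\<^sup>+y. ennreal (indicator Q x * indicator Q y * (\<psi> x - \<psi> y)\<^sup>2) \<partial>lborel \<partial>lborel)
     = ennreal (\<integral>x. indicator Q x * (q * (\<psi> x)\<^sup>2 - 2 * \<psi> x * I + S) \<partial>lborel)"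
    unfolding inner using int nonneg by (intro nn_integral_eq_integral) auto
  also have "(\<integral>x. indicator Q x * (q * (\<psi> x)\<^sup>2 - 2 * \<psi> x * I + S) \<partial>lborel) = q * S - 2 * I * I + S * q"
    unfolding eq using i0 i1 i2 q by (simp add: S_def[symmetric] I_def[symmetric])
  also have "\<dots> = 2 * q * S - 2 * I\<^sup>2" by (simp add: power2_eq_square)
  finally show ?thesis unfolding q' .
qed

text \<open>By the variance identity, what remains of the L2 norm after removing the cell integrals
  is a double integral of squared differences over pairs in a common cell. Writing such pairs as
  \<open>x\<close> and \<open>x + z\<close> confines \<open>z\<close> to a cube of side
  \<open>2 * h\<close>, where \<open>norm z\<close> squared is at most
  \<open>DIM('a) * h\<^sup>2\<close>, and the translation estimate bounds the integral for each
  \<open>z\<close>.\<close>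

lemma cell_Poincare:
  fixes \<psi> :: "'a::euclidean_space \<Rightarrow> real" and m :: nat and h :: real
  assumes C1: "Ck 1 \<psi>" and K: "compact (supp \<psi>)"
    and R: "supp \<psi> \<subseteq> cball 0 R"
  defines "h \<equiv> 1 / real (Suc m)"
  shows "2 * h ^ DIM('a) * (\<integral>x. (\<psi> x)\<^sup>2 \<partial>lborel)
    \<le> 2 * (\<Sum>j\<in>cell m ` cball 0 R. (\<integral>x. indicator {x. cell m x = j} x * \<psi> x \<partial>lborel)\<^sup>2)
      + (2 * h) ^ DIM('a) * (DIM('a) * h\<^sup>2 * (\<integral>x. (norm (grad \<psi> x))\<^sup>2 \<partial>lborel))"
proof -
  have h: "h > 0" by (simp add: h_def)
  have cont: "continuous_on UNIV \<psi>" using C1 by (rule Ck_continuous)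
  have meas [measurable]: "\<psi> \<in> borel_measurable borel"
    using cont by (rule borel_measurable_continuous_onI)
  have out: "\<psi> x = 0" if "x \<notin> supp \<psi>" for x
    using that closure_subset[of "{x. \<psi> x \<noteq> 0}"] by auto
  have i1: "integrable lborel \<psi>"
    by (rule compactly_supported_integrable[OF cont K out])
  have i2: "integrable lborel (\<lambda>x. (\<psi> x)\<^sup>2)"
  proof (rule compactly_supported_integrable[OF _ K])
    show "continuous_on UNIV (\<lambda>x. (\<psi> x)\<^sup>2)" by (intro continuous_intros cont)
    show "(\<psi> x)\<^sup>2 = 0" if "x \<notin> supp \<psi>" for x
      using out[OF that] by simp
  qed
  let ?J = "cell m ` cball (0::'a) R" and ?Q = "\<lambda>j. {x :: 'a. cell m x = j}"
  let ?i = "\<lambda>j x. indicator (?Q j) x :: real"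
  define G where "G = (\<integral>x. (norm (grad \<psi> x))\<^sup>2 \<partial>lborel)"
  have G: "G \<ge> 0" by (simp add: G_def)
  have fin: "finite ?J" by (rule finite_cells)
  have Q: "?Q j \<in> sets borel" "emeasure lborel (?Q j) < \<infinity>" "h ^ DIM('a) \<le> measure lborel (?Q j)"
    if "j \<in> ?J" for j
    using that cell_measure[of m] by (auto simp: h_def simp del: of_nat_Suc)
  define S I where "S j = (\<integral>x. ?i j x * (\<psi> x)\<^sup>2 \<partial>lborel)" and "I j = (\<integral>x. ?i j x * \<psi> x \<partial>lborel)" for j
  have S0: "0 \<le> S j" for j unfolding S_def by simp
  have sum1: "(\<Sum>j\<in>?J. ?i j x) \<le> 1" for x
  proof -
    have "(\<Sum>j\<in>?J. ?i j x) = (\<Sum>j\<in>?J. if j = cell m x then 1 else 0)"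
      by (intro sum.cong) (auto simp: indicator_def)
    then show ?thesis using fin by (simp add: sum.delta)
  qed
  have split: "(\<integral>x. (\<psi> x)\<^sup>2 \<partial>lborel) = (\<Sum>j\<in>?J. S j)"
  proof -
    have "(\<psi> x)\<^sup>2 = (\<Sum>j\<in>?J. ?i j x * (\<psi> x)\<^sup>2)" for x
    proof (cases "x \<in> cball 0 R")
      case True
      have "(\<Sum>j\<in>?J. ?i j x * (\<psi> x)\<^sup>2) = (\<Sum>j\<in>?J. if j = cell m x then (\<psi> x)\<^sup>2 else 0)"
        by (intro sum.cong) (auto simp: indicator_def)
      then show ?thesis using True fin by (simp add: sum.delta)
    next
      case False
      then have "x \<notin> supp \<psi>" using R by blast
      from out[OF this] show ?thesis by simp
    qed
    then have "(\<integral>x. (\<psi> x)\<^sup>2 \<partial>lborel) = (\<integral>x. (\<Sum>j\<in>?J. ?i j x * (\<psi> x)\<^sup>2) \<partial>lborel)" by simp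
    also have "\<dots> = (\<Sum>j\<in>?J. S j)"
      unfolding S_def
      using integrable_mult_indicator[OF _ i2] Q(1) by (intro Bochner_Integration.integral_sum) auto
    finally show ?thesis .
  qed
  let ?C = "cbox (- (h *\<^sub>R One)) (h *\<^sub>R One) :: 'a set"
  \<comment> \<open>At most one cell contains both points, and if one does, each coordinate of
    \<open>z\<close> is at most \<open>h\<close> in absolute value.\<close>
  have pair: "(\<Sum>j\<in>?J. ?i j x * ?i j (x + z)) \<le> indicator ?C z" for x z
  proof (cases "cell m x = cell m (x + z)")
    case True
    then have "z \<in> ?C"
      using cell_eq_imp_close[OF True]
      by (auto simp: mem_box h_def abs_le_iff minus_le_iff simp del: of_nat_Suc)
    moreover have "(\<Sum>j\<in>?J. ?i j x * ?i j (x + z)) \<le> (\<Sum>j\<in>?J. ?i j x)"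
      by (intro sum_mono) (auto simp: indicator_def)
    ultimately show ?thesis using sum1[of x] by simp
  next
    case False
    then have "(\<Sum>j\<in>?J. ?i j x * ?i j (x + z)) = 0" by (intro sum.neutral) (auto simp: indicator_def)
    then show ?thesis by simp
  qed
  have jm [measurable]: "?i j \<in> borel_measurable borel" for j
    by (intro borel_measurable_indicator)
      (use measurable_sets_borel[OF cell_measurable, of "{j}" m] in \<open>simp add: vimage_def\<close>)
  \<comment> \<open>Moving to \<open>ennreal\<close> requires every summand to be nonnegative; this
    is seen by integrating the squared deviation of \<psi> from its mean \<open>I j / q\<close> over
    the cell.\<close>
  have "ennreal (\<Sum>j\<in>?J. 2 * measure lborel (?Q j) * S j - 2 * (I j)\<^sup>2)
     = (\<Sum>j\<in>?J. ennreal (2 * measure lborel (?Q j) * S j - 2 * (I j)\<^sup>2))"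
  proof (rule sum_ennreal[symmetric])
    fix j assume j: "j \<in> ?J"
    define q where "q = measure lborel (?Q j)"
    have q: "q > 0" using Q(3)[OF j] h by (auto simp: q_def intro: less_le_trans[of 0 "h ^ DIM('a)"])
    have "0 \<le> (\<integral>x. ?i j x * (\<psi> x - I j / q)\<^sup>2 \<partial>lborel)" by simp
    also have "\<dots> = (\<integral>x. ?i j x * (\<psi> x)\<^sup>2 - 2 * I j / q * (?i j x * \<psi> x) + (I j / q)\<^sup>2 * ?i j x \<partial>lborel)"
      by (intro Bochner_Integration.integral_cong) (auto simp: power2_eq_square algebra_simps)
    also have "\<dots> = S j - 2 * I j / q * I j + (I j / q)\<^sup>2 * q"
      using integrable_mult_indicator[OF _ i2, of "?Q j"] integrable_mult_indicator[OF _ i1, of "?Q j"]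
        integrable_real_indicator[of "?Q j" lborel] Q[OF j]
      by (simp add: S_def I_def q_def)
    also have "\<dots> = S j - (I j)\<^sup>2 / q" using q by (simp add: power2_eq_square field_simps)
    finally show "0 \<le> 2 * measure lborel (?Q j) * S j - 2 * (I j)\<^sup>2"
      using q by (simp add: q_def[symmetric] field_simps)
  qed
  also have "\<dots> = (\<Sum>j\<in>?J. \<integral>\<^sup>+x. \<integral>\<^sup>+y. ennreal (?i j x * ?i j y * (\<psi> x - \<psi> y)\<^sup>2) \<partial>lborel \<partial>lborel)"
    unfolding S_def I_def
    by (intro sum.cong refl nn_integral_cell_pairs[symmetric] Q i1 i2)
  also have "\<dots> = (\<Sum>j\<in>?J. \<integral>\<^sup>+x. \<integral>\<^sup>+z. ennreal (?i j x * ?i j (x + z) * (\<psi> x - \<psi> (x + z))\<^sup>2) \<partial>lborel \<partial>lborel)"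
    by (intro sum.cong refl nn_integral_cong nn_integral_lborel_translation[symmetric]) measurable
  also have "\<dots> = (\<integral>\<^sup>+x. \<integral>\<^sup>+z. (\<Sum>j\<in>?J. ennreal (?i j x * ?i j (x + z) * (\<psi> x - \<psi> (x + z))\<^sup>2)) \<partial>lborel \<partial>lborel)"
    by (subst nn_integral_sum[symmetric], measurable, subst nn_integral_sum, measurable)
  also have "\<dots> \<le> (\<integral>\<^sup>+x. \<integral>\<^sup>+z. ennreal (indicator ?C z * (\<psi> (x + z) - \<psi> x)\<^sup>2) \<partial>lborel \<partial>lborel)"
  proof (intro nn_integral_mono)
    fix x z
    have "(\<Sum>j\<in>?J. ennreal (?i j x * ?i j (x + z) * (\<psi> x - \<psi> (x + z))\<^sup>2))
        = ennreal ((\<Sum>j\<in>?J. ?i j x * ?i j (x + z)) * (\<psi> x - \<psi> (x + z))\<^sup>2)"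
      by (subst sum_ennreal) (auto simp: sum_distrib_right)
    also have "\<dots> \<le> ennreal (indicator ?C z * (\<psi> (x + z) - \<psi> x)\<^sup>2)"
      unfolding power2_commute[of "\<psi> x"] by (intro ennreal_leI mult_right_mono pair) simp
    finally show "(\<Sum>j\<in>?J. ennreal (?i j x * ?i j (x + z) * (\<psi> x - \<psi> (x + z))\<^sup>2))
       \<le> ennreal (indicator ?C z * (\<psi> (x + z) - \<psi> x)\<^sup>2)" .
  qed
  \<comment> \<open>Tonelli puts the shift \<open>z\<close> outside, so that the inner integral is a
    translation difference for one fixed \<open>z\<close>.\<close>
  also have "\<dots> = (\<integral>\<^sup>+z. \<integral>\<^sup>+x. ennreal (indicator ?C z * (\<psi> (x + z) - \<psi> x)\<^sup>2) \<partial>lborel \<partial>lborel)"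
    by (rule lborel_pair.Fubini') measurable
  also have "\<dots> \<le> (\<integral>\<^sup>+z. ennreal (DIM('a) * h\<^sup>2 * G) * indicator ?C z \<partial>lborel)"
  proof (intro nn_integral_mono)
    fix z :: 'a
    show "(\<integral>\<^sup>+x. ennreal (indicator ?C z * (\<psi> (x + z) - \<psi> x)\<^sup>2) \<partial>lborel) \<le> ennreal (DIM('a) * h\<^sup>2 * G) * indicator ?C z"
    proof (cases "z \<in> ?C")
      case True
      have "(norm z)\<^sup>2 = (\<Sum>i\<in>Basis. (z \<bullet> i)\<^sup>2)"
        unfolding power2_norm_eq_inner euclidean_inner[of z z] by (simp add: power2_eq_square)
      also have "\<dots> \<le> (\<Sum>i\<in>(Basis :: 'a set). h\<^sup>2)"
      proof (rule sum_mono)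
        fix i :: 'a assume "i \<in> Basis"
        then have "\<bar>z \<bullet> i\<bar> \<le> h" using True by (auto simp: mem_box abs_le_iff)
        then show "(z \<bullet> i)\<^sup>2 \<le> h\<^sup>2" by (metis abs_le_square_iff abs_of_pos h)
      qed
      finally have nz: "(norm z)\<^sup>2 \<le> DIM('a) * h\<^sup>2" by simp
      have int: "integrable lborel (\<lambda>x. (\<psi> (x + z) - \<psi> x)\<^sup>2)"
      proof (rule compactly_supported_integrable)
        show "continuous_on UNIV (\<lambda>x. (\<psi> (x + z) - \<psi> x)\<^sup>2)"
          by (intro continuous_intros continuous_on_compose2[OF cont]) auto
        show "compact (cball (0::'a) (R + norm z))" by simp
        fix x :: 'a assume "x \<notin> cball 0 (R + norm z)"
        then have "x \<notin> cball 0 R" "x + z \<notin> cball 0 R"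
          using norm_triangle_ineq4[of "x + z" z] norm_ge_zero[of z] unfolding mem_cball_0 add_diff_cancel_right'
          by linarith+
        then have "\<psi> x = 0" "\<psi> (x + z) = 0" using out[of x] out[of "x + z"] R by blast+
        then show "(\<psi> (x + z) - \<psi> x)\<^sup>2 = 0" by simp
      qed
      have "(\<integral>\<^sup>+x. ennreal (indicator ?C z * (\<psi> (x + z) - \<psi> x)\<^sup>2) \<partial>lborel)
          = ennreal (\<integral>x. (\<psi> (x + z) - \<psi> x)\<^sup>2 \<partial>lborel)"
        using True int by (simp add: nn_integral_eq_integral)
      also have "\<dots> \<le> ennreal (DIM('a) * h\<^sup>2 * G)"
        using translation_difference_bound[OF C1 K, of z] mult_right_mono[OF nz G]
        by (intro ennreal_leI) (simp add: G_def)
      finally show ?thesis using True by simp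
    qed simp
  qed
  also have "\<dots> = ennreal (DIM('a) * h\<^sup>2 * G) * emeasure lborel ?C"
    by (rule nn_integral_cmult_indicator) simp
  also have "emeasure lborel ?C = ennreal ((2 * h) ^ DIM('a))"
  proof -
    have "(\<Prod>b\<in>Basis. (h *\<^sub>R One - - (h *\<^sub>R One)) \<bullet> (b :: 'a)) = (\<Prod>b\<in>(Basis :: 'a set). 2 * h)"
      by (intro prod.cong) (auto simp: inner_add_left)
    then show ?thesis using h by (simp add: emeasure_lborel_cbox_eq del: diff_minus_eq_add)
  qed
  also have "ennreal (DIM('a) * h\<^sup>2 * G) * ennreal ((2 * h) ^ DIM('a)) = ennreal ((2 * h) ^ DIM('a) * (DIM('a) * h\<^sup>2 * G))"
    using G h by (simp add: ennreal_mult[symmetric] mult.commute)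
  finally have main: "(\<Sum>j\<in>?J. 2 * measure lborel (?Q j) * S j - 2 * (I j)\<^sup>2) \<le> (2 * h) ^ DIM('a) * (DIM('a) * h\<^sup>2 * G)"
    using G h by (subst (asm) ennreal_le_iff) auto
  \<comment> \<open>The lower bound \<open>h ^ DIM('a)\<close> for the measure of a cell replaces
    the individual measures.\<close>
  have "2 * h ^ DIM('a) * (\<integral>x. (\<psi> x)\<^sup>2 \<partial>lborel) = (\<Sum>j\<in>?J. 2 * h ^ DIM('a) * S j)"
    by (simp add: split sum_distrib_left)
  also have "\<dots> \<le> (\<Sum>j\<in>?J. 2 * measure lborel (?Q j) * S j)"
    by (intro sum_mono mult_right_mono mult_left_mono Q S0) auto
  also have "\<dots> = (\<Sum>j\<in>?J. 2 * measure lborel (?Q j) * S j - 2 * (I j)\<^sup>2) + 2 * (\<Sum>j\<in>?J. (I j)\<^sup>2)"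
    by (simp add: sum_subtractf sum_distrib_left)
  finally show ?thesis using main unfolding I_def G_def by linarith
qed

section \<open>Compactness from convergence of cell integrals\<close>

context bounded_open_domain
begin

lemma test_norms_lborel:
  assumes \<phi>: "\<phi> \<in> test_functions \<Omega>"
  shows "(\<integral>x. (\<phi> x)\<^sup>2 \<partial>lborel) = (nrm \<phi>)\<^sup>2"
    and "(\<integral>x. (norm (grad \<phi> x))\<^sup>2 \<partial>lborel) = (nrm (\<nabla> \<phi>))\<^sup>2"
proof -
  have m: "\<phi> \<in> borel_measurable borel" "grad \<phi> \<in> borel_measurable borel"
    using test_functionsD(5,6)[OF \<phi>] by (auto intro: borel_measurable_continuous_onI)
  have o: "\<phi> x = 0" "grad \<phi> x = 0" if "x \<notin> \<Omega>" for x
    using that test_functionsD(3)[OF \<phi>] test_function_outside[of x \<phi>] grad_outside_support[of x \<phi>] by blast+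
  show "(\<integral>x. (\<phi> x)\<^sup>2 \<partial>lborel) = (nrm \<phi>)\<^sup>2"
    unfolding L2_norm_power2 using m o by (simp add: integral_lebesgue_on_eq_lborel)
  have "nrm (\<nabla> \<phi>) = nrm (grad \<phi>)"
    using \<phi> by (intro L2_norm_cong_AE test_H1(2) L2_measurable[OF wgrad_L2] test_H1(1)
      L2_measurable[OF test_L2(2)])
  then show "(\<integral>x. (norm (grad \<phi> x))\<^sup>2 \<partial>lborel) = (nrm (\<nabla> \<phi>))\<^sup>2"
    using m o by (simp add: L2_norm_power2 integral_lebesgue_on_eq_lborel)
qed

text \<open>The integrals over all grid cubes of all mesh sizes are a countable family of bounded
  real sequences, so one diagonal subsequence makes all of them converge. For a given accuracy, a
  mesh is fixed that makes the gradient term of \<open>cell_Poincare\<close> small, and the finitely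
  many cell integrals of differences are then small eventually.\<close>

lemma Rellich_test_functions:
  assumes \<phi>: "\<And>n. \<phi> n \<in> test_functions \<Omega>" and M: "\<And>n. nrm1 (\<phi> n) \<le> M"
  shows "\<exists>r :: nat \<Rightarrow> nat. strict_mono r \<and>
    (\<forall>e>0. \<exists>K. \<forall>k\<ge>K. \<forall>l\<ge>K. nrm (\<lambda>x. \<phi> (r k) x - \<phi> (r l) x) < e)"
proof -
  obtain R where R: "\<Omega> \<subseteq> cball 0 R"
    using bounded_subset_ballD[OF bounded_domain, of 0] ball_subset_cball by blast
  have M0: "M \<ge> 0" using M[of 0] H1_norm_nonneg[of "\<phi> 0"] by linarith
  let ?I = "\<lambda>n (m, j). \<integral>x. indicator {x :: 'a. cell m x = j} x * \<phi> n x \<partial>lborel"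
  let ?S = "SIGMA m:UNIV. cell m ` cball (0::'a) R"
  have cont: "continuous_on UNIV (\<phi> n)" for n using \<phi> by (rule test_functionsD(5))
  have int: "integrable lborel (\<phi> n)" for n
    by (rule compactly_supported_integrable[OF cont test_functionsD(2)[OF \<phi>]]) (erule test_function_outside)
  have cellm: "{x :: 'a. cell m x = j} \<in> sets borel" for m j
    using measurable_sets_borel[OF cell_measurable, of "{j}" m] by (simp add: vimage_def)
  have Iint: "integrable lborel (\<lambda>x. indicator {x :: 'a. cell m x = j} x * \<phi> n x)" for m j n
    using integrable_mult_indicator[OF _ int[of n], of "{x :: 'a. cell m x = j}"] cellm by simp
  let ?c = "nrm (\<lambda>x. 1 :: real)"
  have bound: "norm (?I n p) \<le> ?c * M" for n p
  proof -
    obtain m j where p: "p = (m, j)" by (cases p)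
    have "norm (?I n p) \<le> (\<integral>x. norm (indicator {x :: 'a. cell m x = j} x * \<phi> n x) \<partial>lborel)"
      unfolding p by (simp add: integral_norm_bound)
    also have "\<dots> \<le> (\<integral>x. norm (\<phi> n x) \<partial>lborel)"
      by (intro integral_mono integrable_norm Iint int) (auto simp: indicator_def)
    also have "\<dots> = (\<integral>x. norm (\<phi> n x) \<partial>\<mu>)"
    proof (rule integral_lebesgue_on_eq_lborel[symmetric])
      show "(\<lambda>x. norm (\<phi> n x)) \<in> borel_measurable borel"
        using borel_measurable_continuous_onI[OF cont[of n]] by measurable
      show "norm (\<phi> n x) = 0" if "x \<notin> \<Omega>" for x
        using that test_functionsD(3)[OF \<phi>[of n]] test_function_outside[of x "\<phi> n"] by auto
    qed simp
    also have "\<dots> \<le> ?c * nrm (\<phi> n)"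
      by (rule L2_norm_le_L1[OF domain_lmeasurable test_L2(1)[OF \<phi>]])
    also have "\<dots> \<le> ?c * M"
      using L2_norm_le_trinorm[of 1 "\<phi> n"] M[of n]
      by (intro mult_left_mono) (auto simp: H1_norm_eq_trinorm)
    finally show ?thesis .
  qed
  have "countable ?S" by (intro countable_SIGMA) (auto intro: countable_finite finite_cells)
  \<comment> \<open>Diagonal extraction over the countable set of pairs of a mesh and a cell
    index.\<close>
  from function_convergent_subsequence[OF this, of ?I, OF bound]
  obtain r :: "nat \<Rightarrow> nat" where r: "strict_mono r"
    and conv: "\<And>p. p \<in> ?S \<Longrightarrow> \<exists>l. (\<lambda>n. ?I (r n) p) \<longlonglongrightarrow> l" by blast
  have "\<exists>K. \<forall>k\<ge>K. \<forall>l\<ge>K. nrm (\<lambda>x. \<phi> (r k) x - \<phi> (r l) x) < e" if e: "e > 0" for e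
  proof -
    define d where "d = DIM('a)"
    \<comment> \<open>The gradient term of \<open>cell_Poincare\<close> equals
      \<open>h ^ d * (c * h\<^sup>2)\<close> once the gradient of a difference is bounded by
      \<open>2 * M\<close>.\<close>
    define c where "c = 2 ^ d * real d * (2 * M)\<^sup>2"
    have c: "c \<ge> 0" by (simp add: c_def)
    obtain m where m: "c * (1 / real (Suc m))\<^sup>2 < e\<^sup>2"
    proof -
      have "(\<lambda>m. c * (1 / real (Suc m))\<^sup>2) \<longlonglongrightarrow> c * 0\<^sup>2"
        using LIMSEQ_inverse_real_of_nat by (intro tendsto_intros) (simp add: inverse_eq_divide)
      from order_tendstoD(2)[OF this, of "e\<^sup>2"] e
      have "\<forall>\<^sub>F m in sequentially. c * (1 / real (Suc m))\<^sup>2 < e\<^sup>2" by simp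
      then show ?thesis using that eventually_happens'[OF sequentially_bot] by blast
    qed
    define h where "h = 1 / real (Suc m)"
    have h: "h > 0" by (simp add: h_def)
    let ?J = "cell m ` cball (0::'a) R"
    have fin: "finite ?J" by (rule finite_cells)
    \<comment> \<open>Chosen so that the squares of \<open>card ?J\<close> cell integrals add up to
      at most half of \<open>h ^ d * e\<^sup>2\<close>; the added 1 keeps the divisor
      positive.\<close>
    define e' where "e' = h ^ d * (e\<^sup>2 / 2) / (real (card ?J) + 1)"
    have e': "e' > 0" using h e by (simp add: e'_def add_nonneg_pos)
    have "\<exists>K. \<forall>k\<ge>K. \<forall>l\<ge>K. \<bar>?I (r k) (m, j) - ?I (r l) (m, j)\<bar> < sqrt e'" if "j \<in> ?J" for j
    proof -
      have "Cauchy (\<lambda>n. ?I (r n) (m, j))"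
        using conv[of "(m, j)"] that by (intro convergent_Cauchy) (auto simp: convergent_def)
      from CauchyD[OF this, of "sqrt e'"] e' show ?thesis by auto
    qed
    then have "\<forall>j\<in>?J. \<exists>K. \<forall>k\<ge>K. \<forall>l\<ge>K. \<bar>?I (r k) (m, j) - ?I (r l) (m, j)\<bar> < sqrt e'" by blast
    from bchoice[OF this] obtain K where K: "\<And>j k l. j \<in> ?J \<Longrightarrow> k \<ge> K j \<Longrightarrow> l \<ge> K j \<Longrightarrow>
      \<bar>?I (r k) (m, j) - ?I (r l) (m, j)\<bar> < sqrt e'" by blast
    define L where "L = Max (insert 0 (K ` ?J))"
    have L: "K j \<le> L" if "j \<in> ?J" for j unfolding L_def using that fin by (intro Max_ge) auto
    have "nrm (\<lambda>x. \<phi> (r k) x - \<phi> (r l) x) < e" if kl: "k \<ge> L" "l \<ge> L" for k l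
    proof -
      let ?\<psi> = "\<lambda>x. \<phi> (r k) x - \<phi> (r l) x"
      have \<psi>: "?\<psi> \<in> test_functions \<Omega>" using test_functions_lincomb[OF \<phi>[of "r k"] \<phi>[of "r l"], of 1 "-1"] by simp
      have i: "(\<integral>x. indicator {x. cell m x = j} x * ?\<psi> x \<partial>lborel) = ?I (r k) (m, j) - ?I (r l) (m, j)" for j
        using Iint by (simp add: right_diff_distrib)
      have "(\<integral>x. indicator {x. cell m x = j} x * ?\<psi> x \<partial>lborel)\<^sup>2 \<le> e'" if "j \<in> ?J" for j
      proof -
        have "\<bar>?I (r k) (m, j) - ?I (r l) (m, j)\<bar> \<le> sqrt e'"
          using K[OF that, of k l] L[OF that] kl by simp
        then have "\<bar>?I (r k) (m, j) - ?I (r l) (m, j)\<bar>\<^sup>2 \<le> (sqrt e')\<^sup>2" by (intro power_mono) auto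
        then show ?thesis using e' unfolding i by simp
      qed
      then have "(\<Sum>j\<in>?J. (\<integral>x. indicator {x. cell m x = j} x * ?\<psi> x \<partial>lborel)\<^sup>2) \<le> real (card ?J) * e'"
        using sum_bounded_above[of ?J _ e'] by simp
      also have "\<dots> \<le> h ^ d * (e\<^sup>2 / 2)"
      proof -
        have cancel: "c \<ge> 0 \<Longrightarrow> (c + 1) * (B / (c + 1)) = B" for c B :: real by simp
        have "real (card ?J) * e' \<le> (real (card ?J) + 1) * e'" using e' by simp
        also have "\<dots> = h ^ d * (e\<^sup>2 / 2)" unfolding e'_def by (rule cancel) simp
        finally show ?thesis .
      qed
      finally have s: "(\<Sum>j\<in>?J. (\<integral>x. indicator {x. cell m x = j} x * ?\<psi> x \<partial>lborel)\<^sup>2) \<le> h ^ d * (e\<^sup>2 / 2)" .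
      have "nrm1 ?\<psi> \<le> 2 * M"
        using trinorm_lincomb_le[OF test_H1(1)[OF \<phi>[of "r k"]] test_H1(1)[OF \<phi>[of "r l"]], of 1 1 "-1"]
          M[of "r k"] M[of "r l"] by (simp add: H1_norm_eq_trinorm)
      then have "nrm (\<nabla> ?\<psi>) \<le> 2 * M" using L2_norm_wgrad_le_H1_norm[of ?\<psi>] by simp
      then have g: "(nrm (\<nabla> ?\<psi>))\<^sup>2 \<le> (2 * M)\<^sup>2" by (intro power_mono) auto
      have "2 * h ^ d * (nrm ?\<psi>)\<^sup>2
         \<le> 2 * (\<Sum>j\<in>?J. (\<integral>x. indicator {x. cell m x = j} x * ?\<psi> x \<partial>lborel)\<^sup>2)
           + (2 * h) ^ d * (d * h\<^sup>2 * (nrm (\<nabla> ?\<psi>))\<^sup>2)"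
        using cell_Poincare[OF test_functionsD(1,2)[OF \<psi>] order_trans[OF test_functionsD(3)[OF \<psi>] R], of m]
        unfolding test_norms_lborel[OF \<psi>] h_def d_def .
      also have "\<dots> \<le> 2 * (h ^ d * (e\<^sup>2 / 2)) + (2 * h) ^ d * (d * h\<^sup>2 * (2 * M)\<^sup>2)"
        using h by (intro add_mono mult_left_mono s g) auto
      also have "\<dots> = h ^ d * (e\<^sup>2 + c * h\<^sup>2)"
        by (simp add: c_def power_mult_distrib algebra_simps)
      also have "\<dots> < h ^ d * (2 * e\<^sup>2)"
        using m h unfolding h_def[symmetric] by (intro mult_strict_left_mono) auto
      finally have "(nrm ?\<psi>)\<^sup>2 < e\<^sup>2" using h by simp
      then show ?thesis using e by (intro power2_less_imp_less[of _ e]) auto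
    qed
    then show ?thesis by blast
  qed
  with r show ?thesis by blast
qed

text \<open>Each member is replaced by a test function at distance below \<open>1 / Suc k\<close>;
  the subsequence found for these serves the original sequence by a three-term estimate.\<close>

theorem Rellich:
  assumes X: "\<And>n. X n \<in> H10 \<Omega>" and M: "\<And>n. nrm1 (X n) \<le> M"
  shows "\<exists>r :: nat \<Rightarrow> nat. strict_mono r \<and>
    (\<forall>e>0. \<exists>K. \<forall>k\<ge>K. \<forall>l\<ge>K. nrm (\<lambda>x. X (r k) x - X (r l) x) < e)"
proof -
  have "\<exists>\<phi>. \<phi> \<in> test_functions \<Omega> \<and> nrm1 (\<lambda>x. X k x - \<phi> x) < inverse (real (Suc k))" for k
    using H10_approx[OF X, of "inverse (real (Suc k))" k] by (metis inverse_positive_iff_positive of_nat_0_less_iff zero_less_Suc)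
  then obtain \<phi> where \<phi>: "\<And>k. \<phi> k \<in> test_functions \<Omega>"
    "\<And>k. nrm1 (\<lambda>x. X k x - \<phi> k x) < inverse (real (Suc k))" by metis
  have "nrm1 (\<phi> k) \<le> M + 1" for k
  proof -
    have "inverse (real (Suc k)) \<le> 1" by (simp add: field_simps)
    then show ?thesis
      using trinorm_lincomb_le[OF H10_H1[OF X[of k]] H1_diff[OF H10_H1[OF X[of k]] test_H1(1)[OF \<phi>(1)[of k]]], of 1 1 "-1"]
        M[of k] \<phi>(2)[of k] unfolding H1_norm_eq_trinorm by simp
  qed
  from Rellich_test_functions[OF \<phi>(1) this]
  obtain r :: "nat \<Rightarrow> nat" where rC: "strict_mono r \<and>
    (\<forall>e>0. \<exists>K. \<forall>k\<ge>K. \<forall>l\<ge>K. nrm (\<lambda>x. \<phi> (r k) x - \<phi> (r l) x) < e)" ..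
  then have r: "strict_mono r" ..
  have C: "\<exists>K. \<forall>k\<ge>K. \<forall>l\<ge>K. nrm (\<lambda>x. \<phi> (r k) x - \<phi> (r l) x) < e" if "e > 0" for e
    using conjunct2[OF rC, rule_format, OF that] .
  have "\<exists>K. \<forall>k\<ge>K. \<forall>l\<ge>K. nrm (\<lambda>x. X (r k) x - X (r l) x) < e" if e: "e > 0" for e
  proof -
    obtain K where K: "\<And>k l. k \<ge> K \<Longrightarrow> l \<ge> K \<Longrightarrow> nrm (\<lambda>x. \<phi> (r k) x - \<phi> (r l) x) < e / 3"
      using C[of "e / 3"] e by auto
    obtain N where N: "inverse (real (Suc N)) < e / 3" using reals_Archimedean[of "e / 3"] e by auto
    have close: "nrm (\<lambda>x. X (r k) x - \<phi> (r k) x) < e / 3" if "k \<ge> N" for k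
    proof -
      have "inverse (real (Suc (r k))) \<le> inverse (real (Suc N))"
        using that seq_suble[OF r, of k] by (intro le_imp_inverse_le) auto
      then show ?thesis
        using \<phi>(2)[of "r k"] N L2_norm_le_trinorm[of 1 "\<lambda>x. X (r k) x - \<phi> (r k) x"]
        unfolding H1_norm_eq_trinorm by linarith
    qed
    have "nrm (\<lambda>x. X (r k) x - X (r l) x) < e" if "k \<ge> max K N" "l \<ge> max K N" for k l
    proof -
      have "nrm (\<lambda>x. X (r k) x - X (r l) x) \<le> nrm (\<lambda>x. X (r k) x - \<phi> (r k) x)
          + (nrm (\<lambda>x. \<phi> (r k) x - \<phi> (r l) x) + nrm (\<lambda>x. \<phi> (r l) x - X (r l) x))"
        using L2_norm_triangle_diff[OF H10_L2[OF X[of "r k"]] test_L2(1)[OF \<phi>(1)[of "r k"]] H10_L2[OF X[of "r l"]]]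
          L2_norm_triangle_diff[OF test_L2(1)[OF \<phi>(1)[of "r k"]] test_L2(1)[OF \<phi>(1)[of "r l"]] H10_L2[OF X[of "r l"]]]
        by linarith
      then show ?thesis
        using close[of k] close[of l] K[of k l] that L2_norm_minus_commute[of \<Omega> "\<phi> (r l)" "X (r l)"] by simp
    qed
    then show ?thesis by blast
  qed
  with r show ?thesis by blast
qed

end

section \<open>The semilinear energy\<close>

text \<open>Rounding \<open>s\<close> down to a grid of mesh \<open>1 / Suc n\<close> leaves
  countably many values, for which measurability in \<open>x\<close> suffices; continuity in
  \<open>s\<close> lets the rounded functions converge pointwise.\<close>

lemma Caratheodory_joint_measurable:
  fixes g :: "'x \<Rightarrow> real \<Rightarrow> real"
  assumes meas: "\<And>s. (\<lambda>x. g x s) \<in> borel_measurable M"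
    and cont: "\<And>x. x \<in> space M \<Longrightarrow> continuous_on UNIV (g x)"
  shows "(\<lambda>(x, s). g x s) \<in> borel_measurable (M \<Otimes>\<^sub>M borel)"
proof -
  let ?a = "\<lambda>n s. real_of_int \<lfloor>real (Suc n) * s\<rfloor> / real (Suc n)"
  have "(\<lambda>p. g (fst p) (?a n (snd p))) \<in> borel_measurable (M \<Otimes>\<^sub>M borel)" for n
  proof (rule measurable_compose_countable[where f="\<lambda>i p. g (fst p) (real_of_int i / real (Suc n))"
        and g="\<lambda>p. \<lfloor>real (Suc n) * snd p\<rfloor>"])
    show "(\<lambda>p. g (fst p) (real_of_int i / real (Suc n))) \<in> borel_measurable (M \<Otimes>\<^sub>M borel)" for i :: int
      by (rule measurable_compose[OF measurable_fst meas])
    show "(\<lambda>p. \<lfloor>real (Suc n) * snd p\<rfloor>) \<in> measurable (M \<Otimes>\<^sub>M borel) (count_space UNIV)"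
      by measurable
  qed
  moreover have "(\<lambda>n. g (fst p) (?a n (snd p))) \<longlonglongrightarrow> (case p of (x, s) \<Rightarrow> g x s)"
    if "p \<in> space (M \<Otimes>\<^sub>M borel)" for p
  proof -
    obtain x s where p: "p = (x, s)" by (cases p)
    have "(\<lambda>n. ?a n s) \<longlonglongrightarrow> s"
    proof (rule LIMSEQ_I)
      fix e :: real assume "e > 0"
      then obtain N where N: "inverse (real (Suc N)) < e" using reals_Archimedean by blast
      have "norm (?a n s - s) < e" if "n \<ge> N" for n
      proof -
        have "\<bar>real_of_int \<lfloor>real (Suc n) * s\<rfloor> - real (Suc n) * s\<bar> \<le> 1" by linarith
        then have "\<bar>real (Suc n) * (?a n s - s)\<bar> \<le> 1"
          by (simp add: right_diff_distrib del: of_nat_Suc)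
        then have "\<bar>?a n s - s\<bar> \<le> inverse (real (Suc n))"
          unfolding abs_mult by (simp add: field_simps del: of_nat_Suc)
        also have "\<dots> \<le> inverse (real (Suc N))" using that by (intro le_imp_inverse_le) auto
        finally show ?thesis using N by simp
      qed
      then show "\<exists>N. \<forall>n\<ge>N. norm (?a n s - s) < e" by blast
    qed
    moreover have "isCont (g x) s"
      using cont[of x] that continuous_on_eq_continuous_at[OF open_UNIV] by (auto simp: p space_pair_measure)
    ultimately have "(\<lambda>n. g x (?a n s)) \<longlonglongrightarrow> g x s" by (rule isCont_tendsto_compose[rotated])
    then show ?thesis by (simp add: p)
  qed
  ultimately show ?thesis by (rule borel_measurable_LIMSEQ_metric)
qed

lemma Caratheodory_measurable:
  fixes g :: "'x \<Rightarrow> real \<Rightarrow> real"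
  assumes "\<And>s. (\<lambda>x. g x s) \<in> borel_measurable M"
    and "\<And>x. x \<in> space M \<Longrightarrow> continuous_on UNIV (g x)" and "u \<in> borel_measurable M"
  shows "(\<lambda>x. g x (u x)) \<in> borel_measurable M"
proof -
  have "(\<lambda>x. (x, u x)) \<in> measurable M (M \<Otimes>\<^sub>M borel)" using assms(3) by measurable
  from measurable_compose[OF this Caratheodory_joint_measurable[OF assms(1,2)]]
  show ?thesis by simp
qed

section \<open>Primitives of the nonlinearity\<close>

lemma LBINT_antiderivative:
  fixes g :: "real \<Rightarrow> real"
  assumes "continuous_on UNIV g"
  shows "((\<lambda>t. LBINT s=0..ereal t. g s) has_real_derivative g t) (at t)"
proof -
  have "isCont g s" for s using assms continuous_on_eq_continuous_at[OF open_UNIV] by auto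
  then obtain G where G: "\<And>s. (G has_vector_derivative g s) (at s)"
    using einterval_antiderivative[of "-\<infinity>" "\<infinity>" g] by auto
  have "(LBINT s=ereal 0..ereal t. g s) = G t - G 0" for t
    by (rule interval_integral_FTC_finite)
      (auto intro: continuous_on_subset[OF assms] has_vector_derivative_at_within[OF G])
  then have eq: "(\<lambda>t. LBINT s=0..ereal t. g s) = (\<lambda>t. G t - G 0)"
    by (simp add: zero_ereal_def)
  show ?thesis
    unfolding eq using G[of t] by (auto intro!: derivative_eq_intros simp: has_real_derivative_iff_has_vector_derivative)
qed

lemma LBINT_zero [simp]: "(LBINT s=0..ereal 0. (g s :: real)) = 0"
  by (simp add: zero_ereal_def[symmetric])

text \<open>Mean value inequality on the symmetric interval from \<open>- \<bar>t\<bar>\<close> to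
  \<open>\<bar>t\<bar>\<close>, which treats both signs of \<open>t\<close> at once.\<close>

lemma LBINT_linear_growth:
  fixes g :: "real \<Rightarrow> real"
  assumes g: "continuous_on UNIV g" and L: "L \<ge> 0" and Lip: "\<And>s t. \<bar>g s - g t\<bar> \<le> L * \<bar>s - t\<bar>"
  shows "\<bar>LBINT s=0..ereal t. g s\<bar> \<le> (\<bar>g 0\<bar> + L * \<bar>t\<bar>) * \<bar>t\<bar>"
proof -
  let ?F = "\<lambda>t. LBINT s=0..ereal t. g s"
  have "\<bar>?F t - ?F 0\<bar> \<le> (\<bar>g 0\<bar> + L * \<bar>t\<bar>) * \<bar>t - 0\<bar>"
  proof (rule field_differentiable_bound[where S="{-\<bar>t\<bar>..\<bar>t\<bar>}" and f="?F" and f'=g, unfolded real_norm_def])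
    show "(?F has_field_derivative g s) (at s within {- \<bar>t\<bar>..\<bar>t\<bar>})" for s
      by (rule has_field_derivative_at_within[OF LBINT_antiderivative[OF g]])
    fix s assume "s \<in> {- \<bar>t\<bar>..\<bar>t\<bar>}"
    then have "\<bar>s\<bar> \<le> \<bar>t\<bar>" by auto
    then have "L * \<bar>s\<bar> \<le> L * \<bar>t\<bar>" using L by (rule mult_left_mono)
    then show "\<bar>g s\<bar> \<le> \<bar>g 0\<bar> + L * \<bar>t\<bar>"
      using Lip[of s 0] by simp
  qed auto
  then show ?thesis by simp
qed

text \<open>Adding \<open>K / 2 * t\<^sup>2\<close> to the primitive makes it convex; the claim is
  the tangent inequality of that convex function at \<open>r\<close>.\<close>

lemma LBINT_semiconvex:
  fixes g :: "real \<Rightarrow> real"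
  assumes g: "continuous_on UNIV g" and K: "\<And>s t. s \<le> t \<Longrightarrow> g t - g s \<ge> - K * (t - s)"
  shows "(LBINT s=0..ereal t. g s) - (LBINT s=0..ereal r. g s) \<ge> g r * (t - r) - K / 2 * (t - r)\<^sup>2"
proof -
  let ?F = "\<lambda>t. LBINT s=0..ereal t. g s"
  \<comment> \<open>The gap above the tangent: it vanishes at \<open>r\<close>, decreases before
    \<open>r\<close> and increases after it.\<close>
  define G where "G t = ?F t - ?F r - g r * (t - r) + K / 2 * (t - r)\<^sup>2" for t
  have G: "(G has_real_derivative g t - g r + K * (t - r)) (at t)" for t
    unfolding G_def[abs_def]
    by (auto intro!: derivative_eq_intros LBINT_antiderivative g)
  have "G r \<le> G t"
  proof (cases "r \<le> t")
    case True
    then show ?thesis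
    proof (rule DERIV_nonneg_imp_nondecreasing)
      fix x assume "r \<le> x" "x \<le> t"
      then have "g x - g r + K * (x - r) \<ge> 0" using K[of r x] by simp
      then show "\<exists>y. (G has_real_derivative y) (at x) \<and> 0 \<le> y" using G by blast
    qed
  next
    case False
    then have "t \<le> r" by simp
    then show ?thesis
    proof (rule DERIV_nonpos_imp_nonincreasing)
      fix x assume "t \<le> x" "x \<le> r"
      then have "g x - g r + K * (x - r) \<le> 0" using K[of x r] by (simp add: algebra_simps)
      then show "\<exists>y. (G has_real_derivative y) (at x) \<and> y \<le> 0" using G by blast
    qed
  qed
  moreover have "G r = 0" by (simp add: G_def)
  ultimately show ?thesis by (simp add: G_def)
qed

text \<open>\<open>L\<close> bounds the slope of \<open>f\<close> from both sides and serves all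
  continuity estimates. \<open>K\<close> bounds it from below only and may be smaller than
  \<open>L\<close>; it is the constant that enters the energy balance. The restriction on the time
  step appears here as \<open>dt_small\<close>.\<close>

locale semilinear_problem = bounded_open_domain \<Omega>
  for \<Omega> :: "'a::euclidean_space set" +
  fixes f :: "'a \<Rightarrow> real \<Rightarrow> real" and L K dt C\<^sub>P :: real
  assumes f_measurable: "\<And>s. (\<lambda>x. f x s) \<in> borel_measurable (lebesgue_on \<Omega>)"
    and f_continuous: "\<And>x. x \<in> \<Omega> \<Longrightarrow> continuous_on UNIV (f x)"
    and f_zero_L2: "(\<lambda>x. f x 0) \<in> L2 \<Omega>"
    and L_nonneg: "L \<ge> 0"
    and f_Lipschitz: "AE x in lebesgue_on \<Omega>. \<forall>s t. \<bar>f x s - f x t\<bar> \<le> L * \<bar>s - t\<bar>"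
    and f_semimonotone: "AE x in lebesgue_on \<Omega>. \<forall>s t. s \<le> t \<longrightarrow> f x t - f x s \<ge> - K * (t - s)"
    and dt_pos: "dt > 0"
    and Poincare: "poincare_constant \<Omega> C\<^sub>P"
    and dt_small: "1 / dt - K / 2 + 1 / (2 * C\<^sub>P) > 0"
begin

abbreviation E where "E \<equiv> energy \<Omega> f"
abbreviation dE where "dE \<equiv> energy_deriv \<Omega> f"
abbreviation dual_norm where "dual_norm \<equiv> energy_dual_norm \<Omega> f dt"
abbreviation tri where "tri \<equiv> trinorm \<Omega> dt"
abbreviation Bil where "Bil \<equiv> B_form \<Omega> dt"

lemma Nemytskii_measurable:
  "u \<in> borel_measurable \<mu> \<Longrightarrow> (\<lambda>x. f x (u x)) \<in> borel_measurable \<mu>"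
  by (rule Caratheodory_measurable[OF f_measurable f_continuous]) auto

lemma L2_abs: "(u :: 'a \<Rightarrow> real) \<in> L2 \<Omega> \<Longrightarrow> (\<lambda>x. \<bar>u x\<bar>) \<in> L2 \<Omega>"
  using L2_norm_fun[of u \<Omega>] by simp

lemma Nemytskii_L2:
  assumes u: "u \<in> L2 \<Omega>"
  shows "(\<lambda>x. f x (u x)) \<in> L2 \<Omega>"
proof (rule L2_bounded_by)
  show "(\<lambda>x. \<bar>f x 0\<bar> + L * \<bar>u x\<bar>) \<in> L2 \<Omega>"
    by (intro L2_add L2_cmult L2_abs f_zero_L2 u)
  show "(\<lambda>x. f x (u x)) \<in> borel_measurable \<mu>"
    by (rule Nemytskii_measurable[OF L2_measurable[OF u]])
  show "AE x in \<mu>. norm (f x (u x)) \<le> norm (\<bar>f x 0\<bar> + L * \<bar>u x\<bar>)"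
    using f_Lipschitz
  proof eventually_elim
    case (elim x)
    have "\<bar>f x (u x) - f x 0\<bar> \<le> L * \<bar>u x - 0\<bar>" using elim by blast
    then have "\<bar>f x (u x)\<bar> \<le> \<bar>f x 0\<bar> + L * \<bar>u x\<bar>" by simp
    then show ?case by simp
  qed
qed

lemma Nemytskii_Lipschitz:
  assumes u: "u \<in> L2 \<Omega>" and v: "v \<in> L2 \<Omega>"
  shows "nrm (\<lambda>x. f x (u x) - f x (v x)) \<le> L * nrm (\<lambda>x. u x - v x)"
proof -
  have "nrm (\<lambda>x. f x (u x) - f x (v x)) \<le> nrm (\<lambda>x. L * (u x - v x))"
  proof (rule L2_norm_mono)
    show "AE x in \<mu>. norm (f x (u x) - f x (v x)) \<le> norm (L * (u x - v x))"
      using f_Lipschitz by eventually_elim (use L_nonneg in \<open>simp add: abs_mult\<close>)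
  qed (intro L2_cmult L2_diff u v L2_measurable Nemytskii_L2)+
  then show ?thesis using L_nonneg by (simp add: L2_norm_cmult)
qed

lemma energy_deriv_eq:
  assumes u: "u \<in> H1 \<Omega>" and v: "v \<in> H1 \<Omega>"
  shows "dE u v
    = (\<integral>x. \<nabla> u x \<bullet> \<nabla> v x \<partial>\<mu>) - (\<integral>x. f x (u x) * v x \<partial>\<mu>)"
  unfolding energy_deriv_def
  using L2_inner_integrable[OF wgrad_L2[OF u] wgrad_L2[OF v]]
    L2_mult_integrable[OF Nemytskii_L2[OF H1_L2[OF u]] H1_L2[OF v]]
  by simp

lemma L2_CS_real:
  "(u :: 'a \<Rightarrow> real) \<in> L2 \<Omega> \<Longrightarrow> v \<in> L2 \<Omega> \<Longrightarrow> \<bar>\<integral>x. u x * v x \<partial>\<mu>\<bar> \<le> nrm u * nrm v"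
  using L2_Cauchy_Schwarz[of u \<Omega> v] by simp

lemma energy_deriv_bound:
  assumes u: "u \<in> H1 \<Omega>" and v: "v \<in> H1 \<Omega>"
  shows "\<bar>dE u v\<bar>
    \<le> (nrm (\<nabla> u) + nrm (\<lambda>x. f x (u x))) * nrm1 v"
proof -
  have "\<bar>dE u v\<bar> \<le> nrm (\<nabla> u) * nrm (\<nabla> v)
      + nrm (\<lambda>x. f x (u x)) * nrm v"
    using L2_Cauchy_Schwarz[OF wgrad_L2[OF u] wgrad_L2[OF v]]
      L2_CS_real[OF Nemytskii_L2[OF H1_L2[OF u]] H1_L2[OF v]]
    unfolding energy_deriv_eq[OF u v] by linarith
  also have "\<dots> \<le> nrm (\<nabla> u) * nrm1 v + nrm (\<lambda>x. f x (u x)) * nrm1 v"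
    using L2_norm_le_trinorm[of 1 v]
    by (intro add_mono mult_left_mono L2_norm_wgrad_le_H1_norm) (auto simp: H1_norm_eq_trinorm)
  finally show ?thesis by (simp add: distrib_right)
qed

text \<open>Lipschitz continuity of the derivative of the energy in the H1 norm, used to carry
  near-criticality from the approximations to their limit.\<close>

lemma energy_deriv_diff_bound:
  assumes u: "u \<in> H1 \<Omega>" and v: "v \<in> H1 \<Omega>" and w: "w \<in> H1 \<Omega>"
  shows "\<bar>dE u w - dE v w\<bar> \<le> (1 + L) * nrm1 (\<lambda>x. u x - v x) * nrm1 w"
proof -
  let ?d = "nrm1 (\<lambda>x. u x - v x)"
  note g = wgrad_L2[OF u] wgrad_L2[OF v] wgrad_L2[OF w]
  note N = Nemytskii_L2[OF H1_L2[OF u]] Nemytskii_L2[OF H1_L2[OF v]]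
  have "dE u w - dE v w
      = (\<integral>x. (\<nabla> u x - \<nabla> v x) \<bullet> \<nabla> w x \<partial>\<mu>)
        - (\<integral>x. (f x (u x) - f x (v x)) * w x \<partial>\<mu>)"
    unfolding energy_deriv_eq[OF u w] energy_deriv_eq[OF v w]
    using L2_inner_integrable[OF g(1,3)] L2_inner_integrable[OF g(2,3)]
      L2_mult_integrable[OF N(1) H1_L2[OF w]] L2_mult_integrable[OF N(2) H1_L2[OF w]]
    by (simp add: inner_diff_left left_diff_distrib)
  also have "\<bar>\<dots>\<bar> \<le> nrm (\<lambda>x. \<nabla> u x - \<nabla> v x) * nrm (\<nabla> w)
      + nrm (\<lambda>x. f x (u x) - f x (v x)) * nrm w"
    using L2_Cauchy_Schwarz[OF L2_diff[OF g(1,2)] g(3)] L2_CS_real[OF L2_diff[OF N] H1_L2[OF w]]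
    by linarith
  also have "nrm (\<lambda>x. \<nabla> u x - \<nabla> v x) = nrm (\<nabla> (\<lambda>x. u x - v x))"
    using H1_lincomb(2)[OF u v, of 1 "-1"]
    by (intro L2_norm_cong_AE L2_measurable[OF L2_diff[OF g(1,2)]] L2_measurable[OF wgrad_L2[OF H1_diff[OF u v]]])
      (auto elim: eventually_mono)
  also have "nrm (\<nabla> (\<lambda>x. u x - v x)) * nrm (\<nabla> w)
      + nrm (\<lambda>x. f x (u x) - f x (v x)) * nrm w \<le> ?d * nrm1 w + (L * ?d) * nrm1 w"
  proof (intro add_mono mult_mono L2_norm_wgrad_le_H1_norm)
    show "nrm w \<le> nrm1 w" using L2_norm_le_trinorm[of 1 w] by (simp add: H1_norm_eq_trinorm)
    have "nrm (\<lambda>x. f x (u x) - f x (v x)) \<le> L * nrm (\<lambda>x. u x - v x)"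
      by (intro Nemytskii_Lipschitz H1_L2 u v)
    also have "\<dots> \<le> L * ?d"
      using L2_norm_le_trinorm[of 1 "\<lambda>x. u x - v x"]
      by (intro mult_left_mono L_nonneg) (simp add: H1_norm_eq_trinorm)
    finally show "nrm (\<lambda>x. f x (u x) - f x (v x)) \<le> L * ?d" .
  qed (auto simp: L_nonneg)
  finally show ?thesis by (simp add: distrib_right)
qed

text \<open>The terms in \<open>u * v\<close> cancel. Thus a step of the iteration is a descent step
  of length \<open>dt\<close> for the energy, in the inner product \<open>Bil\<close>.\<close>

lemma ell_form_minus_B_form:
  assumes u: "u \<in> H1 \<Omega>" and v: "v \<in> H1 \<Omega>"
  shows "ell_form \<Omega> f dt u v - Bil u v = - dt * dE u v"
proof -
  note i = L2_inner_integrable[OF wgrad_L2[OF u] wgrad_L2[OF v]] L2_mult_integrable[OF H1_L2[OF u] H1_L2[OF v]]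
    L2_mult_integrable[OF Nemytskii_L2[OF H1_L2[OF u]] H1_L2[OF v]]
  have "ell_form \<Omega> f dt u v = (\<integral>x. u x * v x + dt * (f x (u x) * v x) \<partial>\<mu>)"
    unfolding ell_form_def by (simp add: algebra_simps)
  also have "\<dots> = (\<integral>x. u x * v x \<partial>\<mu>) + dt * (\<integral>x. f x (u x) * v x \<partial>\<mu>)"
    using i by simp
  finally show ?thesis
    unfolding B_form_def energy_deriv_eq[OF u v] using i by (simp add: algebra_simps)
qed

definition potential :: "'a \<Rightarrow> real \<Rightarrow> real" where
  "potential x t = (LBINT s=0..ereal t. f x s)"

text \<open>For a fixed upper limit, measurability in \<open>x\<close> comes from integrating out
  the second variable; the primitive is continuous in its upper limit, so the Caratheodory argument
  covers a variable one.\<close>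

lemma potential_measurable:
  assumes u: "u \<in> borel_measurable \<mu>"
  shows "(\<lambda>x. potential x (u x)) \<in> borel_measurable \<mu>"
proof (rule Caratheodory_measurable[OF _ _ u])
  let ?M = "\<mu>"
  have joint: "(\<lambda>(x, s). f x s) \<in> borel_measurable (?M \<Otimes>\<^sub>M lborel)"
    using Caratheodory_joint_measurable[OF f_measurable f_continuous]
    by (simp cong: measurable_cong_sets sets_pair_measure_cong)
  fix t
  have "(\<lambda>x. set_lebesgue_integral lborel (einterval a b) (f x)) \<in> borel_measurable ?M" for a b
    unfolding set_lebesgue_integral_def
  proof (rule lborel.borel_measurable_lebesgue_integral)
    have "(\<lambda>p. indicator (einterval a b) (snd p) *\<^sub>R (case p of (x, s) \<Rightarrow> f x s)) \<in> borel_measurable (?M \<Otimes>\<^sub>M lborel)"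
      using joint by (intro borel_measurable_scaleR measurable_compose[OF measurable_snd] borel_measurable_indicator) auto
    then show "(\<lambda>(x, s). indicator (einterval a b) s *\<^sub>R f x s) \<in> borel_measurable (?M \<Otimes>\<^sub>M lborel)"
      by (simp add: case_prod_unfold)
  qed
  then show "(\<lambda>x. potential x t) \<in> borel_measurable ?M"
    unfolding potential_def interval_lebesgue_integral_def by simp
next
  fix x assume "x \<in> space \<mu>"
  then show "continuous_on UNIV (potential x)"
    unfolding potential_def[abs_def]
    by (intro continuous_at_imp_continuous_on ballI DERIV_isCont[OF LBINT_antiderivative] f_continuous) auto
qed

lemma potential_growth:
  "AE x in \<mu>. \<bar>potential x (u x)\<bar> \<le> (\<bar>f x 0\<bar> + L * \<bar>u x\<bar>) * \<bar>u x\<bar>"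
  using f_Lipschitz AE_space
  by eventually_elim
    (auto simp: potential_def L_nonneg f_continuous simp del: zero_ereal_def intro!: LBINT_linear_growth)

lemma growth_L2: "u \<in> L2 \<Omega> \<Longrightarrow> (\<lambda>x. \<bar>f x 0\<bar> + L * \<bar>u x\<bar>) \<in> L2 \<Omega>"
  by (intro L2_add L2_cmult L2_abs f_zero_L2)

lemma potential_integrable:
  assumes u: "u \<in> L2 \<Omega>"
  shows "integrable \<mu> (\<lambda>x. potential x (u x))"
proof (rule Bochner_Integration.integrable_bound[OF L2_mult_integrable[OF growth_L2[OF u] L2_abs[OF u]]])
  show "(\<lambda>x. potential x (u x)) \<in> borel_measurable \<mu>"
    by (rule potential_measurable[OF L2_measurable[OF u]])
  show "AE x in \<mu>. norm (potential x (u x)) \<le> norm ((\<bar>f x 0\<bar> + L * \<bar>u x\<bar>) * \<bar>u x\<bar>)"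
    using potential_growth[of u] by eventually_elim (simp add: L_nonneg)
qed

lemma energy_eq:
  "E u = 1 / 2 * (nrm (\<nabla> u))\<^sup>2 - (\<integral>x. potential x (u x) \<partial>\<mu>)"
  by (simp add: energy_def L2_norm_power2 potential_def)

text \<open>The potential grows at most quadratically, so an L2 bound alone controls the energy from
  below. This bounds the energies of the final approximations across different Galerkin
  spaces.\<close>

lemma energy_lower_bound:
  assumes u: "u \<in> L2 \<Omega>" and M: "nrm u \<le> M"
  shows "- ((nrm (\<lambda>x. f x 0) + L * M) * M) \<le> E u"
proof -
  have "(\<integral>x. potential x (u x) \<partial>\<mu>) \<le> (\<integral>x. (\<bar>f x 0\<bar> + L * \<bar>u x\<bar>) * \<bar>u x\<bar> \<partial>\<mu>)"
    by (intro integral_mono_AE potential_integrable u L2_mult_integrable growth_L2 L2_abs)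
      (use potential_growth[of u] in \<open>auto elim: eventually_mono\<close>)
  also have "\<dots> \<le> nrm (\<lambda>x. \<bar>f x 0\<bar> + L * \<bar>u x\<bar>) * nrm (\<lambda>x. \<bar>u x\<bar>)"
    using L2_CS_real[OF growth_L2[OF u] L2_abs[OF u]] by linarith
  also have "\<dots> \<le> (nrm (\<lambda>x. f x 0) + L * M) * M"
  proof (intro mult_mono)
    have "nrm (\<lambda>x. \<bar>f x 0\<bar> + L * \<bar>u x\<bar>) \<le> nrm (\<lambda>x. \<bar>f x 0\<bar>) + nrm (\<lambda>x. L * \<bar>u x\<bar>)"
      by (intro L2_norm_triangle L2_cmult L2_abs f_zero_L2 u)
    also have "\<dots> = nrm (\<lambda>x. f x 0) + L * nrm u"
      using L_nonneg unfolding L2_norm_cmult by (simp add: L2_norm_def)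
    also have "\<dots> \<le> nrm (\<lambda>x. f x 0) + L * M"
      using M L_nonneg by (intro add_left_mono mult_left_mono)
    finally show "nrm (\<lambda>x. \<bar>f x 0\<bar> + L * \<bar>u x\<bar>) \<le> nrm (\<lambda>x. f x 0) + L * M" .
    show "nrm (\<lambda>x. \<bar>u x\<bar>) \<le> M" using M by (simp add: L2_norm_def)
    have "0 \<le> M" using M L2_norm_nonneg[of \<Omega> u] by linarith
    then show "0 \<le> nrm (\<lambda>x. f x 0) + L * M" using L_nonneg by simp
  qed simp
  finally show ?thesis unfolding energy_eq using zero_le_power2[of "nrm (\<nabla> u)"] by linarith
qed

text \<open>Let \<open>G\<close> and \<open>W\<close> be the squared norms of the gradient of
  \<open>w\<close> and of \<open>w\<close>. The hypothesis says
  \<open>- dE u w = G + W / dt\<close>; the quadratic gradient part of the energy costs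
  \<open>G / 2\<close>, and semiconvexity of the potential costs at most \<open>K / 2 * W\<close>.
  The drop is therefore at least \<open>G / 2 + \<beta> * W\<close>, which the Poincare inequality
  makes coercive even for negative \<beta>.\<close>

lemma energy_decay:
  "\<exists>c>0. \<forall>u\<in>H10 \<Omega>. \<forall>w\<in>H10 \<Omega>. Bil w w = - dt * dE u w \<longrightarrow>
    c * (tri w)\<^sup>2 \<le> E u - E (\<lambda>x. u x + w x)"
proof -
  define \<beta> where "\<beta> = 1 / dt - K / 2"
  \<comment> \<open>The coefficient of \<open>W\<close> if all of \<open>G / 2\<close> were spent
    through the Poincare inequality.\<close>
  define \<gamma> where "\<gamma> = \<beta> + 1 / (2 * C\<^sub>P)"
  have CP: "C\<^sub>P > 0" using Poincare by (simp add: poincare_constant_def)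
  have \<gamma>: "\<gamma> > 0" using dt_small by (simp add: \<gamma>_def \<beta>_def)
  \<comment> \<open>The fraction of \<open>G / 2\<close> that is kept. The rest is converted into
    \<open>W\<close>; \<open>\<theta> \<le> \<gamma> * C\<^sub>P\<close> leaves at least half of
    \<gamma> as the coefficient of \<open>W\<close>.\<close>
  define \<theta> where "\<theta> = min 1 (\<gamma> * C\<^sub>P)"
  have \<theta>: "0 < \<theta>" "\<theta> \<le> 1" "\<theta> \<le> \<gamma> * C\<^sub>P" using \<gamma> CP by (auto simp: \<theta>_def)
  \<comment> \<open>Matches the two surviving coefficients with the weights \<open>dt\<close> and 1
    of \<open>tri\<close>.\<close>
  define c where "c = min (\<theta> / (2 * dt)) (\<gamma> / 2)"
  have c: "c > 0" "c * dt \<le> \<theta> / 2" "c \<le> \<gamma> / 2"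
  proof -
    show "c > 0" "c \<le> \<gamma> / 2" using \<theta> \<gamma> dt_pos by (auto simp: c_def)
    have "c * dt \<le> \<theta> / (2 * dt) * dt" using dt_pos by (intro mult_right_mono) (auto simp: c_def)
    then show "c * dt \<le> \<theta> / 2" using dt_pos by simp
  qed
  have "c * (tri w)\<^sup>2 \<le> E u - E (\<lambda>x. u x + w x)"
    if u: "u \<in> H10 \<Omega>" and w: "w \<in> H10 \<Omega>" and B: "Bil w w = - dt * dE u w" for u w
  proof -
    note uH = H10_H1[OF u] and wH = H10_H1[OF w]
    note gu = wgrad_L2[OF uH] and gw = wgrad_L2[OF wH]
    define G W where "G = (nrm (\<nabla> w))\<^sup>2" and "W = (nrm w)\<^sup>2"
    have W: "0 \<le> G" "0 \<le> W" "W \<le> C\<^sub>P * G"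
      using Poincare w by (auto simp: G_def W_def poincare_constant_def)
    have sumH: "(\<lambda>x. u x + w x) \<in> H1 \<Omega>" using H1_lincomb(1)[OF uH wH, of 1 1] by simp
    have "(nrm (\<nabla> (\<lambda>x. u x + w x)))\<^sup>2 = (nrm (\<lambda>x. \<nabla> u x + \<nabla> w x))\<^sup>2"
      using H1_lincomb(2)[OF uH wH, of 1 1]
      by (intro arg_cong[of _ _ "\<lambda>r. r\<^sup>2"] L2_norm_cong_AE L2_measurable[OF L2_add[OF gu gw]]
          L2_measurable[OF wgrad_L2[OF sumH]]) auto
    also have "\<dots> = (nrm (\<nabla> u))\<^sup>2 + 2 * (\<integral>x. \<nabla> u x \<bullet> \<nabla> w x \<partial>\<mu>) + G"
      unfolding G_def by (rule L2_norm_add_power2[OF gu gw])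
    finally have grad: "(nrm (\<nabla> (\<lambda>x. u x + w x)))\<^sup>2 = \<dots>" .
    have iN: "integrable \<mu> (\<lambda>x. f x (u x) * w x)"
      by (intro L2_mult_integrable Nemytskii_L2 H10_L2 u w)
    have iW: "integrable \<mu> (\<lambda>x. (w x)\<^sup>2)"
      using L2_square_integrable[OF H10_L2[OF w]] by simp
    have iP: "integrable \<mu> (\<lambda>x. potential x (u x))"
      "integrable \<mu> (\<lambda>x. potential x (u x + w x))"
      by (intro potential_integrable H10_L2 u H1_L2[OF sumH])+
    have "(\<integral>x. f x (u x) * w x - K / 2 * (w x)\<^sup>2 \<partial>\<mu>)
        \<le> (\<integral>x. potential x (u x + w x) - potential x (u x) \<partial>\<mu>)"
    proof (rule integral_mono_AE)
      show "AE x in \<mu>. f x (u x) * w x - K / 2 * (w x)\<^sup>2 \<le> potential x (u x + w x) - potential x (u x)"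
        using f_semimonotone AE_space
      proof eventually_elim
        case (elim x)
        then have "continuous_on UNIV (f x)" by (intro f_continuous) simp
        from LBINT_semiconvex[OF this, of K "u x" "u x + w x"] elim show ?case
          by (simp add: potential_def)
      qed
    qed (intro Bochner_Integration.integrable_diff integrable_mult_right iN iW iP)+
    moreover have "(\<integral>x. (w x)\<^sup>2 \<partial>\<mu>) = W" by (simp add: W_def L2_norm_power2)
    ultimately have pot: "(\<integral>x. f x (u x) * w x \<partial>\<mu>) - K / 2 * W
        \<le> (\<integral>x. potential x (u x + w x) \<partial>\<mu>) - (\<integral>x. potential x (u x) \<partial>\<mu>)"
      using iN iW iP by simp
    have "- dE u w = (1 / dt) * Bil w w" using B dt_pos by simp
    also have "\<dots> = (1 / dt) * (dt * G + W)"
      unfolding B_form_self[OF wH less_imp_le[OF dt_pos]] trinorm_power2[OF less_imp_le[OF dt_pos]] G_def W_def ..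
    also have "\<dots> = G + W / dt" using dt_pos by (simp add: field_simps)
    finally have res: "- dE u w = G + W / dt" .
    have \<beta>W: "\<beta> * W = W / dt - K / 2 * W" by (simp add: \<beta>_def left_diff_distrib)
    have arith: "- (a - b) = G + t \<Longrightarrow> \<beta> * W = t - k \<Longrightarrow> b - k \<le> P' - P \<Longrightarrow>
      G / 2 + \<beta> * W \<le> 1 / 2 * A - P - (1 / 2 * (A + 2 * a + G) - P')" for a b t k P P' A :: real
      by (simp add: field_simps)
    have dec: "G / 2 + \<beta> * W \<le> E u - E (\<lambda>x. u x + w x)"
      unfolding energy_eq grad by (rule arith[OF res[unfolded energy_deriv_eq[OF uH wH]] \<beta>W pot])
    have "c * (tri w)\<^sup>2 = (c * dt) * G + c * W"
      unfolding trinorm_power2[OF less_imp_le[OF dt_pos]] G_def W_def by (simp add: algebra_simps)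
    also have "\<dots> \<le> \<theta> / 2 * G + (\<gamma> - \<theta> / (2 * C\<^sub>P)) * W"
    proof (intro add_mono mult_right_mono W c)
      have "\<theta> / (2 * C\<^sub>P) \<le> \<gamma> * C\<^sub>P / (2 * C\<^sub>P)" using \<theta> CP by (intro divide_right_mono) auto
      also have "\<dots> = \<gamma> / 2" using CP by simp
      finally show "c \<le> \<gamma> - \<theta> / (2 * C\<^sub>P)" using c(3) by linarith
    qed
    also have "(\<gamma> - \<theta> / (2 * C\<^sub>P)) * W = \<beta> * W + (1 - \<theta>) / (2 * C\<^sub>P) * W"
      unfolding \<gamma>_def by (simp add: algebra_simps diff_divide_distrib)
    also have "(1 - \<theta>) / (2 * C\<^sub>P) * W \<le> (1 - \<theta>) / (2 * C\<^sub>P) * (C\<^sub>P * G)"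
      using \<theta> CP W by (intro mult_left_mono) auto
    also have "(1 - \<theta>) / (2 * C\<^sub>P) * (C\<^sub>P * G) = (1 - \<theta>) / 2 * G" using CP by simp
    finally have "c * (tri w)\<^sup>2 \<le> G / 2 + \<beta> * W" by (simp add: algebra_simps diff_divide_distrib)
    with dec show ?thesis by linarith
  qed
  with c(1) show ?thesis by blast
qed

end

section \<open>Convergence of the adaptive algorithm\<close>

context semilinear_problem
begin

definition linear_subspace :: "('a \<Rightarrow> real) set \<Rightarrow> bool" where
  "linear_subspace W \<longleftrightarrow> W \<subseteq> H10 \<Omega> \<and> (\<forall>u\<in>W. \<forall>v\<in>W. \<forall>a b. (\<lambda>x. a * u x + b * v x) \<in> W)"

lemma linear_subspaceD:
  assumes "linear_subspace W"
  shows "u \<in> W \<Longrightarrow> u \<in> H10 \<Omega>" "u \<in> W \<Longrightarrow> u \<in> H1 \<Omega>"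
    "u \<in> W \<Longrightarrow> v \<in> W \<Longrightarrow> (\<lambda>x. a * u x + b * v x) \<in> W"
    "u \<in> W \<Longrightarrow> v \<in> W \<Longrightarrow> (\<lambda>x. u x - v x) \<in> W"
proof -
  show "u \<in> W \<Longrightarrow> u \<in> H10 \<Omega>" "u \<in> W \<Longrightarrow> u \<in> H1 \<Omega>"
    using assms H10_H1 by (auto simp: linear_subspace_def)
  have lin: "(\<lambda>x. a * u x + b * v x) \<in> W" if "u \<in> W" "v \<in> W" for a b u v
    using assms that by (auto simp: linear_subspace_def)
  show "u \<in> W \<Longrightarrow> v \<in> W \<Longrightarrow> (\<lambda>x. a * u x + b * v x) \<in> W" by (rule lin)
  show "u \<in> W \<Longrightarrow> v \<in> W \<Longrightarrow> (\<lambda>x. u x - v x) \<in> W" using lin[of u v 1 "-1"] by simp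
qed

lemma fin_dim_subspace_linear:
  assumes "fin_dim_subspace \<Omega> W"
  shows "linear_subspace W"
proof -
  obtain B where B: "finite B" "B \<subseteq> H10 \<Omega>"
    and W: "W = {u \<in> H10 \<Omega>. \<exists>c. AE x in \<mu>. u x = (\<Sum>b\<in>B. c b * b x)}"
    using assms by (auto simp: fin_dim_subspace_def)
  have "(\<lambda>x. r * u x + s * v x) \<in> W" if u: "u \<in> W" and v: "v \<in> W" for u v r s
  proof -
    obtain c d where c: "AE x in \<mu>. u x = (\<Sum>b\<in>B. c b * b x)"
      and d: "AE x in \<mu>. v x = (\<Sum>b\<in>B. d b * b x)"
      using u v by (auto simp: W)
    have "AE x in \<mu>. r * u x + s * v x = (\<Sum>b\<in>B. (r * c b + s * d b) * b x)"
      using c d by eventually_elim (simp add: sum_distrib_left sum.distrib[symmetric] algebra_simps)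
    then have "\<exists>e. AE x in \<mu>. r * u x + s * v x = (\<Sum>b\<in>B. e b * b x)"
      by (rule exI[of _ "\<lambda>b. r * c b + s * d b"])
    moreover have "(\<lambda>x. r * u x + s * v x) \<in> H10 \<Omega>" using u v by (intro H10_lincomb) (auto simp: W)
    ultimately show ?thesis by (simp add: W)
  qed
  then show ?thesis unfolding linear_subspace_def by (auto simp: W)
qed

lemma iteration_increment:
  assumes W: "linear_subspace W" and u: "u \<in> W" and u': "u' \<in> W" and v: "v \<in> W"
    and step: "\<forall>v\<in>W. Bil u' v = ell_form \<Omega> f dt u v"
  shows "Bil (\<lambda>x. u' x - u x) v = - dt * dE u v"
proof -
  note H = linear_subspaceD(2)[OF W]
  have "Bil (\<lambda>x. u' x - u x) v = Bil u' v - Bil u v"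
    using B_form_lincomb[OF H[OF u'] H[OF u] H[OF v], of dt 1 "-1"] dt_pos by simp
  also have "\<dots> = - dt * dE u v"
    using ell_form_minus_B_form[OF H[OF u] H[OF v]] step v by simp
  finally show ?thesis .
qed

text \<open>The scaled increment \<open>- (u' - u) / dt\<close> represents the derivative of the
  energy on \<open>W\<close>, so the choice in \<open>residual\<close> has a witness. The chosen
  residual may differ from it as a function, but both have the same products with all of
  \<open>W\<close>.\<close>

lemma residual_of_iterate:
  assumes W: "linear_subspace W" and u: "u \<in> W" and u': "u' \<in> W"
    and step: "\<forall>v\<in>W. Bil u' v = ell_form \<Omega> f dt u v"
  shows "residual \<Omega> f dt W u \<in> W"
    and "\<And>v. v \<in> W \<Longrightarrow> Bil (residual \<Omega> f dt W u) v = dE u v"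
    and "tri (\<lambda>x. u' x - u x) = dt * tri (residual \<Omega> f dt W u)"
proof -
  note H = linear_subspaceD(2)[OF W]
  let ?w = "\<lambda>x. u' x - u x" and ?R = "residual \<Omega> f dt W u"
  have dt0: "dt \<ge> 0" using dt_pos by simp
  have w: "?w \<in> W" by (rule linear_subspaceD(4)[OF W u' u])
  have R0: "(\<lambda>x. (- 1 / dt) * ?w x + 0 * ?w x) \<in> W" by (rule linear_subspaceD(3)[OF W w w])
  have R0B: "Bil (\<lambda>x. (- 1 / dt) * ?w x + 0 * ?w x) v = dE u v" if "v \<in> W" for v
    using B_form_lincomb[OF H[OF w] H[OF w] H[OF that] dt0, of "- 1 / dt" 0]
      iteration_increment[OF W u u' that step] dt_pos by simp
  have "?R \<in> W \<and> (\<forall>v\<in>W. Bil ?R v = dE u v)"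
    unfolding residual_def
    by (rule someI[of "\<lambda>R. R \<in> W \<and> (\<forall>v\<in>W. Bil R v = dE u v)"]) (use R0 R0B in blast)
  then show R: "?R \<in> W" and RB: "\<And>v. v \<in> W \<Longrightarrow> Bil ?R v = dE u v" by auto
  have wR: "Bil ?w v = - dt * Bil ?R v" if "v \<in> W" for v
    using iteration_increment[OF W u u' that step] RB[OF that] by simp
  \<comment> \<open>Equality of norms is obtained by testing with \<open>?w\<close> and then with
    \<open>?R\<close>, which avoids identifying the two functions.\<close>
  have "(tri ?w)\<^sup>2 = - dt * Bil ?w ?R"
    using wR[OF w] B_form_self[OF H[OF w] dt0] B_form_commute[of dt ?R ?w] by simp
  also have "\<dots> = dt\<^sup>2 * (tri ?R)\<^sup>2"
    using wR[OF R] B_form_self[OF H[OF R] dt0] by (simp add: power2_eq_square)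
  finally have "(tri ?w)\<^sup>2 = (dt * tri ?R)\<^sup>2" by (simp add: power_mult_distrib)
  then show "tri ?w = dt * tri ?R"
    by (rule power2_eq_imp_eq) (use dt0 in auto)
qed

lemma energy_deriv_residual_bound:
  assumes W: "linear_subspace W" and u: "u \<in> W" and u': "u' \<in> W" and v: "v \<in> W"
    and step: "\<forall>v\<in>W. Bil u' v = ell_form \<Omega> f dt u v"
  shows "\<bar>dE u v\<bar> \<le> tri (residual \<Omega> f dt W u) * tri v"
  using B_form_bound[OF linear_subspaceD(2)[OF W residual_of_iterate(1)[OF W u u' step]] linear_subspaceD(2)[OF W v], of dt]
    residual_of_iterate(2)[OF W u u' step v] dt_pos by simp

text \<open>The summable energy drops force the residuals to zero, while the right side of the
  criterion does not decrease with \<open>n\<close>. Once the first step lowers the energy, the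
  criterion must be met; if it does not, the iteration is already stationary and the index 1 works
  with both sides zero.\<close>

lemma stopping_criterion_reached:
  assumes W: "linear_subspace W" and y: "\<And>n. y n \<in> W"
    and step: "\<And>n. \<forall>v\<in>W. Bil (y (Suc n)) v = ell_form \<Omega> f dt (y n) v"
    and \<alpha>: "\<alpha> > 0" and bdd: "bdd_below (range (\<lambda>n. E (y n)))"
  shows "\<exists>n\<ge>1. tri (residual \<Omega> f dt W (y n)) \<le> \<alpha> * (E (y 0) - E (y n))"
proof (rule ccontr)
  assume neg: "\<not> ?thesis"
  define r where "r n = tri (residual \<Omega> f dt W (y n))" for n
  define e where "e n = E (y n)" for n
  have never: "\<alpha> * (e 0 - e n) < r n" if "n \<ge> 1" for n
  proof -
    have "\<not> r n \<le> \<alpha> * (e 0 - e n)" using neg that unfolding r_def e_def by blast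
    then show ?thesis by simp
  qed
  have dt0: "dt \<ge> 0" using dt_pos by simp
  note H = linear_subspaceD(2)[OF W y]
  let ?w = "\<lambda>n x. y (Suc n) x - y n x"
  have w: "?w n \<in> W" for n by (rule linear_subspaceD(4)[OF W y y])
  have wr: "tri (?w n) = dt * r n" for n
    unfolding r_def by (rule residual_of_iterate(3)[OF W y y step])
  have r0: "r n \<ge> 0" for n unfolding r_def using dt0 by simp
  obtain c where c: "c > 0" and decay: "\<forall>u\<in>H10 \<Omega>. \<forall>w\<in>H10 \<Omega>.
      Bil w w = - dt * dE u w \<longrightarrow>
      c * (tri w)\<^sup>2 \<le> E u - E (\<lambda>x. u x + w x)"
    using energy_decay by auto
  define a where "a = c * dt\<^sup>2"
  have a: "a > 0" using c dt_pos by (simp add: a_def)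
  have dec: "a * (r n)\<^sup>2 \<le> e n - e (Suc n)" for n
    using decay[rule_format, OF linear_subspaceD(1)[OF W y[of n]] linear_subspaceD(1)[OF W w[of n]]
        iteration_increment[OF W y y w step]]
    by (simp add: wr a_def e_def power_mult_distrib mult.assoc)
  have mono: "e (Suc n) \<le> e n" for n
  proof -
    have "0 \<le> a * (r n)\<^sup>2" using a by simp
    then show ?thesis using dec[of n] by linarith
  qed
  then have decs: "decseq e" by (rule decseq_SucI)
  have "e n \<ge> Inf (range e)" for n using bdd unfolding e_def by (intro cInf_lower) auto
  then obtain l where l: "e \<longlonglongrightarrow> l" using decseq_convergent[OF decs, of "Inf (range e)"] by blast
  have rlim: "r \<longlonglongrightarrow> 0"
  proof -
    have "(\<lambda>n. (e n - e (Suc n)) / a) \<longlonglongrightarrow> 0"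
      using tendsto_divide[OF tendsto_diff[OF l LIMSEQ_Suc[OF l]] tendsto_const, of a] a by simp
    then have "(\<lambda>n. (r n)\<^sup>2) \<longlonglongrightarrow> 0"
      by (rule tendsto_sandwich[OF _ _ tendsto_const, rotated -1])
        (use dec a in \<open>auto simp: pos_le_divide_eq mult.commute\<close>)
    then have "(\<lambda>n. sqrt ((r n)\<^sup>2)) \<longlonglongrightarrow> sqrt 0" by (rule tendsto_real_sqrt)
    then show ?thesis using r0 by simp
  qed
  show False
  proof (cases "e 1 < e 0")
    case True
    \<comment> \<open>A fixed positive threshold, below every later value of the right side of the
      criterion.\<close>
    then have "\<alpha> * (e 0 - e 1) > 0" using \<alpha> by simp
    from order_tendstoD(2)[OF rlim this] obtain n0 where "\<And>n. n \<ge> n0 \<Longrightarrow> r n < \<alpha> * (e 0 - e 1)"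
      by (auto simp: eventually_sequentially)
    then obtain n where n: "n \<ge> 1" "r n < \<alpha> * (e 0 - e 1)" using max.cobounded1 max.cobounded2 by metis
    have "e n \<le> e 1" using decs n(1) by (auto simp: decseq_def)
    then have "\<alpha> * (e 0 - e 1) \<le> \<alpha> * (e 0 - e n)" using \<alpha> by simp
    then show False using never[OF n(1)] n(2) by simp
  next
    case False
    then have e01: "e 1 = e 0" using mono[of 0] by simp
    then have "a * (r 0)\<^sup>2 \<le> 0" using dec[of 0] by simp
    then have r00: "r 0 = 0" using a by (simp add: mult_le_0_iff)
    then have "tri (?w 0) = 0" by (simp add: wr)
    \<comment> \<open>The two iterates agree only up to null sets, so the vanishing residual is
      transferred from \<open>y 0\<close> to \<open>y 1\<close> through
      \<open>energy_deriv_diff_bound\<close>.\<close>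
    then have "nrm1 (?w 0) \<le> 0" using H1_norm_le_trinorm[OF dt_pos, of "?w 0"] by simp
    then have H0: "nrm1 (\<lambda>x. y 1 x - y 0 x) = 0"
      using H1_norm_nonneg[of "?w 0"] by simp
    let ?R = "residual \<Omega> f dt W (y 1)"
    have R: "?R \<in> W" by (rule residual_of_iterate(1)[OF W y y step])
    have "\<bar>dE (y 0) ?R\<bar> \<le> r 0 * tri ?R"
      unfolding r_def by (rule energy_deriv_residual_bound[OF W y y R step])
    moreover have "\<bar>dE (y 1) ?R - dE (y 0) ?R\<bar> \<le> 0"
      using energy_deriv_diff_bound[OF H[of 1] H[of 0] linear_subspaceD(2)[OF W R]] H0 by simp
    ultimately have "dE (y 1) ?R = 0" using r00 by simp
    then have "(r 1)\<^sup>2 = 0"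
      using residual_of_iterate(2)[OF W y y step R] B_form_self[OF linear_subspaceD(2)[OF W R] dt0]
      by (simp add: r_def)
    then show False using never[of 1] e01 by simp
  qed
qed

section \<open>Strong convergence of almost critical sequences\<close>

text \<open>Expand the squared norm of the gradient of \<open>v = u - d\<close>, and replace the
  mixed term by \<open>dE u d\<close>. Every term on the right is then controlled by convergence of
  gradient norms, smallness of the residual, or L2 convergence.\<close>

lemma gradient_difference_identity:
  assumes u: "u \<in> H1 \<Omega>" and v: "v \<in> H1 \<Omega>"
  defines "d \<equiv> \<lambda>x. u x - v x"
  shows "(nrm (\<nabla> d))\<^sup>2 = (nrm (\<nabla> v))\<^sup>2 - (nrm (\<nabla> u))\<^sup>2
    + 2 * (dE u d + (\<integral>x. f x (u x) * d x \<partial>\<mu>))"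
proof -
  have d: "d \<in> H1 \<Omega>" unfolding d_def by (rule H1_diff[OF u v])
  note g = wgrad_L2[OF u] wgrad_L2[OF v] wgrad_L2[OF d]
  have "AE x in \<mu>. \<nabla> v x = \<nabla> u x - \<nabla> d x"
    using H1_lincomb(2)[OF u v, of 1 "-1"] by eventually_elim (simp add: d_def)
  then have "nrm (\<nabla> v) = nrm (\<lambda>x. \<nabla> u x - \<nabla> d x)"
    by (intro L2_norm_cong_AE L2_measurable[OF g(2)] L2_measurable[OF L2_diff[OF g(1,3)]])
  then have "(nrm (\<nabla> v))\<^sup>2 = (nrm (\<nabla> u))\<^sup>2
      - 2 * (\<integral>x. \<nabla> u x \<bullet> \<nabla> d x \<partial>\<mu>) + (nrm (\<nabla> d))\<^sup>2"
    using L2_norm_diff_power2[OF g(1,3)] by simp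
  then show ?thesis unfolding energy_deriv_eq[OF u d] by simp
qed

text \<open>No weak compactness in \<open>H\<^sup>1\<close> is needed: testing the small residual of a later
  iterate with the difference to an earlier one controls the gradient of that difference.\<close>

lemma almost_critical_sequence_H1_Cauchy:
  fixes X :: "nat \<Rightarrow> 'a \<Rightarrow> real" and \<epsilon> :: "nat \<Rightarrow> real"
  assumes X: "\<And>k. X k \<in> H10 \<Omega>" and M: "\<And>k. nrm1 (X k) \<le> M"
    and L2C: "\<And>e. e > 0 \<Longrightarrow> \<exists>K. \<forall>k\<ge>K. \<forall>l\<ge>K. nrm (\<lambda>x. X k x - X l x) < e"
    and grad: "convergent (\<lambda>k. (nrm (\<nabla> (X k)))\<^sup>2)"
    and \<epsilon>: "\<epsilon> \<longlonglongrightarrow> 0"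
    and crit: "\<And>k l. k \<le> l \<Longrightarrow> \<bar>dE (X l) (\<lambda>x. X l x - X k x)\<bar> \<le> \<epsilon> l"
    and e: "e > 0"
  shows "\<exists>K. \<forall>k\<ge>K. \<forall>l\<ge>K. nrm1 (\<lambda>x. X k x - X l x) < e"
proof -
  note XH = H10_H1[OF X] and X2 = H10_L2[OF X]
  let ?D = "\<lambda>k l. \<lambda>x. X k x - X l x"
  define G where "G k = (nrm (\<nabla> (X k)))\<^sup>2" for k
  define F where "F = nrm (\<lambda>x. f x 0) + L * M"
  have L2M: "nrm (X k) \<le> M" for k
    using M[of k] L2_norm_le_trinorm[of 1 "X k"] by (simp add: H1_norm_eq_trinorm)
  have M0: "M \<ge> 0" using M[of 0] H1_norm_nonneg[of "X 0"] by linarith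
  have F0: "F \<ge> 0" using M0 L_nonneg by (simp add: F_def)
  have F: "nrm (\<lambda>x. f x (X k x)) \<le> F" for k
  proof -
    have "nrm (\<lambda>x. f x (X k x) - 0) \<le> nrm (\<lambda>x. f x (X k x) - f x 0) + nrm (\<lambda>x. f x 0 - 0)"
      by (rule L2_norm_triangle_diff[OF Nemytskii_L2[OF X2] f_zero_L2 L2_zero])
    moreover have "nrm (\<lambda>x. f x (X k x) - f x 0) \<le> L * nrm (\<lambda>x. X k x - 0)"
      by (rule Nemytskii_Lipschitz[OF X2 L2_zero])
    moreover have "L * nrm (X k) \<le> L * M" by (intro mult_left_mono L2M L_nonneg)
    ultimately show ?thesis by (simp add: F_def)
  qed
  \<comment> \<open>Six contributions below or at \<eta> are collected in the end, and 6/8 is at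
    most 1.\<close>
  define \<eta> where "\<eta> = e\<^sup>2 / 8"
  have \<eta>: "\<eta> > 0" using e by (simp add: \<eta>_def)
  obtain K1 where K1: "\<And>k. k \<ge> K1 \<Longrightarrow> \<epsilon> k < \<eta>"
    using order_tendstoD(2)[OF \<epsilon> \<eta>] by (auto simp: eventually_sequentially)
  obtain K2 where K2: "\<And>k l. k \<ge> K2 \<Longrightarrow> l \<ge> K2 \<Longrightarrow> \<bar>G k - G l\<bar> < \<eta>"
    using CauchyD[OF convergent_Cauchy[OF grad] \<eta>] unfolding G_def[symmetric] by auto
  \<comment> \<open>The first entry bounds the squared L2 norm of a difference by \<eta>, the second
    its pairing with the nonlinearity, whose norm is at most \<open>F\<close>.\<close>
  define \<delta> where "\<delta> = min (sqrt \<eta>) (\<eta> / (F + 1))"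
  have \<delta>: "\<delta> > 0" using \<eta> F0 by (simp add: \<delta>_def)
  obtain K3 where K3: "\<And>k l. k \<ge> K3 \<Longrightarrow> l \<ge> K3 \<Longrightarrow> nrm (?D k l) < \<delta>"
    using L2C[OF \<delta>] by auto
  define K where "K = max K1 (max K2 K3)"
  have key: "nrm1 (?D l k) < e" if "K \<le> k" "k \<le> l" for k l
  proof -
    have kl: "k \<ge> K2" "l \<ge> K2" "k \<ge> K3" "l \<ge> K3" "l \<ge> K1" using that by (auto simp: K_def)
    have D: "nrm (?D l k) < \<delta>" by (rule K3[OF kl(4,3)])
    have "(nrm (?D l k))\<^sup>2 \<le> (sqrt \<eta>)\<^sup>2" using D by (intro power_mono) (auto simp: \<delta>_def)
    then have 1: "(nrm (?D l k))\<^sup>2 \<le> \<eta>" using \<eta> by simp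
    have "\<bar>\<integral>x. f x (X l x) * ?D l k x \<partial>\<mu>\<bar> \<le> nrm (\<lambda>x. f x (X l x)) * nrm (?D l k)"
      by (rule L2_CS_real[OF Nemytskii_L2[OF X2] L2_diff[OF X2 X2]])
    also have "\<dots> \<le> F * (\<eta> / (F + 1))"
      using D F0 by (intro mult_mono F) (auto simp: \<delta>_def)
    also have "\<dots> \<le> \<eta>" using F0 \<eta> by (simp add: field_simps)
    finally have 2: "\<bar>\<integral>x. f x (X l x) * ?D l k x \<partial>\<mu>\<bar> \<le> \<eta>" .
    have 3: "\<bar>dE (X l) (?D l k)\<bar> < \<eta>" using crit[OF that(2)] K1[OF kl(5)] by linarith
    have 4: "\<bar>G k - G l\<bar> < \<eta>" by (rule K2[OF kl(1,2)])
    have "(nrm1 (?D l k))\<^sup>2 = (nrm (\<nabla> (?D l k)))\<^sup>2 + (nrm (?D l k))\<^sup>2"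
      by (simp add: H1_norm_def)
    also have "\<dots> < 6 * \<eta>"
    proof -
      have arith: "w = g - g' + 2 * (E + I) \<Longrightarrow> s \<le> \<eta> \<Longrightarrow> \<bar>I\<bar> \<le> \<eta> \<Longrightarrow> \<bar>E\<bar> < \<eta> \<Longrightarrow> \<bar>g - g'\<bar> < \<eta>
        \<Longrightarrow> w + s < 6 * \<eta>" for w g g' E I s :: real
        by (smt (verit))
      show ?thesis
        by (rule arith[OF gradient_difference_identity[OF XH[of l] XH[of k]] 1 2 3 4[unfolded G_def]])
    qed
    also have "\<dots> \<le> e\<^sup>2" by (simp add: \<eta>_def)
    finally show ?thesis using e by (intro power2_less_imp_less[of _ e]) auto
  qed
  \<comment> \<open>\<open>crit\<close> speaks only of a later member against an earlier one;
    symmetry of the norm covers the other order.\<close>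
  have sym: "nrm1 (?D k l) = nrm1 (?D l k)" for k l
    unfolding H1_norm_eq_trinorm by (simp add: trinorm_diff_eq XH) (rule L2_norm_minus_commute)
  have "nrm1 (?D k l) < e" if "k \<ge> K" "l \<ge> K" for k l
    using key[of k l] key[of l k] that sym[of k l] by (cases "k \<le> l") auto
  then show ?thesis by blast
qed

lemma energy_deriv_trinorm_bound:
  assumes "u \<in> H1 \<Omega>"
  shows "\<exists>C\<ge>0. \<forall>v\<in>H1 \<Omega>. \<bar>dE u v\<bar> \<le> C * tri v"
proof -
  let ?A = "nrm (\<nabla> u) + nrm (\<lambda>x. f x (u x))" and ?c = "sqrt (max 1 (1 / dt))"
  have "\<bar>dE u v\<bar> \<le> (?A * ?c) * tri v" if "v \<in> H1 \<Omega>" for v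
  proof -
    have "\<bar>dE u v\<bar> \<le> ?A * nrm1 v" by (rule energy_deriv_bound[OF assms that])
    also have "\<dots> \<le> ?A * (?c * tri v)" by (intro mult_left_mono H1_norm_le_trinorm dt_pos) simp
    finally show ?thesis by (simp add: mult.assoc)
  qed
  then show ?thesis by (intro exI[of _ "?A * ?c"]) auto
qed

section \<open>Dual norms\<close>

text \<open>The case \<open>t = 0\<close> is covered because division by zero yields 0.\<close>

lemma quotient_le:
  assumes "\<bar>a\<bar> \<le> C * (t :: real)" "C \<ge> 0" "t \<ge> 0"
  shows "\<bar>a\<bar> / t \<le> C"
  using assms by (cases "t = 0") (auto simp: field_simps)

text \<open>A real \<open>Sup\<close> is informative only over a bounded set; continuity of the
  derivative of the energy with respect to \<open>tri\<close> provides the bound.\<close>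

lemma energy_dual_norm_upper:
  assumes u: "u \<in> H1 \<Omega>" and W: "W \<subseteq> H10 \<Omega>"
  shows "0 \<le> dual_norm W u"
    and "w \<in> W \<Longrightarrow> \<not> (AE x in \<mu>. w x = 0) \<Longrightarrow>
      \<bar>dE u w\<bar> \<le> dual_norm W u * tri w"
proof -
  let ?S = "insert 0 ((\<lambda>w. \<bar>dE u w\<bar> / tri w) ` {w \<in> W. \<not> (AE x in \<mu>. w x = 0)})"
  have dt0: "dt \<ge> 0" using dt_pos by simp
  obtain C where C: "C \<ge> 0" "\<forall>v\<in>H1 \<Omega>. \<bar>dE u v\<bar> \<le> C * tri v"
    using energy_deriv_trinorm_bound[OF u] by auto
  have bdd: "bdd_above ?S"
  proof (rule bdd_aboveI)
    fix s assume "s \<in> ?S"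
    then show "s \<le> C" using C W H10_H1 dt0 by (auto intro!: quotient_le)
  qed
  show "0 \<le> dual_norm W u"
    unfolding energy_dual_norm_def by (rule cSup_upper[OF _ bdd]) simp
  assume w: "w \<in> W" "\<not> (AE x in \<mu>. w x = 0)"
  then have "\<bar>dE u w\<bar> / tri w \<le> dual_norm W u"
    unfolding energy_dual_norm_def by (intro cSup_upper bdd) blast
  moreover have "tri w > 0"
  proof -
    have "w \<in> L2 \<Omega>" using w(1) W H10_L2 by blast
    then have "nrm w \<noteq> 0" using w(2) by (simp add: L2_norm_eq_0_iff)
    then have "nrm w > 0" using L2_norm_nonneg[of \<Omega> w] by (simp add: less_le)
    then show ?thesis using L2_norm_le_trinorm[OF dt0, of w] by linarith
  qed
  ultimately show "\<bar>dE u w\<bar> \<le> dual_norm W u * tri w"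
    by (simp add: field_simps)
qed

lemma energy_dual_norm_least:
  assumes "\<And>w. w \<in> W \<Longrightarrow> \<bar>dE u w\<bar> \<le> C * tri w" "C \<ge> 0"
  shows "dual_norm W u \<le> C"
  unfolding energy_dual_norm_def
  by (rule cSup_least) (use assms dt_pos in \<open>auto intro!: quotient_le\<close>)

text \<open>The dual norm says nothing about functions that vanish almost everywhere. For these the
  zero function is a weak gradient, hence by uniqueness so is the chosen one up to a null
  set.\<close>

lemma energy_deriv_AE_zero:
  assumes u: "u \<in> H1 \<Omega>" and v: "v \<in> H1 \<Omega>" and zero: "AE x in \<mu>. v x = 0"
  shows "dE u v = 0"
proof -
  have "has_weak_gradient \<Omega> v (\<lambda>x. 0)"
    unfolding has_weak_gradient_def
  proof
    fix \<phi> assume "\<phi> \<in> test_functions \<Omega>"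
    have "(\<integral>x. v x *\<^sub>R grad \<phi> x \<partial>\<mu>) = 0"
      by (rule integral_eq_zero_AE) (use zero in \<open>auto elim: eventually_mono\<close>)
    then show "(\<integral>x. v x *\<^sub>R grad \<phi> x \<partial>\<mu>) = - (\<integral>x. \<phi> x *\<^sub>R 0 \<partial>\<mu>)" by simp
  qed
  from wgrad_AE_eq[OF H1_L2[OF v] L2_zero this]
  have g: "AE x in \<mu>. \<nabla> v x = 0" .
  show ?thesis
    unfolding energy_deriv_def by (rule integral_eq_zero_AE) (use g zero in eventually_elim, simp)
qed

section \<open>Passage to the limit along the adaptive sequence\<close>

theorem adaptive_ILG_converges:
  fixes V :: "nat \<Rightarrow> ('a \<Rightarrow> real) set"
    and u :: "nat \<Rightarrow> nat \<Rightarrow> 'a \<Rightarrow> real"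
    and U :: "nat \<Rightarrow> 'a \<Rightarrow> real"
  assumes fin_dim: "\<And>N. fin_dim_subspace \<Omega> (V N)"
    and V_mono: "\<And>N. V N \<subseteq> V (Suc N)"
    and \<alpha>: "0 < \<alpha>"
    and alg: "adaptive_ILG \<Omega> f dt \<alpha> V u U"
    and bdd: "\<And>N. bdd_below (range (\<lambda>n. E (u N n)))"
    and q: "0 < q" "q < 1"
    and dis: "\<And>N. dis_residual \<Omega> f dt (V (Suc N)) (U N) \<le> q * dis_residual \<Omega> f dt (V N) (U N)"
    and U_bdd: "bdd_above (range (\<lambda>N. nrm1 (U N)))"
  shows "\<exists>ustar r. strict_mono r \<and> (\<forall>k. U (r k) \<in> H10 \<Omega>) \<and>
    (\<lambda>k. nrm1 (\<lambda>x. U (r k) x - ustar x)) \<longlonglongrightarrow> 0 \<and> weak_solution \<Omega> f ustar"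
proof -
  note sub = fin_dim_subspace_linear[OF fin_dim]
  have dt0: "dt \<ge> 0" using dt_pos by simp
  have V_le: "V M \<subseteq> V N" if "M \<le> N" for M N
    using that V_mono by (rule lift_Suc_mono_le[rotated])
  define stop where "stop N = stopping_index \<Omega> f dt \<alpha> (V N) (u N)" for N
  have u0: "u 0 0 \<in> V 0" and uS: "\<And>N n. u N (Suc n) \<in> V N"
    and step: "\<And>N n. \<forall>v\<in>V N. Bil (u N (Suc n)) v = ell_form \<Omega> f dt (u N n) v"
    and U: "\<And>N. U N = u N (stop N)" and restart: "\<And>N. u (Suc N) 0 = U N"
    using alg unfolding adaptive_ILG_def stop_def by auto
  \<comment> \<open>The algorithm places only \<open>u 0 0\<close> and the proper iterates in their
    spaces; each later initial guess is inherited through nestedness.\<close>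
  have UV': "u N 0 \<in> V N" for N
  proof (induction N)
    case 0
    show ?case by (rule u0)
  next
    case (Suc N)
    have "U N \<in> V N" unfolding U using Suc uS by (cases "stop N") auto
    then show ?case using restart V_mono by auto
  qed
  have uV: "u N n \<in> V N" for N n using UV' uS by (cases n) auto
  have UV: "U N \<in> V N" for N by (simp add: U uV)
  have UH10: "U N \<in> H10 \<Omega>" for N by (rule linear_subspaceD(1)[OF sub UV])
  note UH = H10_H1[OF UH10]
  define \<rho> where "\<rho> N = tri (residual \<Omega> f dt (V N) (U N))" for N
  have \<rho>0: "\<rho> N \<ge> 0" for N using dt0 by (simp add: \<rho>_def)
  have \<rho>_le: "\<rho> N \<le> \<alpha> * (E (u N 0) - E (U N))" for N
  proof -
    let ?P = "\<lambda>n. n \<ge> 1 \<and> tri (residual \<Omega> f dt (V N) (u N n))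
      \<le> \<alpha> * (E (u N 0) - E (u N n))"
    have "\<exists>n. ?P n"
      using stopping_criterion_reached[of "V N" "u N", OF sub uV step \<alpha> bdd] by auto
    \<comment> \<open>The \<open>LEAST\<close> in \<open>stopping_index\<close> has the required
      property only now that some index is known to satisfy it.\<close>
    then have "?P (stop N)" unfolding stop_def stopping_index_def by (rule LeastI_ex)
    then show ?thesis by (simp add: \<rho>_def U)
  qed
  have res: "\<bar>dE (U N) v\<bar> \<le> \<rho> N * tri v" if "v \<in> V N" for N v
    using energy_deriv_residual_bound[OF sub uV uS that step, of "stop N"] by (simp add: \<rho>_def U)
  obtain M where M: "\<And>N. nrm1 (U N) \<le> M" using U_bdd by (auto simp: bdd_above_def)
  have M0: "M \<ge> 0" using M[of 0] H1_norm_nonneg[of "U 0"] by linarith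
  have L2M: "nrm (U N) \<le> M" for N
    using M[of N] L2_norm_le_trinorm[of 1 "U N"] by (simp add: H1_norm_eq_trinorm)
  have \<rho>lim: "\<rho> \<longlonglongrightarrow> 0"
  proof -
    let ?e = "\<lambda>N. E (U N)"
    \<comment> \<open>The initial guess on the next space is the previous final approximation, so
      the bounds telescope; hence the index shift.\<close>
    have le: "\<rho> (Suc N) \<le> \<alpha> * (?e N - ?e (Suc N))" for N
      using \<rho>_le[of "Suc N"] by (simp add: restart)
    have "0 \<le> \<alpha> * (?e N - ?e (Suc N))" for N using le[of N] \<rho>0[of "Suc N"] by linarith
    then have "?e (Suc N) \<le> ?e N" for N using \<alpha> by (simp add: zero_le_mult_iff)
    then have "decseq ?e" by (rule decseq_SucI)
    then obtain l where l: "?e \<longlonglongrightarrow> l"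
      using decseq_convergent[of ?e "- ((nrm (\<lambda>x. f x 0) + L * M) * M)"]
        energy_lower_bound[OF H10_L2[OF UH10] L2M] by blast
    have "(\<lambda>N. \<alpha> * (?e N - ?e (Suc N))) \<longlonglongrightarrow> 0"
      using tendsto_mult[OF tendsto_const tendsto_diff[OF l LIMSEQ_Suc[OF l]], of \<alpha>] by simp
    then have "(\<lambda>N. \<rho> (Suc N)) \<longlonglongrightarrow> 0"
      by (rule tendsto_sandwich[OF _ _ tendsto_const, rotated -1]) (use le \<rho>0 in auto)
    then show ?thesis by (rule LIMSEQ_imp_Suc)
  qed
  obtain r1 :: "nat \<Rightarrow> nat" where r1: "strict_mono r1 \<and>
    (\<forall>e>0. \<exists>K. \<forall>k\<ge>K. \<forall>l\<ge>K. nrm (\<lambda>x. U (r1 k) x - U (r1 l) x) < e)"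
    using Rellich[OF UH10 M] ..
  let ?G = "\<lambda>N. (nrm (\<nabla> (U N)))\<^sup>2"
  have "?G N \<in> {0..M\<^sup>2}" for N
    using L2_norm_wgrad_le_H1_norm[of "U N"] M[of N] by (auto intro: power_mono)
  then have "\<forall>k. ?G (r1 k) \<in> {0..M\<^sup>2}" by blast
  then obtain l r2 where r2: "strict_mono (r2 :: nat \<Rightarrow> nat)" and l: "((\<lambda>k. ?G (r1 k)) \<circ> r2) \<longlonglongrightarrow> l"
    using seq_compactE[of "{0..M\<^sup>2}" "\<lambda>k. ?G (r1 k)", OF compact_imp_seq_compact[OF compact_Icc]] by blast
  define r where "r = r1 \<circ> r2"
  have r: "strict_mono r" unfolding r_def using r1 r2 by (intro strict_mono_o) auto
  define X where "X k = U (r k)" for k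
  have X: "X k \<in> H10 \<Omega>" for k by (simp add: X_def UH10)
  note XH = H10_H1[OF X]
  have XM: "nrm1 (X k) \<le> M" for k by (simp add: X_def M)
  define c where "c = sqrt (max 1 dt)"
  have rlim: "(\<lambda>k. \<rho> (r k)) \<longlonglongrightarrow> 0"
    using LIMSEQ_subseq_LIMSEQ[OF \<rho>lim r] by (simp add: o_def)
  have Cauchy: "\<exists>K. \<forall>k\<ge>K. \<forall>l\<ge>K. nrm1 (\<lambda>x. X k x - X l x) < e" if e: "e > 0" for e
  proof (rule almost_critical_sequence_H1_Cauchy[OF X XM _ _ _ _ e])
    fix e' :: real assume "e' > 0"
    then obtain K where K: "\<And>k l. k \<ge> K \<Longrightarrow> l \<ge> K \<Longrightarrow> nrm (\<lambda>x. U (r1 k) x - U (r1 l) x) < e'"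
      using r1 by blast
    have "nrm (\<lambda>x. X k x - X l x) < e'" if "k \<ge> K" "l \<ge> K" for k l
      unfolding X_def r_def o_def
      using seq_suble[OF r2, of k] seq_suble[OF r2, of l] that by (intro K) auto
    then show "\<exists>K. \<forall>k\<ge>K. \<forall>l\<ge>K. nrm (\<lambda>x. X k x - X l x) < e'" by blast
  next
    show "convergent (\<lambda>k. (nrm (\<nabla> (X k)))\<^sup>2)"
      using l by (auto simp: convergent_def X_def r_def o_def)
  next
    show "(\<lambda>k. \<rho> (r k) * (c * (2 * M))) \<longlonglongrightarrow> 0"
      using tendsto_mult_left_zero[OF rlim] .
  next
    fix k l :: nat assume kl: "k \<le> l"
    then have "r k \<le> r l" using r by (simp add: strict_mono_less_eq)
    \<comment> \<open>Nestedness puts the earlier approximation into the larger space, where the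
      residual bound of the later one applies.\<close>
    then have "(\<lambda>x. X l x - X k x) \<in> V (r l)"
      using UV V_le by (auto simp: X_def intro!: linear_subspaceD(4)[OF sub])
    then have "\<bar>dE (X l) (\<lambda>x. X l x - X k x)\<bar> \<le> \<rho> (r l) * tri (\<lambda>x. X l x - X k x)"
      unfolding X_def by (rule res)
    also have "tri (\<lambda>x. X l x - X k x) \<le> c * nrm1 (\<lambda>x. X l x - X k x)"
      unfolding c_def by (rule trinorm_le_H1_norm[OF dt0])
    also have "nrm1 (\<lambda>x. X l x - X k x) \<le> 2 * M"
      using trinorm_lincomb_le[OF XH[of l] XH[of k], of 1 1 "-1"] XM[of k] XM[of l]
      unfolding H1_norm_eq_trinorm by simp
    finally show "\<bar>dE (X l) (\<lambda>x. X l x - X k x)\<bar> \<le> \<rho> (r l) * (c * (2 * M))"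
      using \<rho>0[of "r l"] by (simp add: c_def mult_left_mono)
  qed
  obtain ustar where us: "ustar \<in> H10 \<Omega>" and lim: "(\<lambda>k. nrm1 (\<lambda>x. X k x - ustar x)) \<longlonglongrightarrow> 0"
    using H10_complete[OF X Cauchy] by metis
  note usH = H10_H1[OF us]
  define h where "h k = nrm1 (\<lambda>x. X k x - ustar x)" for k
  have h0: "h k \<ge> 0" for k by (simp add: h_def)
  have hlim: "h \<longlonglongrightarrow> 0" using lim by (simp add: h_def[abs_def])
  have diff: "\<bar>dE (X k) v - dE ustar v\<bar> \<le> (1 + L) * h k * nrm1 v"
    if "v \<in> H1 \<Omega>" for k v
    unfolding h_def by (rule energy_deriv_diff_bound[OF XH usH that])
  \<comment> \<open>A fixed \<open>v\<close> in \<open>V N\<close> lies in \<open>V (r k)\<close>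
    for every \<open>k \<ge> N\<close>, so both the residual bound and the distance to the limit may
    be sent to zero.\<close>
  have on_V: "dE ustar v = 0" if v: "v \<in> V N" for v N
  proof -
    have vH: "v \<in> H1 \<Omega>" by (rule linear_subspaceD(2)[OF sub v])
    have "(\<lambda>k. \<rho> (r k) * tri v + (1 + L) * h k * nrm1 v) \<longlonglongrightarrow> 0 * tri v + (1 + L) * 0 * nrm1 v"
      by (intro tendsto_intros rlim hlim)
    moreover have "\<bar>dE ustar v\<bar> \<le> \<rho> (r k) * tri v + (1 + L) * h k * nrm1 v"
      if "k \<ge> N" for k
    proof -
      have "N \<le> r k" using that seq_suble[OF r, of k] by simp
      then have "v \<in> V (r k)" using v V_le by blast
      then show ?thesis using res[of v "r k"] diff[OF vH, of k] unfolding X_def by linarith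
    qed
    ultimately have "\<bar>dE ustar v\<bar> \<le> 0 * tri v + (1 + L) * 0 * nrm1 v"
      by (intro LIMSEQ_le_const) blast+
    then show ?thesis by simp
  qed
  define c' where "c' = (1 + L) * sqrt (max 1 (1 / dt))"
  have c': "c' \<ge> 0" using L_nonneg by (simp add: c'_def)
  have diff': "\<bar>dE (X k) v - dE ustar v\<bar> \<le> c' * h k * tri v"
    if "v \<in> H1 \<Omega>" for k v
  proof -
    have "(1 + L) * h k * nrm1 v \<le> (1 + L) * h k * (sqrt (max 1 (1 / dt)) * tri v)"
      using L_nonneg h0 by (intro mult_left_mono H1_norm_le_trinorm dt_pos) auto
    then show ?thesis using diff[OF that, of k] by (simp add: c'_def mult_ac)
  qed
  have full: "dual_norm (H10 \<Omega>) (X k) \<le> c' * h k / (1 - q)" for k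
  proof -
    let ?a = "dual_norm (H10 \<Omega>) (X k)"
      and ?b = "dual_norm (V (r k)) (X k)"
      and ?c = "dual_norm (V (Suc (r k))) (X k)"
    \<comment> \<open>The derivative at the limit vanishes on \<open>V (Suc (r k))\<close>, so only
      its difference from the derivative at \<open>X k\<close> remains.\<close>
    have "?c \<le> c' * h k"
    proof (rule energy_dual_norm_least)
      show "\<bar>dE (X k) w\<bar> \<le> c' * h k * tri w" if "w \<in> V (Suc (r k))" for w
        using diff'[OF linear_subspaceD(2)[OF sub that], of k] on_V[OF that] by simp
    qed (use c' h0 in simp)
    moreover have "?b \<ge> 0" using linear_subspaceD(1)[OF sub] by (intro energy_dual_norm_upper(1) XH) auto
    then have "0 \<le> q * ?b" using q by simp
    \<comment> \<open>Discarding the nonnegative \<open>q * ?b\<close> leaves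
      \<open>?a - ?c \<le> q * ?a\<close>, and \<open>q < 1\<close> allows \<open>?a\<close> to be
      absorbed.\<close>
    moreover have "?a - ?c \<le> q * (?a - ?b)" using dis[of "r k"] by (simp add: dis_residual_def X_def)
    ultimately have "(1 - q) * ?a \<le> c' * h k"
      unfolding left_diff_distrib right_diff_distrib by linarith
    then show ?thesis using q by (simp add: field_simps)
  qed
  have crit: "dE ustar v = 0" if v: "v \<in> H10 \<Omega>" for v
  proof (cases "AE x in \<mu>. v x = 0")
    case True
    then show ?thesis by (rule energy_deriv_AE_zero[OF usH H10_H1[OF v]])
  next
    case False
    have "(\<lambda>k. (c' * h k / (1 - q) + c' * h k) * tri v) \<longlonglongrightarrow> (c' * 0 / (1 - q) + c' * 0) * tri v"
      using q by (intro tendsto_intros hlim) auto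
    moreover have "\<bar>dE ustar v\<bar> \<le> (c' * h k / (1 - q) + c' * h k) * tri v" for k
    proof -
      have "\<bar>dE (X k) v\<bar> \<le> dual_norm (H10 \<Omega>) (X k) * tri v"
        by (rule energy_dual_norm_upper(2)[OF XH _ v False]) simp
      also have "\<dots> \<le> c' * h k / (1 - q) * tri v"
        using dt0 by (intro mult_right_mono full) simp
      finally show ?thesis using diff'[OF H10_H1[OF v], of k] by (simp add: distrib_right)
    qed
    ultimately have "\<bar>dE ustar v\<bar> \<le> (c' * 0 / (1 - q) + c' * 0) * tri v"
      by (intro LIMSEQ_le_const) blast+
    then show ?thesis by simp
  qed
  then have "weak_solution \<Omega> f ustar"
    using us unfolding weak_solution_def energy_deriv_def by blast
  then show ?thesis using r X lim unfolding X_def by blast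
qed

lemma H10_norm_convergence_imp_weak:
  assumes X: "\<And>k. X k \<in> H10 \<Omega>" and u: "u \<in> H10 \<Omega>"
    and lim: "(\<lambda>k. nrm1 (\<lambda>x. X k x - u x)) \<longlonglongrightarrow> 0"
  shows "H10_weakly_converges \<Omega> X u"
  unfolding H10_weakly_converges_def
proof (intro allI impI)
  fix \<Lambda> assume \<Lambda>: "H10_functional \<Omega> \<Lambda>"
  then obtain C where C: "\<forall>v\<in>H10 \<Omega>. \<bar>\<Lambda> v\<bar> \<le> C * nrm1 v"
    unfolding H10_functional_def by blast
  have lin: "\<Lambda> (\<lambda>x. X k x - u x) = \<Lambda> (X k) - \<Lambda> u" for k
  proof -
    have "\<Lambda> (\<lambda>x. 1 * X k x + (- 1) * u x) = 1 * \<Lambda> (X k) + (- 1) * \<Lambda> u"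
      using \<Lambda> X u unfolding H10_functional_def by blast
    then show ?thesis by simp
  qed
  have "(\<lambda>k. \<Lambda> (X k) - \<Lambda> u) \<longlonglongrightarrow> 0"
  proof (rule Lim_null_comparison)
    show "\<forall>\<^sub>F k in sequentially. norm (\<Lambda> (X k) - \<Lambda> u) \<le> C * nrm1 (\<lambda>x. X k x - u x)"
      using C[rule_format, OF H10_diff[OF X u]] by (simp add: lin)
    show "(\<lambda>k. C * nrm1 (\<lambda>x. X k x - u x)) \<longlonglongrightarrow> 0"
      using tendsto_mult_right_zero[OF lim] .
  qed
  then show "(\<lambda>k. \<Lambda> (X k)) \<longlonglongrightarrow> \<Lambda> u" by (simp add: LIM_zero_iff)
qed

end

section \<open>Constants extracted from the structural assumption\<close>

text \<open>Membership bounds the distance of the slope from \<open>- 1 / lam\<close> by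
  \<open>\<rho> + 1 / lam\<close>. The upper bound is thus independent of \<open>lam\<close>, while
  the lower one improves as \<open>lam\<close> grows.\<close>

lemma Lambda_f_derivative_bounds:
  assumes "lam \<in> Lambda_f \<Omega> f \<rho>"
  shows "AE x in lebesgue_on \<Omega>. \<forall>s. - (\<rho> + 2 / lam) \<le> deriv (f x) s \<and> deriv (f x) s \<le> \<rho>"
proof -
  let ?S = "\<lambda>x. SUP s. ereal \<bar>deriv (f x) s + 1 / lam\<bar>"
  have "AE x in lebesgue_on \<Omega>. ?S x \<le> sigma_f \<Omega> f lam"
    unfolding sigma_f_def by (rule esssup_AE)
  then show ?thesis
  proof eventually_elim
    case (elim x)
    show ?case
    proof
      fix s
      have "ereal \<bar>deriv (f x) s + 1 / lam\<bar> \<le> ?S x" by (rule SUP_upper) simp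
      also note elim
      also have "sigma_f \<Omega> f lam < ereal (\<rho> + 1 / lam)" using assms by (simp add: Lambda_f_def)
      finally have "\<bar>deriv (f x) s + 1 / lam\<bar> < \<rho> + 1 / lam" by simp
      then show "- (\<rho> + 2 / lam) \<le> deriv (f x) s \<and> deriv (f x) s \<le> \<rho>" by (auto simp: abs_less_iff)
    qed
  qed
qed

text \<open>\<open>mu_f\<close> is the infimum of \<open>1 / lam\<close> over
  \<open>Lambda_f\<close>, which is 0 when the set is unbounded; the supremum itself need not belong
  to the set, hence the slack \<open>e\<close>.\<close>

lemma mu_f_approximation:
  assumes A: "Lambda_f \<Omega> f \<rho> \<noteq> {}" and e: "e > 0"
  obtains lam where "lam \<in> Lambda_f \<Omega> f \<rho>" "1 / lam < mu_f \<Omega> f \<rho> + e"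
proof (cases "bdd_above (Lambda_f \<Omega> f \<rho>)")
  case True
  let ?S = "Sup (Lambda_f \<Omega> f \<rho>)"
  obtain lam0 where lam0: "lam0 \<in> Lambda_f \<Omega> f \<rho>" using A by blast
  then have "0 < lam0" "lam0 \<le> ?S" using True by (auto simp: Lambda_f_def intro: cSup_upper)
  then have S: "?S > 0" by simp
  have mu: "mu_f \<Omega> f \<rho> = 1 / ?S" using True by (simp add: mu_f_def inverse_eq_divide)
  have "1 / (1 / ?S + e) < ?S" using S e by (simp add: field_simps add_pos_pos)
  then obtain lam where lam: "lam \<in> Lambda_f \<Omega> f \<rho>" "1 / (1 / ?S + e) < lam"
    using less_cSup_iff[OF A True] by blast
  have "1 / ?S + e > 0" using S e by (simp add: add_pos_pos)
  then have "1 / lam < 1 / ?S + e"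
    using lam by (auto simp: Lambda_f_def field_simps)
  then show ?thesis using that[OF lam(1)] mu by simp
next
  case False
  then obtain lam where lam: "lam \<in> Lambda_f \<Omega> f \<rho>" "1 / e < lam"
    unfolding bdd_above_def by (auto simp: not_le)
  then have "1 / lam < e" using e by (auto simp: Lambda_f_def field_simps)
  then show ?thesis using that[OF lam(1)] False by (simp add: mu_f_def)
qed

theorem theorem4p3:
  fixes \<Omega> :: "'a::euclidean_space set"
    and f :: "'a \<Rightarrow> real \<Rightarrow> real"
    and \<rho> C\<^sub>P dt \<alpha> q :: real
    and V :: "nat \<Rightarrow> ('a \<Rightarrow> real) set"
    and u :: "nat \<Rightarrow> nat \<Rightarrow> 'a \<Rightarrow> real"
    and U :: "nat \<Rightarrow> 'a \<Rightarrow> real"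
  assumes "DIM('a) \<in> {1, 2, 3}"
    and "polytopal_domain \<Omega>"
    and "poincare_constant \<Omega> C\<^sub>P"
    and "\<And>s. (\<lambda>x. f x s) \<in> borel_measurable (lebesgue_on \<Omega>)"
    and "\<rho> > 0"
    and "assumption_A \<Omega> f \<rho>"
    and "dt \<in> Lambda_f \<Omega> f \<rho>"
    and "1 / dt > kappa_f \<Omega> f \<rho> C\<^sub>P"
    and "\<And>N. fin_dim_subspace \<Omega> (V N)"
    and "\<And>N. V N \<subseteq> V (Suc N)"
    and "0 < \<alpha>" and "\<alpha> < 1"
    and "adaptive_ILG \<Omega> f dt \<alpha> V u U"
    and "\<And>N. bdd_below (range (\<lambda>n. energy \<Omega> f (u N n)))"
    and "0 < q" and "q < 1"
    and "\<And>N. dis_residual \<Omega> f dt (V (Suc N)) (U N) \<le> q * dis_residual \<Omega> f dt (V N) (U N)"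
    and "bdd_above (range (\<lambda>N. H1_norm \<Omega> (U N)))"
  shows "\<exists>ustar r. strict_mono r \<and>
           H10_weakly_converges \<Omega> (\<lambda>k. U (r k)) ustar \<and>
           (\<lambda>k. L2_norm \<Omega> (\<lambda>x. U (r k) x - ustar x)) \<longlonglongrightarrow> 0 \<and>
           weak_solution \<Omega> f ustar \<and>
           (continuous_up_to_boundary \<Omega> f \<longrightarrow>
             (\<exists>s. strict_mono s \<and>
                (\<lambda>k. H1_norm \<Omega> (\<lambda>x. U (r (s k)) x - ustar x)) \<longlonglongrightarrow> 0))"
proof -
  have dt: "dt > 0" using assms(7) by (simp add: Lambda_f_def)
  \<comment> \<open>The slack in the step restriction is spent on approximating
    \<open>mu_f\<close>.\<close>
  define e where "e = 1 / dt - kappa_f \<Omega> f \<rho> C\<^sub>P"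
  have e: "e > 0" using assms(8) by (simp add: e_def)
  have kappa: "mu_f \<Omega> f \<rho> + \<rho> / 2 - 1 / (2 * C\<^sub>P) \<le> kappa_f \<Omega> f \<rho> C\<^sub>P"
    by (simp add: kappa_f_def)
  obtain lam where lam: "lam \<in> Lambda_f \<Omega> f \<rho>" "1 / lam < mu_f \<Omega> f \<rho> + e"
    using mu_f_approximation[of \<Omega> f \<rho> e] assms(6) e by (auto simp: assumption_A_def)
  \<comment> \<open>The Lipschitz constant is read off at \<open>dt\<close>, the one-sided constant
    at the near-optimal \<open>lam\<close>.\<close>
  define L K where "L = \<rho> + 2 / dt" and "K = \<rho> + 2 / lam"
  have K2: "K / 2 = \<rho> / 2 + 1 / lam" by (simp add: K_def add_divide_distrib)
  have diffable: "(f x has_real_derivative deriv (f x) s) (at s)" if "x \<in> \<Omega>" for x s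
    using assms(6) that DERIV_deriv_iff_real_differentiable by (auto simp: assumption_A_def)
  interpret semilinear_problem \<Omega> f L K dt C\<^sub>P
  proof
    show "open \<Omega>" "bounded \<Omega>" using assms(2) by (auto simp: polytopal_domain_def)
    show "(\<lambda>x. f x s) \<in> borel_measurable (lebesgue_on \<Omega>)" for s by (rule assms(4))
    show "continuous_on UNIV (f x)" if "x \<in> \<Omega>" for x
      by (intro continuous_at_imp_continuous_on ballI DERIV_isCont[OF diffable[OF that]])
    show "(\<lambda>x. f x 0) \<in> L2 \<Omega>" using assms(6) by (simp add: assumption_A_def)
    show "L \<ge> 0" using assms(5) dt by (simp add: L_def)
    show "dt > 0" by (rule dt)
    show "poincare_constant \<Omega> C\<^sub>P" by (rule assms(3))
    \<comment> \<open>\<open>K / 2 < \<rho> / 2 + mu_f \<Omega> f \<rho> + e\<close>, which is at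
      most \<open>kappa_f \<Omega> f \<rho> C\<^sub>P + 1 / (2 * C\<^sub>P) + e\<close>, and the
      first and last terms of this sum add up to \<open>1 / dt\<close>.\<close>
    show "1 / dt - K / 2 + 1 / (2 * C\<^sub>P) > 0" unfolding K2 using lam(2) kappa by (simp add: e_def)
    show "AE x in lebesgue_on \<Omega>. \<forall>s t. \<bar>f x s - f x t\<bar> \<le> L * \<bar>s - t\<bar>"
      using Lambda_f_derivative_bounds[OF assms(7)] AE_space
    proof eventually_elim
      case (elim x)
      then have x: "x \<in> \<Omega>" by simp
      have "\<bar>deriv (f x) s\<bar> \<le> L" for s
      proof -
        have "2 / dt > 0" using dt by simp
        then show ?thesis using elim(1)[rule_format, of s] unfolding L_def abs_le_iff by linarith
      qed
      then show ?case
        using field_differentiable_bound[of UNIV "f x" "deriv (f x)" L] diffable[OF x] by auto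
    qed
    show "AE x in lebesgue_on \<Omega>. \<forall>s t. s \<le> t \<longrightarrow> f x t - f x s \<ge> - K * (t - s)"
      using Lambda_f_derivative_bounds[OF lam(1)] AE_space
    proof eventually_elim
      case (elim x)
      then have x: "x \<in> \<Omega>" by simp
      \<comment> \<open>One-sided monotonicity is the statement that adding \<open>K * s\<close>
        makes \<open>f x\<close> nondecreasing.\<close>
      have "f x s + K * s \<le> f x t + K * t" if "s \<le> t" for s t
        using that
      proof (rule DERIV_nonneg_imp_nondecreasing)
        fix r
        have "((\<lambda>r. f x r + K * r) has_real_derivative deriv (f x) r + K) (at r)"
          by (auto intro!: derivative_eq_intros diffable[OF x])
        moreover have "0 \<le> deriv (f x) r + K" using elim(1)[rule_format, of r] by (simp add: K_def)
        ultimately show "\<exists>y. ((\<lambda>r. f x r + K * r) has_real_derivative y) (at r) \<and> 0 \<le> y" by blast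
      qed
      then show ?case by (simp add: algebra_simps)
    qed
  qed
  obtain ustar r where r: "strict_mono r" and X: "\<forall>k. U (r k) \<in> H10 \<Omega>"
    and lim: "(\<lambda>k. H1_norm \<Omega> (\<lambda>x. U (r k) x - ustar x)) \<longlonglongrightarrow> 0" and sol: "weak_solution \<Omega> f ustar"
    using adaptive_ILG_converges[OF assms(9,10,11,13,14,15,16,17,18)] by blast
  have us: "ustar \<in> H10 \<Omega>" using sol by (simp add: weak_solution_def)
  have "H10_weakly_converges \<Omega> (\<lambda>k. U (r k)) ustar"
    by (rule H10_norm_convergence_imp_weak[OF _ us lim]) (use X in blast)
  moreover have "(\<lambda>k. L2_norm \<Omega> (\<lambda>x. U (r k) x - ustar x)) \<longlonglongrightarrow> 0"
    by (rule tendsto_sandwich[OF _ _ tendsto_const lim])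
      (use L2_norm_le_trinorm[of 1] in \<open>auto simp: H1_norm_eq_trinorm\<close>)
  \<comment> \<open>Convergence along \<open>r\<close> is already in the H1 norm, so the identity
    serves as the further subsequence.\<close>
  moreover have "\<exists>s. strict_mono s \<and> (\<lambda>k. H1_norm \<Omega> (\<lambda>x. U (r (s k)) x - ustar x)) \<longlonglongrightarrow> 0"
    using lim by (intro exI[of _ id]) (auto simp: strict_mono_def)
  ultimately show ?thesis using r sol by blast
qed

end
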